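(* Assume $q<r<qe$. Then for any $\delta>0$ there exist $K>0$ and $h_0>0$ such that for all $h\in(0,h_0)$, $$\sup_{(t,x)\in[0,T-\delta]\times\overline\Omega}|u^h(t,x)-u(t,x)|\le K\sqrt{h}\,|\log h| .$$
   Context: Let $T>0$, $q>0$, $r>0$, $\Omega=(-1,1)$, $\alpha=(r-q-1)/2$, $\beta=\alpha^2+r$, and $\varphi(x)=e^{\alpha x}\max(e^x-1,0)$. The function $u$ is the unique solution, in the a.e. sense and in the viscosity sense, belonging to $C([0,T)\times\overline\Omega)$ and with $u,u_t,u_x,u_{xx}\in L^2((0,T)\times\Omega)$, of the obstacle problem $$\min\{u_t-u_{xx}+\beta u,\;u-\varphi\}=0\ \text{in }(0,T)\times\Omega,\quad u(0,x)=\varphi(x)\ (x\in\overline\Omega),\quad u(t,\pm1)=\varphi(\pm1)\ (t\in(0,T)).$$ Let $[s]$ denote the integer part of $s\in\mathbb R$. For $h>0$ put $u_0=\varphi$ and, for $m=1,2,\dots,[T/h]$, let $u_m$ be the unique minimizer of $$J_m(v)=\frac12\int_\Omega\Big\{\frac{|v-u_{m-1}|^2}{h}+(v_x)^2+\beta v^2\Big\}dx$$ over $\mathcal K=\{v\in H^1(\Omega): v-\varphi\in H^1_0(\Omega),\ v\ge\varphi\text{ a.e. in }\Omega\}$. Define $u^h(t,x)=u_m(x)$ for $t\in[mh,(m+1)h)$, $x\in\overline\Omega$, $m=0,1,\dots,[T/h]$. *)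

theory Defs
  imports "HOL-Analysis.Analysis"
begin

section \<open>Sobolev spaces\<close>

text \<open>Elements of \<open>L\<^sup>2\<close> and of the Sobolev spaces are represented by functions on the whole
  type; only their restriction to \<open>S\<close>, up to null sets, matters.\<close>

definition L2 :: "'a::euclidean_space set \<Rightarrow> ('a \<Rightarrow> real) set" where
  "L2 S = {f. f \<in> borel_measurable (lebesgue_on S) \<and>
              integrable (lebesgue_on S) (\<lambda>x. (f x)\<^sup>2)}"

fun C_k :: "nat \<Rightarrow> ('a::euclidean_space \<Rightarrow> real) \<Rightarrow> bool" where
  "C_k 0 f \<longleftrightarrow> continuous_on UNIV f"
| "C_k (Suc k) f \<longleftrightarrow> (\<forall>x. f differentiable (at x)) \<and>
     (\<forall>b\<in>Basis. C_k k (\<lambda>x. frechet_derivative f (at x) b))"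

definition test_functions :: "'a::euclidean_space set \<Rightarrow> ('a \<Rightarrow> real) set" where
  "test_functions S = {\<psi>. (\<forall>k. C_k k \<psi>) \<and>
     compact (closure {x. \<psi> x \<noteq> 0}) \<and> closure {x. \<psi> x \<noteq> 0} \<subseteq> S}"

definition has_weak_partial ::
  "'a::euclidean_space set \<Rightarrow> 'a \<Rightarrow> ('a \<Rightarrow> real) \<Rightarrow> ('a \<Rightarrow> real) \<Rightarrow> bool" where
  "has_weak_partial S b v g \<longleftrightarrow> v \<in> L2 S \<and> g \<in> L2 S \<and>
     (\<forall>\<psi>\<in>test_functions S.
        (\<integral>x. v x * frechet_derivative \<psi> (at x) b \<partial>lebesgue_on S)
          = - (\<integral>x. g x * \<psi> x \<partial>lebesgue_on S))"

text \<open>A weak derivative is determined almost everywhere; the choice below is only used under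
  integrals.\<close>

definition weak_partial ::
  "'a::euclidean_space set \<Rightarrow> 'a \<Rightarrow> ('a \<Rightarrow> real) \<Rightarrow> ('a \<Rightarrow> real)" where
  "weak_partial S b v = (SOME g. has_weak_partial S b v g)"

definition H1 :: "'a::euclidean_space set \<Rightarrow> ('a \<Rightarrow> real) set" where
  "H1 S = {v \<in> L2 S. \<forall>b\<in>Basis. \<exists>g. has_weak_partial S b v g}"

text \<open>\<open>H\<^sup>1\<^sub>0\<close> is the closure of the test functions in the \<open>H\<^sup>1\<close> norm.\<close>

definition H10 :: "'a::euclidean_space set \<Rightarrow> ('a \<Rightarrow> real) set" where
  "H10 S = {v \<in> H1 S. \<exists>\<psi>::nat \<Rightarrow> 'a \<Rightarrow> real. (\<forall>n. \<psi> n \<in> test_functions S) \<and>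
     (\<lambda>n. \<integral>x. (v x - \<psi> n x)\<^sup>2 \<partial>lebesgue_on S) \<longlonglongrightarrow> 0 \<and>
     (\<forall>b\<in>Basis. (\<lambda>n. \<integral>x. (weak_partial S b v x - frechet_derivative (\<psi> n) (at x) b)\<^sup>2
                          \<partial>lebesgue_on S) \<longlonglongrightarrow> 0)}"


section \<open>The obstacle problem\<close>

abbreviation Omega :: "real set" where
  "Omega \<equiv> {-1<..<1}"

abbreviation Omega_bar :: "real set" where
  "Omega_bar \<equiv> {-1..1}"

definition alpha :: "real \<Rightarrow> real \<Rightarrow> real" where
  "alpha q r = (r - q - 1) / 2"

definition beta :: "real \<Rightarrow> real \<Rightarrow> real" where
  "beta q r = (alpha q r)\<^sup>2 + r"

definition obstacle :: "real \<Rightarrow> real \<Rightarrow> real \<Rightarrow> real" where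
  "obstacle q r x = exp (alpha q r * x) * max (exp x - 1) 0"

text \<open>Points of space-time are pairs \<open>(t, x)\<close>, so \<open>(1, 0)\<close> is the time direction and
  \<open>(0, 1)\<close> the space direction.\<close>

definition ae_solution ::
  "real \<Rightarrow> real \<Rightarrow> (real \<Rightarrow> real) \<Rightarrow> (real \<times> real \<Rightarrow> real) \<Rightarrow> bool" where
  "ae_solution T b \<phi> u \<longleftrightarrow>
     (let Q = {0<..<T} \<times> Omega in
      \<exists>ut ux uxx. has_weak_partial Q (1, 0) u ut \<and> has_weak_partial Q (0, 1) u ux \<and>
        has_weak_partial Q (0, 1) ux uxx \<and>
        (AE p in lebesgue_on Q. min (ut p - uxx p + b * u p) (u p - \<phi> (snd p)) = 0))"

definition C12_with_derivs ::
  "(real \<times> real) set \<Rightarrow> (real \<times> real \<Rightarrow> real) \<Rightarrow> (real \<times> real \<Rightarrow> real) \<Rightarrow>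
   (real \<times> real \<Rightarrow> real) \<Rightarrow> (real \<times> real \<Rightarrow> real) \<Rightarrow> bool" where
  "C12_with_derivs Q \<psi> \<psi>t \<psi>x \<psi>xx \<longleftrightarrow>
     continuous_on Q \<psi> \<and> continuous_on Q \<psi>t \<and> continuous_on Q \<psi>x \<and> continuous_on Q \<psi>xx \<and>
     (\<forall>t x. (t, x) \<in> Q \<longrightarrow>
        ((\<lambda>s. \<psi> (s, x)) has_real_derivative \<psi>t (t, x)) (at t) \<and>
        ((\<lambda>y. \<psi> (t, y)) has_real_derivative \<psi>x (t, x)) (at x) \<and>
        ((\<lambda>y. \<psi>x (t, y)) has_real_derivative \<psi>xx (t, x)) (at x))"

definition viscosity_subsolution ::
  "real \<Rightarrow> real \<Rightarrow> (real \<Rightarrow> real) \<Rightarrow> (real \<times> real \<Rightarrow> real) \<Rightarrow> bool" where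
  "viscosity_subsolution T b \<phi> u \<longleftrightarrow>
     (let Q = {0<..<T} \<times> Omega in
      \<forall>\<psi> \<psi>t \<psi>x \<psi>xx. \<forall>p\<in>Q. C12_with_derivs Q \<psi> \<psi>t \<psi>x \<psi>xx \<longrightarrow>
        (\<forall>\<^sub>F z in nhds p. u z - \<psi> z \<le> u p - \<psi> p) \<longrightarrow>
        min (\<psi>t p - \<psi>xx p + b * u p) (u p - \<phi> (snd p)) \<le> 0)"

definition viscosity_supersolution ::
  "real \<Rightarrow> real \<Rightarrow> (real \<Rightarrow> real) \<Rightarrow> (real \<times> real \<Rightarrow> real) \<Rightarrow> bool" where
  "viscosity_supersolution T b \<phi> u \<longleftrightarrow>
     (let Q = {0<..<T} \<times> Omega in
      \<forall>\<psi> \<psi>t \<psi>x \<psi>xx. \<forall>p\<in>Q. C12_with_derivs Q \<psi> \<psi>t \<psi>x \<psi>xx \<longrightarrow>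
        (\<forall>\<^sub>F z in nhds p. u z - \<psi> z \<ge> u p - \<psi> p) \<longrightarrow>
        min (\<psi>t p - \<psi>xx p + b * u p) (u p - \<phi> (snd p)) \<ge> 0)"

definition obstacle_problem_solution ::
  "real \<Rightarrow> real \<Rightarrow> (real \<Rightarrow> real) \<Rightarrow> (real \<times> real \<Rightarrow> real) \<Rightarrow> bool" where
  "obstacle_problem_solution T b \<phi> u \<longleftrightarrow>
     continuous_on ({0..<T} \<times> Omega_bar) u \<and>
     ae_solution T b \<phi> u \<and>
     viscosity_subsolution T b \<phi> u \<and> viscosity_supersolution T b \<phi> u \<and>
     (\<forall>x\<in>Omega_bar. u (0, x) = \<phi> x) \<and>
     (\<forall>t\<in>{0<..<T}. u (t, -1) = \<phi> (-1) \<and> u (t, 1) = \<phi> 1)"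


section \<open>The minimizing movement scheme\<close>

definition admissible :: "(real \<Rightarrow> real) \<Rightarrow> (real \<Rightarrow> real) set" where
  "admissible \<phi> = {v \<in> H1 Omega. (\<lambda>x. v x - \<phi> x) \<in> H10 Omega \<and>
                     (AE x in lebesgue_on Omega. v x \<ge> \<phi> x)}"

definition energy ::
  "real \<Rightarrow> real \<Rightarrow> (real \<Rightarrow> real) \<Rightarrow> (real \<Rightarrow> real) \<Rightarrow> real" where
  "energy b h w v = 1 / 2 * (\<integral>x. \<bar>v x - w x\<bar>\<^sup>2 / h + (weak_partial Omega 1 v x)\<^sup>2
                                   + b * (v x)\<^sup>2 \<partial>lebesgue_on Omega)"

text \<open>The sequence \<open>U\<close> of successive minimizers for the step size \<open>h\<close>. Elements of
  \<open>H\<^sup>1(-1,1)\<close> are identified with their representative that is continuous on \<open>[-1,1]\<close>, which is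
  what gives the pointwise values of \<open>U m\<close> a meaning.\<close>

definition minimizing_scheme ::
  "real \<Rightarrow> real \<Rightarrow> (real \<Rightarrow> real) \<Rightarrow> real \<Rightarrow> (nat \<Rightarrow> real \<Rightarrow> real) \<Rightarrow> bool" where
  "minimizing_scheme T b \<phi> h U \<longleftrightarrow>
     U 0 = \<phi> \<and>
     (\<forall>m. 1 \<le> m \<and> m \<le> nat \<lfloor>T / h\<rfloor> \<longrightarrow>
        continuous_on Omega_bar (U m) \<and>
        is_arg_min (energy b h (U (m - 1))) (\<lambda>v. v \<in> admissible \<phi>) (U m))"

text \<open>For \<open>0 \<le> t \<le> T\<close>, the index \<open>m\<close> with \<open>t \<in> [m h, (m + 1) h)\<close> is the floor of \<open>t / h\<close>.\<close>

definition interpolant :: "real \<Rightarrow> (nat \<Rightarrow> real \<Rightarrow> real) \<Rightarrow> real \<times> real \<Rightarrow> real" where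
  "interpolant h U = (\<lambda>(t, x). U (nat \<lfloor>t / h\<rfloor>) x)"

end

theory Submission
  imports Defs
begin

text \<open>One step of the scheme is the obstacle problem \<open>min {(U - w) / h - U'' + b U, U - \<phi>} = 0\<close>, and
  testing the Euler-Lagrange inequality with smoothed tents shows that the minimizer can be touched from
  above by functions with the right second derivative, everywhere, and coincides with them off the contact
  set. Two maximum principles follow.

  First, the increments \<open>U (k + 1) - U k\<close> are dominated, up to \<open>O(h)\<close>, by the discrete heat kernel started at
  the kink of the obstacle, whose maximum is \<open>O(sqrt (h / k))\<close>; so \<open>U n - U m\<close> is at most
  \<open>sqrt h (sqrt n - sqrt m) + O(h (n - m))\<close>.

  Second, \<open>u(t)\<close> and \<open>U k\<close> can be compared for independent \<open>t\<close> and \<open>k\<close>: both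
  \<open>u(t) - U k \<le> M exp (a t) / (1 + a h)^k\<close> and \<open>U k - u(t) \<le> M exp (- a t) / (1 - a h)^k\<close> hold for every
  \<open>a\<close>, by induction on \<open>k\<close> and the viscosity inequalities. With \<open>n = t / h\<close>, \<open>a h\<close> of order \<open>1 / sqrt n\<close> and \<open>k\<close>
  shifted from \<open>n\<close> by \<open>O(sqrt n \<bar>log h\<bar>)\<close> indices, the error terms are \<open>O(sqrt h)\<close>, and by the growth bound the
  shift of \<open>k\<close> costs \<open>O(sqrt h \<bar>log h\<bar>)\<close>.\<close>

section \<open>Smooth functions on the line\<close>

text \<open>The convex kink of the obstacle lets the solution grow like the square root of t near t
  = 0, so summing consistency errors of u in the scheme would require time regularity that is
  missing. Comparing u(t) with \<open>U k\<close> for unrelated t and k avoids this: the only time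
  regularity used is an upper bound for the growth of the iterates, and both one-sided errors use it
  in the direction of increasing index. The exponential factors are Chernoff bounds. For the heat
  equation, k implicit Euler steps amount to running the flow for a sum of k independent exponential
  times of mean h. This random time has mean k h and standard deviation h sqrt k; exp (a t) / (1 + a
  h)^k bounds the probability that it is at most t, and exp (- a t) / (1 - a h)^k the probability
  that it is at least t. Moving k by a multiple of sqrt n |log h| brings the relevant probability
  down to order sqrt h, and the logarithm in the rate is the price of this tail bound.\<close>

definition smooth :: "(real \<Rightarrow> real) \<Rightarrow> bool" where
  "smooth f \<longleftrightarrow> (\<forall>k. C_k k f)"

lemma frechet_derivative_real:
  assumes "(f has_real_derivative d) (at x)"
  shows "frechet_derivative f (at x) b = d * b"
proof -
  have "(f has_derivative (\<lambda>y. d * y)) (at x)"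
    using assms by (simp add: has_field_derivative_def)
  from frechet_derivative_at[OF this] show ?thesis by metis
qed

lemma C_k_Suc_real:
  fixes f :: "real \<Rightarrow> real"
  assumes "\<And>x. (f has_real_derivative f' x) (at x)"
  shows "C_k (Suc k) f \<longleftrightarrow> C_k k f'"
proof -
  have "f differentiable (at x)" for x
    using assms by (metis differentiableI has_field_derivative_def)
  then show ?thesis
    by (simp add: frechet_derivative_real[OF assms])
qed

lemma smooth_iff:
  assumes "\<And>x. (f has_real_derivative f' x) (at x)"
  shows "smooth f \<longleftrightarrow> smooth f'"
proof
  assume "smooth f"
  then show "smooth f'" using C_k_Suc_real[of f f', OF assms] by (auto simp: smooth_def)
next
  assume s: "smooth f'"
  have "C_k k f" for k
  proof (cases k)
    case 0
    have "continuous_on UNIV f" using assms DERIV_isCont continuous_at_imp_continuous_on by blast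
    then show ?thesis using 0 by simp
  next
    case (Suc n)
    then show ?thesis using C_k_Suc_real[of f f', OF assms] s by (auto simp: smooth_def)
  qed
  then show "smooth f" by (simp add: smooth_def)
qed

lemma smooth_has_deriv:
  assumes "smooth f" shows "(f has_real_derivative deriv f x) (at x)"
proof -
  have "C_k (Suc 0) f" using assms by (auto simp: smooth_def)
  then have "f differentiable (at x)" by simp
  then show ?thesis
    by (simp add: DERIV_deriv_iff_real_differentiable)
qed

lemma smooth_deriv: "smooth f \<Longrightarrow> smooth (deriv f)"
  using smooth_iff smooth_has_deriv by blast

lemma smooth_continuous: "smooth f \<Longrightarrow> continuous_on S f"
  by (metis DERIV_isCont continuous_at_imp_continuous_on smooth_has_deriv)

lemma smooth_frechet: "smooth f \<Longrightarrow> frechet_derivative f (at x) 1 = deriv f x"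
  using frechet_derivative_real[OF smooth_has_deriv] by simp

text \<open>Induction on the order of differentiability, run for all members of \<open>S\<close> at
  once. It suits families that are closed under differentiation although the higher derivatives have
  no convenient closed form.\<close>

lemma smooth_coinduct:
  assumes "f \<in> S" "\<And>f. f \<in> S \<Longrightarrow> \<exists>f'\<in>S. \<forall>x. (f has_real_derivative f' x) (at x)"
  shows "smooth f"
proof -
  have "\<forall>f\<in>S. C_k k f" for k
  proof (induction k)
    case 0
    show ?case
    proof
      fix f assume "f \<in> S"
      from assms(2)[OF this] obtain f' where "\<And>x. (f has_real_derivative f' x) (at x)" by auto
      then have "continuous_on UNIV f" using DERIV_isCont continuous_at_imp_continuous_on by blast
      then show "C_k 0 f" by simp
    qed
  next
    case (Suc k)
    show ?case
    proof
      fix f assume "f \<in> S"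
      from assms(2)[OF this] obtain f' where "f' \<in> S" "\<forall>x. (f has_real_derivative f' x) (at x)" by auto
      then show "C_k (Suc k) f" using Suc C_k_Suc_real[of f f'] by blast
    qed
  qed
  then show ?thesis using assms(1) by (auto simp: smooth_def)
qed

lemma C_k_Suc_D:
  fixes f :: "real \<Rightarrow> real"
  assumes "C_k (Suc k) f"
  shows "(f has_real_derivative deriv f x) (at x)" "C_k k (deriv f)"
proof -
  have d: "(f has_real_derivative deriv f x) (at x)" for x
    using assms by (simp add: DERIV_deriv_iff_real_differentiable)
  show "(f has_real_derivative deriv f x) (at x)" by fact
  show "C_k k (deriv f)" using C_k_Suc_real[OF d] assms by simp
qed

lemma C_k_SucI:
  fixes f :: "real \<Rightarrow> real"
  assumes "\<And>x. (f has_real_derivative f' x) (at x)" "C_k k f'"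
  shows "C_k (Suc k) f"
  using C_k_Suc_real[of f f', OF assms(1)] assms(2) by simp

lemma C_k_add:
  fixes f g :: "real \<Rightarrow> real"
  shows "C_k k f \<Longrightarrow> C_k k g \<Longrightarrow> C_k k (\<lambda>x. f x + g x)"
proof (induction k arbitrary: f g)
  case 0 then show ?case by (auto intro: continuous_on_add)
next
  case (Suc k)
  have "((\<lambda>x. f x + g x) has_real_derivative deriv f x + deriv g x) (at x)" for x
    by (intro DERIV_add C_k_Suc_D(1)[OF Suc.prems(1)] C_k_Suc_D(1)[OF Suc.prems(2)])
  moreover have "C_k k (\<lambda>x. deriv f x + deriv g x)"
    using Suc.IH C_k_Suc_D(2) Suc.prems by blast
  ultimately show ?case by (rule C_k_SucI)
qed

lemma smooth_add: "smooth f \<Longrightarrow> smooth g \<Longrightarrow> smooth (\<lambda>x. f x + g x)"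
  by (simp add: smooth_def C_k_add)

lemma smooth_mult:
  assumes "smooth f" "smooth g" shows "smooth (\<lambda>x. f x * g x)"
proof -
  have "smooth f \<Longrightarrow> smooth g \<Longrightarrow> C_k k (\<lambda>x. f x * g x)" for k f g
  proof (induction k arbitrary: f g)
    case 0
    then show ?case by (auto intro: continuous_on_mult smooth_continuous)
  next
    case (Suc k)
    have "((\<lambda>x. f x * g x) has_real_derivative deriv f x * g x + f x * deriv g x) (at x)" for x
      by (rule DERIV_mult'[OF smooth_has_deriv[OF Suc.prems(1)] smooth_has_deriv[OF Suc.prems(2)], THEN DERIV_cong]) simp
    moreover have "C_k k (\<lambda>x. deriv f x * g x + f x * deriv g x)"
      using Suc smooth_deriv by (intro C_k_add) blast+
    ultimately show ?case by (rule C_k_SucI)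
  qed
  then show ?thesis using assms by (simp add: smooth_def)
qed

lemma smooth_const: "smooth (\<lambda>x. c)"
  by (rule smooth_coinduct[where S="range (\<lambda>c x. c)"]) (auto intro: DERIV_const)

lemma smooth_affine_compose:
  assumes "smooth f" shows "smooth (\<lambda>x. f (a * x + b))"
proof (rule smooth_coinduct[where S="{\<lambda>x. c * g (a * x + b) |c g. smooth g}"])
  show "(\<lambda>x. f (a * x + b)) \<in> {\<lambda>x. c * g (a * x + b) |c g. smooth g}"
    by (rule CollectI, rule exI[of _ 1], rule exI[of _ f]) (simp add: assms)
next
  fix h assume "h \<in> {\<lambda>x. c * g (a * x + b) |c g. smooth g}"
  then obtain c g where h: "h = (\<lambda>x. c * g (a * x + b))" "smooth g" by auto
  have "(h has_real_derivative (c * a) * deriv g (a * x + b)) (at x)" for x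
    unfolding h(1)
    by (rule derivative_eq_intros DERIV_chain'[OF _ smooth_has_deriv[OF h(2)]] refl | simp)+
  moreover have "(\<lambda>x. (c * a) * deriv g (a * x + b)) \<in> {\<lambda>x. c * g (a * x + b) |c g. smooth g}"
    using smooth_deriv[OF h(2)] by blast
  ultimately show "\<exists>f'\<in>{\<lambda>x. c * g (a * x + b) |c g. smooth g}. \<forall>x. (h has_real_derivative f' x) (at x)"
    by (intro bexI[of _ "\<lambda>x. (c * a) * deriv g (a * x + b)"]) auto
qed

section \<open>A smooth bump and its antiderivatives\<close>

definition flat_exp :: "real \<Rightarrow> real" where
  "flat_exp x = (if x > 0 then exp (- (1 / x)) else 0)"

lemma poly_times_exp_minus_tendsto_0:
  fixes p :: "real poly"
  shows "((\<lambda>y. poly p y * exp (- y)) \<longlongrightarrow> 0) at_top"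
proof -
  have "((\<lambda>y. coeff p i * (y ^ i * exp (- y))) \<longlongrightarrow> 0) at_top" for i
    using tendsto_mult[OF tendsto_const tendsto_power_div_exp_0[of i], of "coeff p i"]
    by (simp add: exp_minus divide_inverse)
  then have "((\<lambda>y. \<Sum>i\<le>degree p. coeff p i * (y ^ i * exp (- y))) \<longlongrightarrow> (\<Sum>i\<le>degree p. 0)) at_top"
    by (intro tendsto_sum)
  then show ?thesis by (simp add: poly_altdef sum_distrib_right mult.assoc)
qed

lemma smooth_flat_exp: "smooth flat_exp"
proof (rule smooth_coinduct[where S="range (\<lambda>p x. if x > 0 then poly p (1 / x) * exp (- (1 / x)) else 0)"])
  show "flat_exp \<in> range (\<lambda>p x. if x > 0 then poly p (1 / x) * exp (- (1 / x)) else 0)"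
    by (rule image_eqI[of _ _ 1]) (auto simp: flat_exp_def)
next
  fix h assume "h \<in> range (\<lambda>p x. if x > 0 then poly p (1 / x) * exp (- (1 / x)) else (0::real))"
  then obtain p where h: "h = (\<lambda>x. if x > 0 then poly p (1 / x) * exp (- (1 / x)) else (0::real))" by auto
  \<comment> \<open>Differentiating p(1/x) exp(-1/x) produces a factor 1/x^2, the polynomial
    \<open>[:0,0,1:]\<close> in the variable 1/x.\<close>
  define p' where "p' = [:0,0,1:] * (p - pderiv p)"
  define h' where "h' = (\<lambda>x. if x > 0 then poly p' (1 / x) * exp (- (1 / x)) else (0::real))"
  have "(h has_real_derivative h' x) (at x)" for x
  proof (cases x "0::real" rule: linorder_cases)
    case less
    have "((\<lambda>x. 0) has_real_derivative h' x) (at x)" using less by (simp add: h'_def)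
    then show ?thesis
      by (rule has_field_derivative_transform_within_open[of _ _ _ "{..<0}"]) (use less in \<open>auto simp: h\<close>)
  next
    case greater
    have "((\<lambda>x. poly p (1 / x) * exp (- (1 / x))) has_real_derivative h' x) (at x)"
      using greater unfolding h'_def p'_def
      by (auto intro!: derivative_eq_intros DERIV_chain'[OF _ poly_DERIV] simp: field_simps power2_eq_square)
    then show ?thesis
      by (rule has_field_derivative_transform_within_open[of _ _ _ "{0<..}"]) (use greater in \<open>auto simp: h\<close>)
  next
    case equal
    have "((\<lambda>y. h y / y) \<longlongrightarrow> 0) (at_right 0)"
    proof -
      \<comment> \<open>The extra factor \<open>[:0,1:]\<close> absorbs the division by y in the
        difference quotient at 0.\<close>
      have "((\<lambda>y. poly ([:0,1:] * p) (inverse y) * exp (- inverse y)) \<longlongrightarrow> 0) (at_right 0)"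
        using poly_times_exp_minus_tendsto_0 filterlim_inverse_at_top_right
        by (rule filterlim_compose)
      then show ?thesis
        by (rule Lim_transform_eventually)
          (auto simp: h eventually_at_filter field_simps intro!: always_eventually)
    qed
    moreover have "((\<lambda>y. h y / y) \<longlongrightarrow> 0) (at_left 0)"
      by (rule Lim_transform_eventually[OF tendsto_const])
         (auto simp: h eventually_at_filter intro!: always_eventually)
    ultimately have "((\<lambda>y. h y / y) \<longlongrightarrow> 0) (at 0)"
      using filterlim_split_at by blast
    then show ?thesis unfolding equal has_field_derivative_iff by (simp add: h h'_def)
  qed
  then show "\<exists>f'\<in>range (\<lambda>p x. if x > 0 then poly p (1 / x) * exp (- (1 / x)) else 0). \<forall>x. (h has_real_derivative f' x) (at x)"
    by (intro bexI[of _ h'] allI) (simp_all add: h'_def)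
qed

lemma flat_exp_pos: "x > 0 \<Longrightarrow> flat_exp x > 0"
  and flat_exp_zero: "x \<le> 0 \<Longrightarrow> flat_exp x = 0"
  and flat_exp_nonneg: "flat_exp x \<ge> 0"
  by (auto simp: flat_exp_def)

lemma antiderivative_UNIV:
  fixes f :: "real \<Rightarrow> real"
  assumes "continuous_on UNIV f"
  shows "\<exists>F. \<forall>x. (F has_real_derivative f x) (at x)"
  using einterval_antiderivative[of "-\<infinity>" \<infinity> f] assms
  by (auto simp: has_real_derivative_iff_has_vector_derivative continuous_on_eq_continuous_at)

text \<open>A normalized bump \<open>\<rho>\<close> is integrated twice: \<open>H1\<close> is a
  smooth step and \<open>H\<close> a convex smoothing of the positive part. Rescaled, they serve as
  mollifier, cutoff and building block of tents. The shift \<open>c\<close> stays unspecified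
  because it cancels when copies of \<open>H\<close> are combined with weights t, 1 - t and
  -1.\<close>

lemma smooth_ramp:
  obtains H H1 \<rho> :: "real \<Rightarrow> real" and c :: real where
    "smooth H" "\<And>x. (H has_real_derivative H1 x) (at x)" "\<And>x. (H1 has_real_derivative \<rho> x) (at x)"
    "\<And>x. x \<le> -1 \<Longrightarrow> H x = 0" "\<And>x. x \<ge> 1 \<Longrightarrow> H x = x - c" "\<And>x. \<rho> x \<ge> 0"
    "\<And>x. \<bar>x\<bar> \<ge> 1 \<Longrightarrow> \<rho> x = 0" "\<And>x. x \<le> -1 \<Longrightarrow> H1 x = 0" "\<And>x. x \<ge> 1 \<Longrightarrow> H1 x = 1" "smooth \<rho>"
    "\<And>x. H1 x \<ge> 0" "\<And>x. H1 x \<le> 1"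
proof -
  define \<rho>0 where "\<rho>0 = (\<lambda>x. flat_exp (1 * x + 1) * flat_exp ((-1) * x + 1))"
  have s0: "smooth \<rho>0" unfolding \<rho>0_def by (intro smooth_mult smooth_affine_compose smooth_flat_exp)
  have pos: "\<rho>0 x > 0" if "\<bar>x\<bar> < 1" for x using that unfolding \<rho>0_def by (auto intro!: mult_pos_pos flat_exp_pos)
  have nn: "\<rho>0 x \<ge> 0" for x unfolding \<rho>0_def by (intro mult_nonneg_nonneg flat_exp_nonneg)
  have z: "\<rho>0 x = 0" if "\<bar>x\<bar> \<ge> 1" for x
    using that unfolding \<rho>0_def by (cases "x \<ge> 1") (auto simp: flat_exp_zero)
  have const_left: "F x = F (-1)" if "\<And>x. (F has_real_derivative g x) (at x)" "\<And>x. x \<le> -1 \<Longrightarrow> g x = 0" "x \<le> -1"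
    for F g :: "real \<Rightarrow> real" and x
  proof (cases "x = -1")
    case False
    then have "x < -1" using that by simp
    moreover have "continuous_on {x..-1} F" using that(1) DERIV_isCont continuous_at_imp_continuous_on by blast
    moreover have "(F has_real_derivative 0) (at y)" if "x < y" "y < -1" for y
      using \<open>\<And>x. (F has_real_derivative g x) (at x)\<close>[of y] \<open>\<And>x. x \<le> -1 \<Longrightarrow> g x = 0\<close>[of y] that by simp
    ultimately show ?thesis using DERIV_isconst_end[of x "-1" F] by simp
  qed simp
  obtain F0 where F0: "\<And>x. (F0 has_real_derivative \<rho>0 x) (at x)"
    using antiderivative_UNIV[OF smooth_continuous[OF s0]] by auto
  have "F0 (-1) < F0 1"
  proof (rule DERIV_pos_imp_increasing_open[of "-1" 1])
    show "\<exists>y. DERIV F0 x :> y \<and> 0 < y" if "-1 < x" "x < 1" for x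
      using that by (intro exI[of _ "\<rho>0 x"] conjI F0 pos) auto
    show "continuous_on {-1..1} F0" using F0 DERIV_isCont continuous_at_imp_continuous_on by blast
  qed auto
  define m where "m = F0 1 - F0 (-1)"
  have m: "m > 0" using \<open>F0 (-1) < F0 1\<close> by (simp add: m_def)
  define \<rho> where "\<rho> = (\<lambda>x. 1 / m * \<rho>0 x)"
  define H1 where "H1 = (\<lambda>x. (F0 x - F0 (-1)) / m)"
  have dH1: "(H1 has_real_derivative \<rho> x) (at x)" for x
    unfolding H1_def \<rho>_def using m by (auto intro!: derivative_eq_intros F0)
  have H1z: "H1 x = 0" if "x \<le> -1" for x
    using const_left[OF F0, of x] z that by (simp add: H1_def)
  have H11: "H1 x = 1" if "x \<ge> 1" for x
  proof -
    \<comment> \<open>Reflection reduces constancy to the right of 1 to \<open>const_left\<close>;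
      the affine part of \<open>H\<close> is obtained below in the same way.\<close>
    have "((\<lambda>x. F0 (-x)) has_real_derivative - \<rho>0 (-x)) (at x)" for x
      using DERIV_mirror F0 by blast
    from const_left[OF this, of "-x"] z that have "F0 x = F0 1" by simp
    then show ?thesis using m by (simp add: H1_def m_def)
  qed
  have "continuous_on UNIV H1" using dH1 DERIV_isCont continuous_at_imp_continuous_on by blast
  then obtain F where F: "\<And>x. (F has_real_derivative H1 x) (at x)" using antiderivative_UNIV by blast
  define H where "H = (\<lambda>x. F x - F (-1))"
  have dH: "(H has_real_derivative H1 x) (at x)" for x
    unfolding H_def by (auto intro!: derivative_eq_intros F)
  have s: "smooth \<rho>" unfolding \<rho>_def by (intro smooth_mult smooth_const s0)
  have sH: "smooth H" using s smooth_iff[OF dH1] smooth_iff[OF dH] by simp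
  have Hz: "H x = 0" if "x \<le> -1" for x
    using const_left[OF F, of x] H1z that by (simp add: H_def)
  have Hc: "H x = x - (1 - H 1)" if "x \<ge> 1" for x
  proof -
    have "((\<lambda>x. H (-x) + x) has_real_derivative - H1 (-x) + 1) (at x)" for x
      by (rule DERIV_add[OF _ DERIV_ident]) (use DERIV_mirror dH in blast)
    from const_left[OF this, of "-x"] H11 that have "H x - x = H 1 - 1" by simp
    then show ?thesis by simp
  qed
  have "\<rho> x \<ge> 0" "\<bar>x\<bar> \<ge> 1 \<Longrightarrow> \<rho> x = 0" for x
    using m nn[of x] z[of x] by (auto simp: \<rho>_def)
  moreover have mono: "H1 x \<le> H1 y" if "x \<le> y" for x y
    using that by (rule DERIV_nonneg_imp_nondecreasing) (use dH1 nn m in \<open>auto simp: \<rho>_def intro!: exI\<close>)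
  have "H1 x \<ge> 0" "H1 x \<le> 1" for x
    using mono[of "-1" x] mono[of x 1] H1z[of x] H1z[of "-1"] H11[of x] H11[of 1] by linarith+
  ultimately show ?thesis
    using sH dH dH1 Hz Hc s H1z H11 by (intro that[of H H1 \<rho> "1 - H 1"])
qed

section \<open>Test functions and weak derivatives on the unit interval\<close>

lemma test_functionsI:
  assumes "smooth \<psi>" "-1 < a" "b < 1" "\<And>x. x < a \<or> x > b \<Longrightarrow> \<psi> x = 0"
  shows "\<psi> \<in> test_functions Omega"
proof -
  have "{x. \<psi> x \<noteq> 0} \<subseteq> {a..b}" using assms(4) by force
  then have "closure {x. \<psi> x \<noteq> 0} \<subseteq> {a..b}" by (simp add: closure_minimal)
  moreover from this have "compact (closure {x. \<psi> x \<noteq> 0})"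
    by (metis compact_Icc closed_closure compact_Int_closed inf.absorb_iff2)
  moreover have "{a..b} \<subseteq> Omega" using assms(2,3) by auto
  ultimately show ?thesis using assms(1) by (auto simp: test_functions_def smooth_def)
qed

lemma test_function_smooth: "\<psi> \<in> test_functions Omega \<Longrightarrow> smooth \<psi>"
  by (simp add: test_functions_def smooth_def)

text \<open>The interval is strictly larger than the support, so that \<open>\<psi>\<close> vanishes
  at its endpoints too, as integration by parts needs.\<close>

lemma test_function_support:
  fixes \<psi> :: "real \<Rightarrow> real"
  assumes "\<psi> \<in> test_functions Omega"
  obtains a b where "-1 < a" "a < b" "b < 1" "\<And>x. x \<le> a \<or> x \<ge> b \<Longrightarrow> \<psi> x = 0"
proof -
  let ?K = "closure {x. \<psi> x \<noteq> 0}"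
  have K: "compact ?K" "?K \<subseteq> Omega" using assms by (auto simp: test_functions_def)
  show ?thesis
  proof (cases "?K = {}")
    case True
    then have "\<psi> x = 0" for x by auto
    then show ?thesis using that[of 0 "1/2"] by auto
  next
    case False
    obtain s t where st: "s \<in> ?K" "t \<in> ?K" "\<And>x. x \<in> ?K \<Longrightarrow> s \<le> x \<and> x \<le> t"
      using compact_attains_inf[OF K(1) False] compact_attains_sup[OF K(1) False] by metis
    then have "-1 < s" "t < 1" "s \<le> t" using K(2) by auto
    moreover have "\<psi> x = 0" if "x < s \<or> x > t" for x
      using st(3)[of x] that closure_subset[of "{x. \<psi> x \<noteq> 0}"] by force
    ultimately show ?thesis by (intro that[of "(s - 1) / 2" "(t + 1) / 2"]) auto
  qed
qed

lemma zero_deriv_outside: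
  assumes "\<And>x. x \<le> a \<or> x \<ge> b \<Longrightarrow> \<psi> x = (0::real)" "x < a \<or> x > b"
  shows "deriv \<psi> x = 0"
proof -
  have "((\<lambda>x. 0) has_real_derivative 0) (at x)" by simp
  then have "(\<psi> has_real_derivative 0) (at x)"
    by (rule has_field_derivative_transform_within_open[of _ _ _ "-{a..b}"])
       (use assms in \<open>auto simp: not_le open_Compl\<close>)
  then show ?thesis by (rule DERIV_imp_deriv)
qed

lemma test_function_deriv:
  assumes "\<psi> \<in> test_functions Omega" shows "deriv \<psi> \<in> test_functions Omega"
proof -
  obtain a b where ab: "-1 < a" "a < b" "b < 1" "\<And>x. x \<le> a \<or> x \<ge> b \<Longrightarrow> \<psi> x = 0"
    using test_function_support[OF assms] by blast
  show ?thesis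
    by (rule test_functionsI[of _ a b])
       (use ab zero_deriv_outside[of a b \<psi>] smooth_deriv test_function_smooth assms in auto)
qed

lemma test_function_linear:
  assumes "\<psi> \<in> test_functions Omega" "\<eta> \<in> test_functions Omega"
  shows "(\<lambda>x. \<psi> x + s * \<eta> x) \<in> test_functions Omega"
proof -
  obtain a b where ab: "-1 < a" "a < b" "b < 1" "\<And>x. x \<le> a \<or> x \<ge> b \<Longrightarrow> \<psi> x = 0"
    using test_function_support[OF assms(1)] by blast
  obtain c d where cd: "-1 < c" "c < d" "d < 1" "\<And>x. x \<le> c \<or> x \<ge> d \<Longrightarrow> \<eta> x = 0"
    using test_function_support[OF assms(2)] by blast
  show ?thesis
    by (rule test_functionsI[of _ "min a c" "max b d"])
       (use ab cd assms[THEN test_function_smooth] in \<open>auto intro!: smooth_add smooth_mult smooth_const\<close>)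
qed

lemma Omega_sets: "Omega \<in> sets lebesgue" by simp

lemma integrable_Omega_iff:
  fixes f :: "real \<Rightarrow> real"
  shows "integrable (lebesgue_on Omega) f \<longleftrightarrow> integrable lebesgue (\<lambda>x. if x \<in> Omega then f x else 0)"
  by (rule Lebesgue_Measure.integrable_restrict_UNIV[OF Omega_sets, symmetric])

text \<open>Passes from the Lebesgue integral over the open interval to the gauge integral over a
  compact one, where the fundamental theorem of calculus is available.\<close>

lemma integral_supported:
  fixes f :: "real \<Rightarrow> real"
  assumes "-1 < a" "b < 1" "continuous_on {a..b} f" "\<And>x. x \<in> Omega \<Longrightarrow> x \<notin> {a..b} \<Longrightarrow> f x = 0"
  shows "integrable (lebesgue_on Omega) f"
    and "integral\<^sup>L (lebesgue_on Omega) f = integral {a..b} f"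
proof -
  have i: "integrable (lebesgue_on {a..b}) f"
    using assms(3) by (rule continuous_imp_integrable_real)
  have eq: "(\<lambda>x. if x \<in> Omega then f x else 0) = (\<lambda>x. if x \<in> {a..b} then f x else 0)"
    by (rule ext) (use assms(1,2) assms(4) in auto)
  show "integrable (lebesgue_on Omega) f"
    unfolding integrable_Omega_iff eq by (subst Lebesgue_Measure.integrable_restrict_UNIV) (use i in auto)
  have "integral\<^sup>L (lebesgue_on Omega) f = integral\<^sup>L (lebesgue_on {a..b}) f"
    using Lebesgue_Measure.integral_restrict_UNIV[of Omega f] Lebesgue_Measure.integral_restrict_UNIV[of "{a..b}" f] eq by simp
  then show "integral\<^sup>L (lebesgue_on Omega) f = integral {a..b} f"
    using lebesgue_integral_eq_integral[OF i] by simp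
qed

lemma integrable_cont_test:
  assumes "continuous_on Omega f" "\<psi> \<in> test_functions Omega"
  shows "integrable (lebesgue_on Omega) (\<lambda>x. f x * \<psi> x)"
proof -
  obtain a b where ab: "-1 < a" "a < b" "b < 1" "\<And>x. x \<le> a \<or> x \<ge> b \<Longrightarrow> \<psi> x = 0"
    using test_function_support[OF assms(2)] by blast
  have "continuous_on {a..b} f" using assms(1) by (rule continuous_on_subset) (use ab in auto)
  then show ?thesis
    by (intro integral_supported(1)[of a b] continuous_on_mult smooth_continuous[OF test_function_smooth[OF assms(2)]])
       (use ab in auto)
qed

text \<open>\<open>F\<close> and \<open>f\<close> are controlled only inside the open interval and
  may be unbounded near -1 and 1; the support of \<open>\<psi>\<close> confines the integrals to a
  compact interval and removes the boundary terms.\<close>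

lemma test_function_by_parts:
  assumes "\<psi> \<in> test_functions Omega" "\<And>x. x \<in> Omega \<Longrightarrow> (F has_real_derivative f x) (at x)"
    "continuous_on Omega f"
  shows "(\<integral>x. F x * deriv \<psi> x \<partial>lebesgue_on Omega) = - (\<integral>x. f x * \<psi> x \<partial>lebesgue_on Omega)"
proof -
  obtain a b where ab: "-1 < a" "a < b" "b < 1" "\<And>x. x \<le> a \<or> x \<ge> b \<Longrightarrow> \<psi> x = 0"
    using test_function_support[OF assms(1)] by blast
  have s: "smooth \<psi>" using assms(1) by (rule test_function_smooth)
  have sub: "{a..b} \<subseteq> Omega" using ab by auto
  have cF: "continuous_on {a..b} F"
    using assms(2) sub by (intro continuous_at_imp_continuous_on ballI DERIV_isCont) blast
  have cf: "continuous_on {a..b} f" using assms(3) sub by (rule continuous_on_subset)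
  have c1: "continuous_on {a..b} (\<lambda>x. F x * deriv \<psi> x)" and c2: "continuous_on {a..b} (\<lambda>x. f x * \<psi> x)"
    by (intro continuous_on_mult cF cf smooth_continuous smooth_deriv s)+
  have "((\<lambda>x. F x * deriv \<psi> x + f x * \<psi> x) has_integral (F b * \<psi> b - F a * \<psi> a)) {a..b}"
  proof (rule fundamental_theorem_of_calculus)
    fix x assume "x \<in> {a..b}"
    then have "((\<lambda>x. F x * \<psi> x) has_real_derivative (F x * deriv \<psi> x + f x * \<psi> x)) (at x)"
      using sub by (intro DERIV_mult' assms(2) smooth_has_deriv s) auto
    then show "((\<lambda>x. F x * \<psi> x) has_vector_derivative (F x * deriv \<psi> x + f x * \<psi> x)) (at x within {a..b})"
      by (simp add: has_real_derivative_iff_has_vector_derivative has_vector_derivative_at_within)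
  qed (use ab in simp)
  then have "integral {a..b} (\<lambda>x. F x * deriv \<psi> x + f x * \<psi> x) = 0"
    using ab by (simp add: integral_unique)
  then have "integral {a..b} (\<lambda>x. F x * deriv \<psi> x) + integral {a..b} (\<lambda>x. f x * \<psi> x) = 0"
    using c1 c2 by (simp add: integral_add integrable_continuous_real)
  moreover have "(\<integral>x. F x * deriv \<psi> x \<partial>lebesgue_on Omega) = integral {a..b} (\<lambda>x. F x * deriv \<psi> x)"
    by (rule integral_supported(2)) (use ab c1 zero_deriv_outside[of a b \<psi>] in \<open>auto simp: not_le\<close>)
  moreover have "(\<integral>x. f x * \<psi> x \<partial>lebesgue_on Omega) = integral {a..b} (\<lambda>x. f x * \<psi> x)"
    by (rule integral_supported(2)) (use ab c2 in auto)
  ultimately show ?thesis by linarith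
qed

section \<open>Square integrable functions and the fundamental lemma of the calculus of
  variations\<close>

lemma L2_D: "f \<in> L2 S \<Longrightarrow> f \<in> borel_measurable (lebesgue_on S)"
  "f \<in> L2 S \<Longrightarrow> integrable (lebesgue_on S) (\<lambda>x. (f x)\<^sup>2)"
  by (auto simp: L2_def)

lemma L2_mult_integrable:
  assumes "f \<in> L2 S" "g \<in> L2 S" shows "integrable (lebesgue_on S) (\<lambda>x. f x * g x)"
proof (rule Bochner_Integration.integrable_bound)
  show "integrable (lebesgue_on S) (\<lambda>x. (f x)\<^sup>2 + (g x)\<^sup>2)"
    using assms L2_D by (intro Bochner_Integration.integrable_add) auto
  show "(\<lambda>x. f x * g x) \<in> borel_measurable (lebesgue_on S)"
    using assms by (intro borel_measurable_times L2_D)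
  have "\<bar>a * b\<bar> \<le> a\<^sup>2 + b\<^sup>2" for a b :: real
  proof -
    have "2 * (\<bar>a\<bar> * \<bar>b\<bar>) \<le> a\<^sup>2 + b\<^sup>2" using sum_squares_bound[of "\<bar>a\<bar>" "\<bar>b\<bar>"] by simp
    moreover have "0 \<le> \<bar>a\<bar> * \<bar>b\<bar>" by simp
    ultimately show ?thesis unfolding abs_mult by linarith
  qed
  then show "AE x in lebesgue_on S. norm (f x * g x) \<le> norm ((f x)\<^sup>2 + (g x)\<^sup>2)"
    by (auto intro!: AE_I2)
qed

lemma L2_linear:
  assumes "f \<in> L2 S" "g \<in> L2 S" shows "(\<lambda>x. f x + s * g x) \<in> L2 S"
proof -
  have "integrable (lebesgue_on S) (\<lambda>x. (f x)\<^sup>2 + 2 * s * (f x * g x) + s\<^sup>2 * (g x)\<^sup>2)"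
    using assms L2_D L2_mult_integrable by (intro Bochner_Integration.integrable_add integrable_mult_right) auto
  moreover have "(\<lambda>x. (f x)\<^sup>2 + 2 * s * (f x * g x) + s\<^sup>2 * (g x)\<^sup>2) = (\<lambda>x. (f x + s * g x)\<^sup>2)"
    by (auto simp: power2_eq_square algebra_simps)
  moreover have "(\<lambda>x. f x + s * g x) \<in> borel_measurable (lebesgue_on S)"
    using assms L2_D(1) by (intro borel_measurable_add borel_measurable_times borel_measurable_const) auto
  ultimately show ?thesis by (simp add: L2_def)
qed

lemma continuous_integrable_Omega:
  fixes f :: "real \<Rightarrow> real"
  assumes "continuous_on Omega_bar f" shows "integrable (lebesgue_on Omega) f"
proof -
  have "f absolutely_integrable_on Omega_bar"
    using assms by (rule absolutely_integrable_continuous_real)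
  then have "f absolutely_integrable_on Omega"
    by (rule set_integrable_subset) auto
  then show ?thesis
    by (simp add: set_integrable_def integrable_restrict_space)
qed

lemma continuous_L2_Omega: "continuous_on Omega_bar f \<Longrightarrow> f \<in> L2 Omega"
  unfolding L2_def mem_Collect_eq
  by (intro conjI borel_measurable_integrable continuous_integrable_Omega continuous_on_power)

lemma test_function_L2: "\<psi> \<in> test_functions Omega \<Longrightarrow> \<psi> \<in> L2 Omega"
  by (intro continuous_L2_Omega smooth_continuous test_function_smooth)

lemma L2_integrable_Omega: "g \<in> L2 Omega \<Longrightarrow> integrable (lebesgue_on Omega) g"
  using L2_mult_integrable[OF _ continuous_L2_Omega[of "\<lambda>x. 1"]] by simp

text \<open>Smooth cutoffs converge boundedly to the indicator of an interval, so \<open>g\<close>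
  has integral zero over every interval; a Dynkin system argument extends this to Borel sets and
  completion to all measurable sets.\<close>

lemma AE_zero_if_orthogonal_to_test_functions:
  assumes g: "g \<in> L2 Omega"
    and orth: "\<And>\<psi>. \<psi> \<in> test_functions Omega \<Longrightarrow> (\<integral>x. g x * \<psi> x \<partial>lebesgue_on Omega) = 0"
  shows "AE x in lebesgue_on Omega. g x = 0"
proof -
  let ?M = "lebesgue_on Omega"
  have gi: "integrable ?M g" using g by (rule L2_integrable_Omega)
  obtain H H1 \<rho> :: "real \<Rightarrow> real" and c where
    sH: "smooth H" and dH: "\<And>x. (H has_real_derivative H1 x) (at x)"
    and H1: "\<And>x. x \<le> -1 \<Longrightarrow> H1 x = 0" "\<And>x. x \<ge> 1 \<Longrightarrow> H1 x = 1" "\<And>x. H1 x \<ge> 0" "\<And>x. H1 x \<le> 1"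
    by (rule smooth_ramp) metis
  have sH1: "smooth H1" using sH smooth_iff[OF dH] by simp
  have interval: "(\<integral>x. indicator {a<..<b} x * g x \<partial>?M) = 0" if "-1 \<le> a" "b \<le> 1" for a b :: real
  proof -
    \<comment> \<open>A rising times a falling step. The shift by 3 makes the product vanish within
      distance 2/(n+1) of \<open>a\<close> and \<open>b\<close>, hence near -1 and 1 even if these
      are the endpoints; it equals 1 from distance 4/(n+1) on.\<close>
    define \<psi> where "\<psi> = (\<lambda>n x. H1 (real (Suc n) * x + (- real (Suc n) * a - 3)) * H1 (- real (Suc n) * x + (real (Suc n) * b - 3)))"
    have test: "\<psi> n \<in> test_functions Omega" for n
    proof (rule test_functionsI[of _ "a + 2 / real (Suc n)" "b - 2 / real (Suc n)"])
      show "smooth (\<psi> n)" unfolding \<psi>_def by (intro smooth_mult smooth_affine_compose sH1)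
      fix x assume "x < a + 2 / real (Suc n) \<or> x > b - 2 / real (Suc n)"
      then have "real (Suc n) * x + (- real (Suc n) * a - 3) \<le> -1 \<or> - real (Suc n) * x + (real (Suc n) * b - 3) \<le> -1"
        by (simp add: field_simps) linarith
      then show "\<psi> n x = 0" unfolding \<psi>_def using H1(1) by auto
    next
      have "2 / real (Suc n) > 0" by simp
      then show "-1 < a + 2 / real (Suc n)" "b - 2 / real (Suc n) < 1" using that by linarith+
    qed
    have lim: "(\<lambda>n. \<psi> n x) \<longlonglongrightarrow> indicator {a<..<b} x" for x
    proof (cases "x \<in> {a<..<b}")
      case True
      obtain N :: nat where N: "4 / min (x - a) (b - x) < real N" using reals_Archimedean2 by blast
      have "\<psi> n x = 1" if "n \<ge> N" for n
      proof -
        have "4 / min (x - a) (b - x) < real (Suc n)" using N that by linarith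
        then have "4 < real (Suc n) * min (x - a) (b - x)"
          using True by (simp add: pos_divide_less_eq del: of_nat_Suc)
        moreover have "real (Suc n) * min (x - a) (b - x) \<le> real (Suc n) * (x - a)"
           "real (Suc n) * min (x - a) (b - x) \<le> real (Suc n) * (b - x)"
          by (intro mult_left_mono; simp)+
        ultimately have "real (Suc n) * x + (- real (Suc n) * a - 3) \<ge> 1" "- real (Suc n) * x + (real (Suc n) * b - 3) \<ge> 1"
          by (simp_all only: right_diff_distrib)
        then show ?thesis unfolding \<psi>_def by (simp add: H1(2) del: of_nat_Suc)
      qed
      then have "eventually (\<lambda>n. \<psi> n x = 1) sequentially" using eventually_sequentially by blast
      then show ?thesis using True by (simp add: tendsto_eventually)
    next
      case False
      have "\<psi> n x = 0" for n
      proof -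
        have "real (Suc n) * (x - a) \<le> 0 \<or> real (Suc n) * (b - x) \<le> 0"
          using False by (auto simp: mult_le_0_iff)
        then have "real (Suc n) * x + (- real (Suc n) * a - 3) \<le> -1 \<or> - real (Suc n) * x + (real (Suc n) * b - 3) \<le> -1"
          by (auto simp only: right_diff_distrib)
        then show ?thesis unfolding \<psi>_def using H1(1) by auto
      qed
      then show ?thesis using False by simp
    qed
    have "(\<lambda>n. \<integral>x. g x * \<psi> n x \<partial>?M) \<longlonglongrightarrow> (\<integral>x. g x * indicator {a<..<b} x \<partial>?M)"
    proof (rule integral_dominated_convergence[where w="\<lambda>x. \<bar>g x\<bar>"])
      show "(\<lambda>x. g x * \<psi> n x) \<in> borel_measurable ?M" for n
        using L2_D(1)[OF g] L2_D(1)[OF test_function_L2[OF test]] by (intro borel_measurable_times)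
      show "(\<lambda>x. g x * indicator {a<..<b} x) \<in> borel_measurable ?M"
        using L2_D(1)[OF g] by (intro borel_measurable_times borel_measurable_indicator')
          (auto simp: sets_restrict_space intro!: image_eqI[of _ _ "{a<..<b}"])
      show "integrable ?M (\<lambda>x. \<bar>g x\<bar>)" using gi by simp
      have "\<bar>\<psi> n x\<bar> \<le> 1" for n x unfolding \<psi>_def abs_mult
        by (intro mult_le_one) (use H1(3,4) in auto)
      then show "AE x in ?M. norm (g x * \<psi> n x) \<le> \<bar>g x\<bar>" for n
        by (intro AE_I2) (auto simp: abs_mult intro: mult_left_le)
      show "AE x in ?M. (\<lambda>n. g x * \<psi> n x) \<longlonglongrightarrow> g x * indicator {a<..<b} x"
        by (intro AE_I2 tendsto_mult tendsto_const lim)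
    qed
    then show ?thesis using orth[OF test] by (simp add: LIMSEQ_const_iff mult.commute)
  qed
  have meas: "A \<inter> Omega \<in> sets ?M" if "A \<in> sets borel" for A
    using that by (auto simp: sets_restrict_space intro!: image_eqI[of _ _ A])
  have si: "set_integrable ?M (A \<inter> Omega) g" if "A \<in> sets borel" for A
    using integrable_mult_indicator[OF meas[OF that] gi] by (simp add: set_integrable_def)
  have total: "(LINT x:Omega|?M. g x) = 0"
    using interval[of "-1" 1] by (simp add: set_lebesgue_integral_def)
  have borel0: "(LINT x:A \<inter> Omega|?M. g x) = 0" if A: "A \<in> sets borel" for A
  proof -
    have "Int_stable (range (\<lambda>(a, b). box a b :: real set))"
      by (auto simp: Int_stable_def box_Int_box)
    moreover have "range (\<lambda>(a, b). box a b :: real set) \<subseteq> Pow UNIV" by auto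
    moreover have "A \<in> sigma_sets UNIV (range (\<lambda>(a, b). box a b))" using A unfolding borel_eq_box by (simp del: box_real)
    ultimately show ?thesis
    proof (induction rule: sigma_sets_induct_disjoint)
      case (basic A)
      then obtain a b :: real where A: "A = {a<..<b}" by (auto simp: box_real)
      then have "A \<inter> Omega = {max a (-1)<..<min b 1}" by auto
      then show ?case using interval[of "max a (-1)" "min b 1"] by (simp add: set_lebesgue_integral_def)
    next
      case empty then show ?case by (simp add: set_lebesgue_integral_def)
    next
      case (compl A)
      then have [measurable]: "A \<in> sets borel" by (simp add: borel_eq_box del: box_real)
      have eq: "Omega = ((UNIV - A) \<inter> Omega) \<union> (A \<inter> Omega)" by blast
      have "(LINT x:((UNIV - A) \<inter> Omega) \<union> (A \<inter> Omega)|?M. g x) = (LINT x:(UNIV - A) \<inter> Omega|?M. g x) + (LINT x:A \<inter> Omega|?M. g x)"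
        by (intro set_integral_Un si) auto
      then show ?case using total compl eq by simp
    next
      case (union F)
      then have Fb: "\<And>i. F i \<in> sets borel" by (auto simp: borel_eq_box simp del: box_real)
      have eq: "(\<Union>(range F)) \<inter> Omega = (\<Union>i. F i \<inter> Omega)" by blast
      have "(LINT x:(\<Union>i. F i \<inter> Omega)|?M. g x) = (\<Sum>i. (LINT x:F i \<inter> Omega|?M. g x))"
      proof (rule lebesgue_integral_countable_add)
        show "F i \<inter> Omega \<in> sets ?M" for i using meas Fb by blast
        show "F i \<inter> Omega \<inter> (F j \<inter> Omega) = {}" if "i \<noteq> j" for i j
          using union(1) that by (auto simp: disjoint_family_on_def)
        show "set_integrable ?M (\<Union>i. F i \<inter> Omega) g" unfolding eq[symmetric] using Fb by (intro si) auto
      qed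
      then show ?case unfolding eq using union by simp
    qed
  qed
  show ?thesis
  proof (rule sigma_finite_measure.density_zero[OF _ gi])
    show "sigma_finite_measure ?M"
      by (intro finite_measure.axioms(1) finite_measure_lebesgue_on) simp
  next
    \<comment> \<open>A Lebesgue set differs from a Borel set by a null set, which does not affect
      the integral.\<close>
    fix A assume A: "A \<in> sets ?M"
    then have "A \<in> sets lebesgue" "A \<subseteq> Omega" using sets.sets_into_space[OF A] by (auto simp: sets_restrict_space_iff)
    then obtain S N N' where SN: "A = S \<union> N" "N \<subseteq> N'" "N' \<in> null_sets lborel" "S \<in> sets lborel"
      using sets_completionE by metis
    have S: "S \<inter> Omega = S" using SN(1) \<open>A \<subseteq> Omega\<close> by auto
    have "AE x in lborel. x \<notin> N'" using SN(3) by (rule AE_not_in)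
    then have "AE x in lebesgue. x \<notin> N'" by (rule AE_completion)
    then have ae: "AE x in ?M. x \<notin> N'" by (subst AE_restrict_space_iff) auto
    have Sm: "S \<in> sets ?M" using meas[of S] SN(4) S by simp
    have "(LINT x:A|?M. g x) = (LINT x:S|?M. g x)"
    proof (rule set_integral_cong_set)
      show "set_borel_measurable ?M S g" "set_borel_measurable ?M A g"
        unfolding set_borel_measurable_def using L2_D(1)[OF g] A Sm by auto
      show "AE x in ?M. (x \<in> S) = (x \<in> A)" using ae by eventually_elim (use SN in auto)
    qed
    also have "\<dots> = 0" using borel0[of S] SN(4) S by simp
    finally show "set_lebesgue_integral ?M A g = 0" .
  qed
qed

section \<open>Weak derivatives and the Sobolev spaces under addition of test functions\<close>

lemma has_weak_partial_Omega_iff: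
  "has_weak_partial Omega 1 v g \<longleftrightarrow> v \<in> L2 Omega \<and> g \<in> L2 Omega \<and>
     (\<forall>\<psi>\<in>test_functions Omega.
        (\<integral>x. v x * deriv \<psi> x \<partial>lebesgue_on Omega) = - (\<integral>x. g x * \<psi> x \<partial>lebesgue_on Omega))"
  by (simp add: has_weak_partial_def smooth_frechet[OF test_function_smooth])

lemma has_weak_partial_linear:
  assumes "has_weak_partial Omega 1 v g" "has_weak_partial Omega 1 w k"
  shows "has_weak_partial Omega 1 (\<lambda>x. v x + s * w x) (\<lambda>x. g x + s * k x)"
  unfolding has_weak_partial_Omega_iff
proof (intro conjI ballI L2_linear)
  fix \<psi> :: "real \<Rightarrow> real" assume t: "\<psi> \<in> test_functions Omega"
  note t' = test_function_deriv[OF t]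
  have m: "v \<in> L2 Omega" "g \<in> L2 Omega" "w \<in> L2 Omega" "k \<in> L2 Omega"
    using assms by (auto simp: has_weak_partial_Omega_iff)
  have "(\<integral>x. (v x + s * w x) * deriv \<psi> x \<partial>lebesgue_on Omega) =
     (\<integral>x. v x * deriv \<psi> x + s * (w x * deriv \<psi> x) \<partial>lebesgue_on Omega)"
    by (rule Bochner_Integration.integral_cong) (auto simp: algebra_simps)
  also have "\<dots> = (\<integral>x. v x * deriv \<psi> x \<partial>lebesgue_on Omega) + s * (\<integral>x. w x * deriv \<psi> x \<partial>lebesgue_on Omega)"
    using m t' by (subst Bochner_Integration.integral_add) (auto intro!: L2_mult_integrable test_function_L2)
  also have "\<dots> = - ((\<integral>x. g x * \<psi> x \<partial>lebesgue_on Omega) + s * (\<integral>x. k x * \<psi> x \<partial>lebesgue_on Omega))"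
    using assms t by (simp add: has_weak_partial_Omega_iff)
  also have "(\<integral>x. g x * \<psi> x \<partial>lebesgue_on Omega) + s * (\<integral>x. k x * \<psi> x \<partial>lebesgue_on Omega) =
      (\<integral>x. g x * \<psi> x + s * (k x * \<psi> x) \<partial>lebesgue_on Omega)"
    using m t by (subst Bochner_Integration.integral_add) (auto intro!: L2_mult_integrable test_function_L2)
  also have "\<dots> = (\<integral>x. (g x + s * k x) * \<psi> x \<partial>lebesgue_on Omega)"
    by (rule Bochner_Integration.integral_cong) (auto simp: algebra_simps)
  finally show "(\<integral>x. (v x + s * w x) * deriv \<psi> x \<partial>lebesgue_on Omega) =
    - (\<integral>x. (g x + s * k x) * \<psi> x \<partial>lebesgue_on Omega)" .
qed (use assms in \<open>auto simp: has_weak_partial_Omega_iff\<close>)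

lemma has_weak_partial_unique:
  assumes "has_weak_partial Omega 1 v g" "has_weak_partial Omega 1 v k"
  shows "AE x in lebesgue_on Omega. g x = k x"
proof -
  have m: "g \<in> L2 Omega" "k \<in> L2 Omega"
    using assms by (auto simp: has_weak_partial_Omega_iff)
  have "AE x in lebesgue_on Omega. g x + (-1) * k x = 0"
  proof (rule AE_zero_if_orthogonal_to_test_functions)
    show "(\<lambda>x. g x + (-1) * k x) \<in> L2 Omega" by (intro L2_linear m)
    fix \<psi> :: "real \<Rightarrow> real" assume t: "\<psi> \<in> test_functions Omega"
    have "(\<integral>x. (g x + (-1) * k x) * \<psi> x \<partial>lebesgue_on Omega) = (\<integral>x. g x * \<psi> x - k x * \<psi> x \<partial>lebesgue_on Omega)"
      by (rule Bochner_Integration.integral_cong) (auto simp: algebra_simps)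
    also have "\<dots> = (\<integral>x. g x * \<psi> x \<partial>lebesgue_on Omega) - (\<integral>x. k x * \<psi> x \<partial>lebesgue_on Omega)"
      using m test_function_L2[OF t] by (intro Bochner_Integration.integral_diff L2_mult_integrable)
    also have "\<dots> = 0" using assms t by (auto simp: has_weak_partial_Omega_iff)
    finally show "(\<integral>x. (g x + (-1) * k x) * \<psi> x \<partial>lebesgue_on Omega) = 0" .
  qed
  then show ?thesis by simp
qed

lemma has_weak_partial_test_function:
  assumes "\<psi> \<in> test_functions Omega"
  shows "has_weak_partial Omega 1 \<psi> (deriv \<psi>)"
  unfolding has_weak_partial_Omega_iff
  using assms by (auto intro!: test_function_L2 test_function_deriv test_function_by_parts smooth_has_deriv
      smooth_continuous smooth_deriv test_function_smooth)

lemma has_weak_partial_weak_partial: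
  "v \<in> H1 Omega \<Longrightarrow> has_weak_partial Omega 1 v (weak_partial Omega 1 v)"
  unfolding weak_partial_def H1_def by (auto intro: someI[where P="has_weak_partial Omega 1 v"])

lemma H1_iff: "v \<in> H1 Omega \<longleftrightarrow> (\<exists>g. has_weak_partial Omega 1 v g)"
  by (auto simp: H1_def has_weak_partial_def)

text \<open>\<open>weak_partial\<close> is an arbitrary choice, so its additivity holds only almost
  everywhere and comes from uniqueness of weak derivatives.\<close>

lemma H1_add_test_function:
  assumes "v \<in> H1 Omega" "\<psi> \<in> test_functions Omega"
  shows "(\<lambda>x. v x + s * \<psi> x) \<in> H1 Omega"
    and "AE x in lebesgue_on Omega. weak_partial Omega 1 (\<lambda>x. v x + s * \<psi> x) x = weak_partial Omega 1 v x + s * deriv \<psi> x"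
proof -
  have w: "has_weak_partial Omega 1 (\<lambda>x. v x + s * \<psi> x) (\<lambda>x. weak_partial Omega 1 v x + s * deriv \<psi> x)"
    by (intro has_weak_partial_linear has_weak_partial_weak_partial has_weak_partial_test_function assms)
  then show H: "(\<lambda>x. v x + s * \<psi> x) \<in> H1 Omega" using H1_iff by blast
  show "AE x in lebesgue_on Omega. weak_partial Omega 1 (\<lambda>x. v x + s * \<psi> x) x = weak_partial Omega 1 v x + s * deriv \<psi> x"
    by (rule has_weak_partial_unique[OF has_weak_partial_weak_partial[OF H] w])
qed

lemma weak_partial_L2: "v \<in> H1 Omega \<Longrightarrow> weak_partial Omega 1 v \<in> L2 Omega"
  using has_weak_partial_weak_partial has_weak_partial_Omega_iff by blast

lemma H1_L2: "v \<in> H1 Omega \<Longrightarrow> v \<in> L2 Omega"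
  by (simp add: H1_def)

lemma H10_iff: "v \<in> H10 Omega \<longleftrightarrow> v \<in> H1 Omega \<and> (\<exists>\<psi>. (\<forall>n. \<psi> n \<in> test_functions Omega) \<and>
     (\<lambda>n. \<integral>x. (v x - \<psi> n x)\<^sup>2 \<partial>lebesgue_on Omega) \<longlonglongrightarrow> 0 \<and>
     (\<lambda>n. \<integral>x. (weak_partial Omega 1 v x - deriv (\<psi> n) x)\<^sup>2 \<partial>lebesgue_on Omega) \<longlonglongrightarrow> 0)"
proof -
  have eq: "(\<forall>n. \<psi> n \<in> test_functions Omega) \<and> A \<and>
     (\<lambda>n. \<integral>x. (weak_partial Omega 1 v x - frechet_derivative (\<psi> n) (at x) 1)\<^sup>2 \<partial>lebesgue_on Omega) \<longlonglongrightarrow> 0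
   \<longleftrightarrow> (\<forall>n. \<psi> n \<in> test_functions Omega) \<and> A \<and>
     (\<lambda>n. \<integral>x. (weak_partial Omega 1 v x - deriv (\<psi> n) x)\<^sup>2 \<partial>lebesgue_on Omega) \<longlonglongrightarrow> 0" for \<psi> A
    by (cases "\<forall>n. \<psi> n \<in> test_functions Omega") (auto simp: smooth_frechet[OF test_function_smooth])
  show ?thesis unfolding H10_def mem_Collect_eq Basis_real_def ball_simps using eq by simp
qed

text \<open>Shifting the approximating test functions by the same multiple of \<open>\<psi>\<close>
  leaves both approximation errors unchanged.\<close>

lemma H10_add_test_function:
  assumes "v \<in> H10 Omega" "\<psi> \<in> test_functions Omega"
  shows "(\<lambda>x. v x + s * \<psi> x) \<in> H10 Omega"
proof -
  have H: "v \<in> H1 Omega" using assms(1) H10_iff by blast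
  obtain \<xi> where x: "\<And>n. \<xi> n \<in> test_functions Omega"
     "(\<lambda>n. \<integral>x. (v x - \<xi> n x)\<^sup>2 \<partial>lebesgue_on Omega) \<longlonglongrightarrow> 0"
     "(\<lambda>n. \<integral>x. (weak_partial Omega 1 v x - deriv (\<xi> n) x)\<^sup>2 \<partial>lebesgue_on Omega) \<longlonglongrightarrow> 0"
    using assms(1) unfolding H10_iff by blast
  define \<zeta> where "\<zeta> = (\<lambda>n x. \<xi> n x + s * \<psi> x)"
  have z: "\<zeta> n \<in> test_functions Omega" for n unfolding \<zeta>_def by (intro test_function_linear x assms)
  have d: "deriv (\<zeta> n) x = deriv (\<xi> n) x + s * deriv \<psi> x" for n x
    unfolding \<zeta>_def
    by (intro DERIV_imp_deriv DERIV_add DERIV_cmult smooth_has_deriv test_function_smooth x assms)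
  have "(\<integral>x. (weak_partial Omega 1 (\<lambda>x. v x + s * \<psi> x) x - deriv (\<zeta> n) x)\<^sup>2 \<partial>lebesgue_on Omega) =
     (\<integral>x. (weak_partial Omega 1 v x - deriv (\<xi> n) x)\<^sup>2 \<partial>lebesgue_on Omega)" for n
  proof (rule integral_cong_AE)
    show "(\<lambda>x. (weak_partial Omega 1 (\<lambda>x. v x + s * \<psi> x) x - deriv (\<zeta> n) x)\<^sup>2) \<in> borel_measurable (lebesgue_on Omega)"
      by (intro borel_measurable_power borel_measurable_diff L2_D weak_partial_L2 H1_add_test_function H assms
          test_function_L2 test_function_deriv z)
    show "(\<lambda>x. (weak_partial Omega 1 v x - deriv (\<xi> n) x)\<^sup>2) \<in> borel_measurable (lebesgue_on Omega)"
      by (intro borel_measurable_power borel_measurable_diff L2_D weak_partial_L2 H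
          test_function_L2 test_function_deriv x)
    show "AE x in lebesgue_on Omega. (weak_partial Omega 1 (\<lambda>x. v x + s * \<psi> x) x - deriv (\<zeta> n) x)\<^sup>2 =
       (weak_partial Omega 1 v x - deriv (\<xi> n) x)\<^sup>2"
      using H1_add_test_function(2)[OF H assms(2), of s] by eventually_elim (simp add: d)
  qed
  moreover have "(\<lambda>x. (v x + s * \<psi> x - \<zeta> n x)\<^sup>2) = (\<lambda>x. (v x - \<xi> n x)\<^sup>2)" for n by (simp add: \<zeta>_def)
  ultimately show ?thesis unfolding H10_iff using H1_add_test_function(1)[OF H assms(2)] x z
    by (intro conjI exI[of _ \<zeta>]) auto
qed

lemma admissible_add_test_function:
  assumes "U \<in> admissible \<phi>" "\<psi> \<in> test_functions Omega"
    and "AE x in lebesgue_on Omega. U x + s * \<psi> x \<ge> \<phi> x"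
  shows "(\<lambda>x. U x + s * \<psi> x) \<in> admissible \<phi>"
proof -
  have "(\<lambda>x. U x + s * \<psi> x - \<phi> x) = (\<lambda>x. (U x - \<phi> x) + s * \<psi> x)" by auto
  then show ?thesis using assms H10_add_test_function[of "\<lambda>x. U x - \<phi> x" \<psi> s] H1_add_test_function(1)[of U \<psi> s]
    by (simp add: admissible_def)
qed

section \<open>The Euler-Lagrange inequality of one step\<close>

text \<open>The first variation of the energy in direction \<open>\<psi>\<close>, with both derivatives on \<open>\<psi>\<close>.\<close>

definition first_variation ::
  "real \<Rightarrow> real \<Rightarrow> (real \<Rightarrow> real) \<Rightarrow> (real \<Rightarrow> real) \<Rightarrow> (real \<Rightarrow> real) \<Rightarrow> real" where
  "first_variation b h w U \<psi> =
     (\<integral>x. (b * U x + (U x - w x) / h) * \<psi> x \<partial>lebesgue_on Omega) - (\<integral>x. U x * deriv (deriv \<psi>) x \<partial>lebesgue_on Omega)"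

text \<open>The energy is quadratic, hence a polynomial of degree two in \<open>s\<close> along a
  line. Its linear coefficient contains the integral of U' \<psi>'; the definition of the weak
  derivative, tested with \<open>deriv \<psi>\<close>, moves the remaining derivative onto
  \<open>\<psi>\<close>.\<close>

lemma energy_add_test_function:
  assumes U: "U \<in> H1 Omega" and w: "w \<in> L2 Omega" and t: "\<psi> \<in> test_functions Omega"
  shows "\<exists>Q. \<forall>s. energy b h w (\<lambda>x. U x + s * \<psi> x) = energy b h w U + s * first_variation b h w U \<psi> + s\<^sup>2 * Q"
proof -
  let ?M = "lebesgue_on Omega"
  define g where "g = weak_partial Omega 1 U"
  define B where "B = (\<lambda>x. (b * U x + (U x - w x) / h) * \<psi> x)"
  define A where "A = (\<lambda>x. \<bar>U x - w x\<bar>\<^sup>2 / h + (g x)\<^sup>2 + b * (U x)\<^sup>2)"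
  define C where "C = (\<lambda>x. (\<psi> x)\<^sup>2 / h + (deriv \<psi> x)\<^sup>2 + b * (\<psi> x)\<^sup>2)"
  have L: "U \<in> L2 Omega" "g \<in> L2 Omega" "\<psi> \<in> L2 Omega" "deriv \<psi> \<in> L2 Omega"
    unfolding g_def by (intro H1_L2 weak_partial_L2 U test_function_L2 test_function_deriv t)+
  have L1: "(\<lambda>x. U x - w x) \<in> L2 Omega" using L2_linear[OF L(1) w, of "-1"] by simp
  have L3: "(\<lambda>x. b * U x + (U x - w x) / h) \<in> L2 Omega"
    using L2_linear[OF L2_linear[OF L(1) L(1), of "b - 1"] L1, of "1 / h"]
    by (simp add: algebra_simps diff_divide_distrib)
  have iA: "integrable ?M A" unfolding A_def power2_abs
    using L L1 by (intro Bochner_Integration.integrable_add integrable_divide integrable_mult_right L2_D)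
  have iC: "integrable ?M C" unfolding C_def
    using L by (intro Bochner_Integration.integrable_add integrable_divide integrable_mult_right L2_D)
  have iB: "integrable ?M B" unfolding B_def by (intro L2_mult_integrable L3 L)
  have ig: "integrable ?M (\<lambda>x. g x * deriv \<psi> x)" by (intro L2_mult_integrable L)
  have "(\<integral>x. U x * deriv (deriv \<psi>) x \<partial>?M) = - (\<integral>x. g x * deriv \<psi> x \<partial>?M)"
    using has_weak_partial_weak_partial[OF U] test_function_deriv[OF t]
    by (auto simp: has_weak_partial_Omega_iff g_def)
  then have fv: "first_variation b h w U \<psi> = integral\<^sup>L ?M (\<lambda>x. B x + g x * deriv \<psi> x)"
    unfolding first_variation_def B_def[symmetric] using iB ig by simp
  have "energy b h w (\<lambda>x. U x + s * \<psi> x) = energy b h w U + s * first_variation b h w U \<psi> + s\<^sup>2 * (integral\<^sup>L ?M C / 2)" for s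
  proof -
    have H: "(\<lambda>x. U x + s * \<psi> x) \<in> H1 Omega" by (rule H1_add_test_function(1)[OF U t])
    have "(\<integral>x. \<bar>U x + s * \<psi> x - w x\<bar>\<^sup>2 / h + (weak_partial Omega 1 (\<lambda>x. U x + s * \<psi> x) x)\<^sup>2 + b * (U x + s * \<psi> x)\<^sup>2 \<partial>?M) =
      (\<integral>x. A x + (2 * s) * (B x + g x * deriv \<psi> x) + s\<^sup>2 * C x \<partial>?M)"
    proof (rule integral_cong_AE)
      show "(\<lambda>x. \<bar>U x + s * \<psi> x - w x\<bar>\<^sup>2 / h + (weak_partial Omega 1 (\<lambda>x. U x + s * \<psi> x) x)\<^sup>2 + b * (U x + s * \<psi> x)\<^sup>2) \<in> borel_measurable ?M"
        unfolding power2_abs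
        by (intro borel_measurable_add borel_measurable_divide borel_measurable_power borel_measurable_diff
            borel_measurable_times borel_measurable_const L2_D(1) L w weak_partial_L2 H)
      show "(\<lambda>x. A x + (2 * s) * (B x + g x * deriv \<psi> x) + s\<^sup>2 * C x) \<in> borel_measurable ?M"
        by (intro borel_measurable_add borel_measurable_times borel_measurable_const borel_measurable_integrable iA iB iC ig)
      show "AE x in ?M. \<bar>U x + s * \<psi> x - w x\<bar>\<^sup>2 / h + (weak_partial Omega 1 (\<lambda>x. U x + s * \<psi> x) x)\<^sup>2 + b * (U x + s * \<psi> x)\<^sup>2 =
         A x + (2 * s) * (B x + g x * deriv \<psi> x) + s\<^sup>2 * C x"
        using H1_add_test_function(2)[OF U t, of s]
      proof eventually_elim
        case (elim x)
        have "(U x + s * \<psi> x - w x)\<^sup>2 / h = (U x - w x)\<^sup>2 / h + 2 * s * ((U x - w x) / h * \<psi> x) + s\<^sup>2 * ((\<psi> x)\<^sup>2 / h)"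
          by (cases "h = 0") (simp_all add: field_simps power2_eq_square)
        then show ?case unfolding elim A_def B_def C_def g_def power2_abs
          by (simp add: power2_eq_square algebra_simps)
      qed
    qed
    also have "\<dots> = integral\<^sup>L ?M A + (2 * s) * first_variation b h w U \<psi> + s\<^sup>2 * integral\<^sup>L ?M C"
      unfolding fv using iA iB iC ig by simp
    finally show ?thesis unfolding energy_def A_def g_def by simp
  qed
  then show ?thesis by blast
qed

lemma linear_coefficient_nonneg:
  fixes L Q :: real
  assumes "s0 > 0" "\<And>s. 0 < s \<Longrightarrow> s \<le> s0 \<Longrightarrow> 0 \<le> s * L + s\<^sup>2 * Q"
  shows "L \<ge> 0"
proof (rule ccontr)
  assume "\<not> L \<ge> 0"
  \<comment> \<open>Chosen so that s |Q| is at most -L/2, which leaves the linear term dominant; the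
    added 1 keeps the denominator positive.\<close>
  define s where "s = min s0 (- L / (2 * (\<bar>Q\<bar> + 1)))"
  have "- L / (2 * (\<bar>Q\<bar> + 1)) > 0" using \<open>\<not> L \<ge> 0\<close> by (intro divide_pos_pos) auto
  then have s: "s > 0" "s \<le> s0" using assms(1) by (auto simp: s_def)
  have "0 \<le> s * (L + s * Q)" using assms(2)[OF s] by (simp add: power2_eq_square algebra_simps)
  then have "0 \<le> L + s * Q" using s by (simp add: zero_le_mult_iff)
  moreover have "s * Q \<le> s * (\<bar>Q\<bar> + 1)" using s by (intro mult_left_mono) auto
  moreover have "s * (\<bar>Q\<bar> + 1) \<le> (- L / (2 * (\<bar>Q\<bar> + 1))) * (\<bar>Q\<bar> + 1)"
    unfolding s_def by (intro mult_right_mono) auto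
  moreover have "(- L / (2 * (\<bar>Q\<bar> + 1))) * (\<bar>Q\<bar> + 1) = - L / 2" by (simp add: field_simps)
  ultimately show False using \<open>\<not> L \<ge> 0\<close> by linarith
qed

text \<open>The factor \<open>\<sigma>\<close> selects the side of the variation. For nonnegative
  \<open>\<psi>\<close>, upward variations are always admissible; downward ones are admissible for
  small \<open>s\<close> if the minimizer stays above the obstacle near the support of
  \<open>\<psi>\<close>.\<close>

lemma first_variation_nonneg:
  assumes min: "is_arg_min (energy b h w) (\<lambda>v. v \<in> admissible \<phi>) U" and w: "w \<in> L2 Omega"
    and t: "\<psi> \<in> test_functions Omega" and s0: "s0 > 0"
    and adm: "\<And>s. 0 < s \<Longrightarrow> s \<le> s0 \<Longrightarrow> AE x in lebesgue_on Omega. U x + (s * \<sigma>) * \<psi> x \<ge> \<phi> x"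
  shows "\<sigma> * first_variation b h w U \<psi> \<ge> 0"
proof -
  have U: "U \<in> admissible \<phi>" and le: "\<And>v. v \<in> admissible \<phi> \<Longrightarrow> energy b h w U \<le> energy b h w v"
    using min by (auto simp: is_arg_min_def not_less)
  from U have "U \<in> H1 Omega" by (simp add: admissible_def)
  from energy_add_test_function[OF this w t] obtain Q where
    Q: "\<And>s. energy b h w (\<lambda>x. U x + s * \<psi> x) = energy b h w U + s * first_variation b h w U \<psi> + s\<^sup>2 * Q" by blast
  show ?thesis
  proof (rule linear_coefficient_nonneg[OF s0, of _ "\<sigma>\<^sup>2 * Q"])
    fix s assume "0 < s" "s \<le> s0"
    from le[OF admissible_add_test_function[OF U t adm[OF this]]] Q[of "s * \<sigma>"]
    show "0 \<le> s * (\<sigma> * first_variation b h w U \<psi>) + s\<^sup>2 * (\<sigma>\<^sup>2 * Q)"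
      by (simp add: power_mult_distrib mult.assoc)
  qed
qed

section \<open>Pointwise order and boundary values of continuous representatives\<close>

lemma AE_lebesgue_on_ex_in_open:
  fixes S V :: "'a::euclidean_space set"
  assumes "AE x in lebesgue_on S. P x" "S \<in> sets lebesgue" "open V" "V \<noteq> {}" "V \<subseteq> S"
  shows "\<exists>x\<in>V. P x"
proof (rule ccontr)
  assume "\<not> (\<exists>x\<in>V. P x)"
  then have np: "\<And>x. x \<in> V \<Longrightarrow> \<not> P x" by blast
  have "AE x in lebesgue. x \<in> S \<longrightarrow> P x"
    using assms(1,2) by (subst (asm) AE_restrict_space_iff) auto
  then have "AE x in lebesgue. x \<notin> V" by eventually_elim (use np assms(5) in blast)
  then have "V \<in> null_sets lebesgue"
    using AE_iff_null_sets[of V lebesgue] assms(3) by simp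
  then show False using open_not_negligible[OF assms(3,4)] by (simp add: negligible_iff_null_sets)
qed

text \<open>A strict violation would persist, by continuity, on a nonempty open subset of
  \<open>S\<close>, which is not a null set. It is used both on the interval and in space-time, and
  there also yields the inequality at the initial time.\<close>

lemma continuous_AE_le:
  fixes f g :: "'a::euclidean_space \<Rightarrow> real"
  assumes ae: "AE x in lebesgue_on S. f x \<le> g x" and S: "open S"
    and c: "continuous_on D f" "continuous_on D g" and D: "S \<subseteq> D" "D \<subseteq> closure S" and x: "x \<in> D"
  shows "f x \<le> g x"
proof (rule ccontr)
  assume "\<not> f x \<le> g x"
  have "continuous_on D (\<lambda>x. f x - g x)" using c by (intro continuous_on_diff)
  moreover have "f x - g x > 0" using \<open>\<not> f x \<le> g x\<close> by simp
  ultimately have "\<exists>d>0. \<forall>y\<in>D. dist y x < d \<longrightarrow> dist (f y - g y) (f x - g x) < f x - g x"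
    using x unfolding continuous_on_iff by blast
  then obtain d where d: "d > 0" "\<And>y. y \<in> D \<Longrightarrow> dist y x < d \<Longrightarrow> dist (f y - g y) (f x - g x) < f x - g x"
    by blast
  obtain z where "z \<in> S" "dist z x < d"
    using x D(2) d(1) closure_approachable[of x S] by blast
  then have "z \<in> ball x d \<inter> S" by (simp add: dist_commute)
  then have "ball x d \<inter> S \<noteq> {}" "open (ball x d \<inter> S)" "S \<in> sets lebesgue"
    using S by (auto simp: open_Int)
  then have "\<exists>y \<in> ball x d \<inter> S. f y \<le> g y"
    by (intro AE_lebesgue_on_ex_in_open[OF ae]) auto
  then obtain y where y: "y \<in> ball x d \<inter> S" "f y \<le> g y" by blast
  then have "dist (f y - g y) (f x - g x) < f x - g x" using D(1) by (intro d) (auto simp: dist_commute)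
  then show False using y(2) by (simp add: dist_real_def)
qed

text \<open>The Hoelder-1/2 estimate coming from a bound on the integral of (\<psi>')^2. It depends
  on \<open>\<psi>\<close> only through \<open>M\<close>, so it applies uniformly to an
  approximating sequence.\<close>

lemma test_function_boundary_decay:
  assumes t: "\<psi> \<in> test_functions Omega" and M: "(\<integral>x. (deriv \<psi> x)\<^sup>2 \<partial>lebesgue_on Omega) \<le> M"
    and x: "x \<in> Omega" and p: "p \<in> {-1, 1}"
  shows "\<bar>\<psi> x\<bar> \<le> sqrt \<bar>x - p\<bar> * (M + 1) / 2"
proof -
  obtain a b where ab: "-1 < a" "a < b" "b < 1" "\<And>x. x \<le> a \<or> x \<ge> b \<Longrightarrow> \<psi> x = 0"
    using test_function_support[OF t] by blast
  have s: "smooth \<psi>" using t by (rule test_function_smooth)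
  \<comment> \<open>The interval [a', b'] contains the support and the point \<open>x\<close>, lies
    inside the open interval, and has endpoints where \<open>\<psi>\<close> vanishes.\<close>
  define a' where "a' = min a ((x - 1) / 2)"
  define b' where "b' = max b ((x + 1) / 2)"
  have ab': "-1 < a'" "a' < x" "x < b'" "b' < 1" "a' \<le> a" "b \<le> b'"
  proof -
    have "(x - 1) / 2 < x" "x < (x + 1) / 2" "(x + 1) / 2 < 1" "-1 < (x - 1) / 2" using x by auto
    then show "-1 < a'" "a' < x" "x < b'" "b' < 1" "a' \<le> a" "b \<le> b'"
      using ab unfolding a'_def b'_def by linarith+
  qed
  have cd: "continuous_on I (\<lambda>x. (deriv \<psi> x)\<^sup>2)" for I
    by (intro continuous_on_power smooth_continuous smooth_deriv s)
  have "(\<integral>x. (deriv \<psi> x)\<^sup>2 \<partial>lebesgue_on Omega) = integral {a'..b'} (\<lambda>x. (deriv \<psi> x)\<^sup>2)"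
    by (rule integral_supported(2)) (use ab' cd zero_deriv_outside[of a b \<psi>, OF ab(4)] in \<open>auto simp: not_le\<close>)
  then have M': "integral {a'..b'} (\<lambda>x. (deriv \<psi> x)\<^sup>2) \<le> M" using M by simp
  have sub: "integral {c..d} (\<lambda>x. (deriv \<psi> x)\<^sup>2) \<le> M" if "a' \<le> c" "d \<le> b'" for c d
    by (rule order_trans[OF integral_subset_le[of "{c..d}" "{a'..b'}"] M']) (use that in \<open>simp_all add: integrable_continuous_real cd\<close>)
  define l where "l = \<bar>x - p\<bar>"
  have l: "l > 0" using x p by (auto simp: l_def)
  \<comment> \<open>Young's inequality |\<psi>'| \<le> \<tau>/2 (\<psi>')^2 + 1/(2 \<tau>),
    integrated over a length at most l, gives (\<tau> M + l/\<tau>)/2; this \<tau> balances the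
    powers of l.\<close>
  define \<tau> where "\<tau> = sqrt l"
  have \<tau>: "\<tau> > 0" "\<tau> * \<tau> = l" using l by (auto simp: \<tau>_def)
  have bound: "\<bar>\<psi> d - \<psi> c\<bar> \<le> (\<tau> * M + l / \<tau>) / 2" if "a' \<le> c" "c \<le> d" "d \<le> b'" "d - c \<le> l" for c d
  proof -
    have "(deriv \<psi> has_integral (\<psi> d - \<psi> c)) {c..d}"
    proof (rule fundamental_theorem_of_calculus[OF that(2)])
      show "(\<psi> has_vector_derivative deriv \<psi> y) (at y within {c..d})" for y
        using smooth_has_deriv[OF s, of y] has_vector_derivative_at_within
        unfolding has_real_derivative_iff_has_vector_derivative by blast
    qed
    then have I: "\<psi> d - \<psi> c = integral {c..d} (deriv \<psi>)" by (simp add: integral_unique)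
    define J where "J = integral {c..d} (\<lambda>x. (deriv \<psi> x)\<^sup>2)"
    have "((\<lambda>x. (deriv \<psi> x)\<^sup>2) has_integral J) {c..d}"
      unfolding J_def by (intro integrable_integral integrable_continuous_real cd)
    then have K: "((\<lambda>x. \<tau> / 2 * (deriv \<psi> x)\<^sup>2 + 1 / (2 * \<tau>)) has_integral (\<tau> / 2 * J + (d - c) *\<^sub>R (1 / (2 * \<tau>)))) {c..d}"
      using has_integral_const_real[of "1 / (2 * \<tau>)" c d] that(2)
      by (intro has_integral_add has_integral_mult_right) auto
    have "\<bar>deriv \<psi> y\<bar> \<le> \<tau> / 2 * (deriv \<psi> y)\<^sup>2 + 1 / (2 * \<tau>)" for y
    proof -
      define z where "z = \<bar>deriv \<psi> y\<bar>"
      have "0 \<le> (\<tau> * z - 1)\<^sup>2" by simp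
      then have "2 * \<tau> * z \<le> \<tau>\<^sup>2 * z\<^sup>2 + 1"
        by (simp add: power2_diff power_mult_distrib mult.assoc)
      then have "2 * \<tau> * z / (2 * \<tau>) \<le> (\<tau>\<^sup>2 * z\<^sup>2 + 1) / (2 * \<tau>)"
        using \<tau>(1) by (intro divide_right_mono) auto
      also have "(\<tau>\<^sup>2 * z\<^sup>2 + 1) / (2 * \<tau>) = \<tau> / 2 * z\<^sup>2 + 1 / (2 * \<tau>)"
        using \<tau>(1) by (simp add: add_divide_distrib power2_eq_square)
      also have "2 * \<tau> * z / (2 * \<tau>) = z" using \<tau>(1) by simp
      finally show ?thesis by (simp add: z_def)
    qed
    then have "norm (integral {c..d} (deriv \<psi>)) \<le> integral {c..d} (\<lambda>x. \<tau> / 2 * (deriv \<psi> x)\<^sup>2 + 1 / (2 * \<tau>))"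
      by (intro integral_norm_bound_integral integrable_continuous_real smooth_continuous smooth_deriv s
          has_integral_integrable[OF K]) simp
    then have "\<bar>integral {c..d} (deriv \<psi>)\<bar> \<le> \<tau> / 2 * J + (d - c) * (1 / (2 * \<tau>))"
      using K by (simp add: integral_unique)
    also have "\<dots> = (\<tau> * J + (d - c) / \<tau>) / 2" by (simp add: add_divide_distrib)
    also have "\<dots> \<le> (\<tau> * M + l / \<tau>) / 2"
      using sub[of c d] that \<tau> unfolding J_def by (intro divide_right_mono add_mono mult_left_mono) auto
    finally show ?thesis unfolding I .
  qed
  have "\<bar>\<psi> x\<bar> \<le> (\<tau> * M + l / \<tau>) / 2"
  proof (cases "p = -1")
    case True
    have "\<psi> a' = 0" using ab(4)[of a'] ab' by simp
    then show ?thesis using bound[of a' x] ab' True x by (simp add: l_def)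
  next
    case False
    then have "p = 1" using p by simp
    have "\<psi> b' = 0" using ab(4)[of b'] ab' by simp
    then show ?thesis using bound[of x b'] ab' \<open>p = 1\<close> x by (simp add: l_def)
  qed
  also have "l / \<tau> = (\<tau> * \<tau>) / \<tau>" by (simp only: \<tau>(2))
  also have "\<dots> = \<tau>" using \<tau>(1) by simp
  finally have "\<bar>\<psi> x\<bar> \<le> \<tau> * (M + 1) / 2" by (simp add: distrib_left)
  then show ?thesis unfolding \<tau>_def l_def .
qed

text \<open>The approximating test functions eventually have bounded gradient energy, hence are
  uniformly small near \<open>p\<close>. If \<open>v p\<close> were nonzero, they would stay away
  from \<open>v\<close> on a fixed interval next to \<open>p\<close>, contradicting convergence in
  the mean.\<close>

lemma H10_boundary_zero:
  assumes v: "v \<in> H10 Omega" and c: "continuous_on Omega_bar v" and p: "p \<in> {-1, 1}"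
  shows "v p = 0"
proof (rule ccontr)
  let ?M = "lebesgue_on Omega"
  assume "v p \<noteq> 0"
  obtain \<xi> where H: "v \<in> H1 Omega" and x: "\<And>n. \<xi> n \<in> test_functions Omega"
     "(\<lambda>n. \<integral>x. (v x - \<xi> n x)\<^sup>2 \<partial>?M) \<longlonglongrightarrow> 0"
     "(\<lambda>n. \<integral>x. (weak_partial Omega 1 v x - deriv (\<xi> n) x)\<^sup>2 \<partial>?M) \<longlonglongrightarrow> 0"
    using v unfolding H10_iff by blast
  define g where "g = weak_partial Omega 1 v"
  have g: "g \<in> L2 Omega" unfolding g_def by (rule weak_partial_L2[OF H])
  \<comment> \<open>From d^2 \<le> 2 g^2 + 2 (g - d)^2, once the integral of (g - d)^2 is below
    1.\<close>
  define M where "M = 2 * (\<integral>x. (g x)\<^sup>2 \<partial>?M) + 2"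
  have M0: "M \<ge> 0" unfolding M_def by (simp add: integral_nonneg_AE)
  have MM: "(\<integral>x. (deriv (\<xi> n) x)\<^sup>2 \<partial>?M) \<le> M" if n: "(\<integral>x. (g x - deriv (\<xi> n) x)\<^sup>2 \<partial>?M) < 1" for n
  proof -
    have dx: "deriv (\<xi> n) \<in> L2 Omega" by (intro test_function_L2 test_function_deriv x)
    have gd: "(\<lambda>x. g x - deriv (\<xi> n) x) \<in> L2 Omega" using L2_linear[OF g dx, of "-1"] by simp
    have "(\<integral>x. (deriv (\<xi> n) x)\<^sup>2 \<partial>?M) \<le> (\<integral>x. 2 * (g x)\<^sup>2 + 2 * (g x - deriv (\<xi> n) x)\<^sup>2 \<partial>?M)"
    proof (rule integral_mono)
      show "integrable ?M (\<lambda>x. (deriv (\<xi> n) x)\<^sup>2)" by (rule L2_D[OF dx])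
      show "integrable ?M (\<lambda>x. 2 * (g x)\<^sup>2 + 2 * (g x - deriv (\<xi> n) x)\<^sup>2)"
        by (intro Bochner_Integration.integrable_add integrable_mult_right L2_D g gd)
      fix y
      have "0 \<le> (2 * g y - deriv (\<xi> n) y)\<^sup>2" by simp
      then show "(deriv (\<xi> n) y)\<^sup>2 \<le> 2 * (g y)\<^sup>2 + 2 * (g y - deriv (\<xi> n) y)\<^sup>2"
        by (simp add: power2_eq_square algebra_simps)
    qed
    also have "\<dots> = 2 * (\<integral>x. (g x)\<^sup>2 \<partial>?M) + 2 * (\<integral>x. (g x - deriv (\<xi> n) x)\<^sup>2 \<partial>?M)"
      using L2_D(2)[OF g] L2_D(2)[OF gd] by simp
    finally show ?thesis using n by (simp add: M_def)
  qed
  define k where "k = \<bar>v p\<bar> / 2"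
  have k: "k > 0" using \<open>v p \<noteq> 0\<close> by (simp add: k_def)
  have "p \<in> Omega_bar" using p by auto
  then obtain d where d: "d > 0" "\<And>y. y \<in> Omega_bar \<Longrightarrow> dist y p < d \<Longrightarrow> dist (v y) (v p) < k"
    using c k unfolding continuous_on_iff by metis
  \<comment> \<open>Within distance \<epsilon> of \<open>p\<close> the test functions are at most
    k/2 while |v| exceeds k, since |v p| = 2 k.\<close>
  define \<epsilon> where "\<epsilon> = min (min d 1) ((k / (M + 1))\<^sup>2)"
  have \<epsilon>: "\<epsilon> > 0" "\<epsilon> \<le> d" "\<epsilon> \<le> 1"
    using d(1) k M0 by (simp_all add: \<epsilon>_def)
  have "\<epsilon> \<le> (k / (M + 1))\<^sup>2" by (simp add: \<epsilon>_def)
  then have \<epsilon>4: "sqrt \<epsilon> \<le> k / (M + 1)" using k M0 by (intro real_le_lsqrt) auto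
  define I where "I = (if p = 1 then {1 - \<epsilon><..<1} else {-1<..<-1 + \<epsilon>})"
  have I: "I \<subseteq> Omega" "\<And>y. y \<in> I \<Longrightarrow> \<bar>y - p\<bar> < \<epsilon>" "emeasure lebesgue I = ennreal \<epsilon>" "I \<in> sets lebesgue"
    using \<epsilon> p by (auto simp: I_def)
  have "\<forall>\<^sub>F n in sequentially. (\<integral>x. (g x - deriv (\<xi> n) x)\<^sup>2 \<partial>?M) < 1"
    using x(3) unfolding g_def by (rule order_tendstoD) simp
  moreover have "\<forall>\<^sub>F n in sequentially. (\<integral>x. (v x - \<xi> n x)\<^sup>2 \<partial>?M) < (k / 2)\<^sup>2 * \<epsilon>"
    using x(2) by (rule order_tendstoD) (use k \<epsilon> in simp)
  ultimately have "\<forall>\<^sub>F n in sequentially. False"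
  proof eventually_elim
    case (elim n)
    have low: "(k / 2)\<^sup>2 \<le> (v y - \<xi> n y)\<^sup>2" if "y \<in> I" for y
    proof -
      have y: "y \<in> Omega" "\<bar>y - p\<bar> < \<epsilon>" using I that by auto
      have "\<bar>\<xi> n y\<bar> \<le> sqrt \<bar>y - p\<bar> * (M + 1) / 2"
        by (rule test_function_boundary_decay[OF x(1) MM[OF elim(1)] y(1) p])
      also have "\<dots> \<le> (k / (M + 1)) * (M + 1) / 2"
      proof -
        have "sqrt \<bar>y - p\<bar> \<le> sqrt \<epsilon>" using y(2) by simp
        then have "sqrt \<bar>y - p\<bar> \<le> k / (M + 1)" using \<epsilon>4 by linarith
        then show ?thesis using M0 by (intro divide_right_mono mult_right_mono) auto
      qed
      also have "\<dots> = k / 2" using M0 by simp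
      finally have "\<bar>\<xi> n y\<bar> \<le> k / 2" .
      moreover have "\<bar>v y - v p\<bar> < k" using d(2)[of y] y \<epsilon>(2) by (auto simp: dist_real_def)
      ultimately have "k / 2 \<le> \<bar>v y - \<xi> n y\<bar>" using k unfolding k_def by linarith
      then show ?thesis using abs_le_square_iff[of "k / 2" "v y - \<xi> n y"] k by simp
    qed
    have L2: "(\<lambda>x. v x - \<xi> n x) \<in> L2 Omega"
      using L2_linear[OF H1_L2[OF H] test_function_L2[OF x(1)], of "-1" n] by simp
    have Im: "I \<in> sets ?M" using I by (simp add: sets_restrict_space_iff)
    have em: "emeasure ?M I = ennreal \<epsilon>" using I by (subst emeasure_restrict_space) auto
    then have "measure ?M I = \<epsilon>" using \<epsilon> by (simp add: measure_def)
    have "(k / 2)\<^sup>2 * \<epsilon> = (\<integral>x. (k / 2)\<^sup>2 * indicator I x \<partial>?M)"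
      using Im em \<open>measure ?M I = \<epsilon>\<close> by (simp add: I(1) inf.absorb1)
    also have "\<dots> \<le> (\<integral>x. (v x - \<xi> n x)\<^sup>2 \<partial>?M)"
    proof (rule integral_mono)
      show "integrable ?M (\<lambda>x. (k / 2)\<^sup>2 * indicator I x)"
        using Im em by (intro integrable_mult_right integrable_real_indicator) auto
      show "integrable ?M (\<lambda>x. (v x - \<xi> n x)\<^sup>2)" by (rule L2_D[OF L2])
      show "(k / 2)\<^sup>2 * indicator I y \<le> (v y - \<xi> n y)\<^sup>2" for y
        using low[of y] by (auto simp: indicator_def)
    qed
    finally show False using elim(2) by simp
  qed
  then show False by simp
qed

section \<open>Mollified tents and concavity\<close>

lemma antiderivative_Omega:
  fixes f :: "real \<Rightarrow> real"
  assumes "continuous_on Omega f"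
  shows "\<exists>F. \<forall>x\<in>Omega. (F has_real_derivative f x) (at x)"
proof -
  have "isCont f x" if "ereal (-1) < ereal x" "ereal x < ereal 1" for x
    using assms that by (simp add: continuous_on_eq_continuous_at)
  then obtain F where "\<forall>x. ereal (-1) < ereal x \<longrightarrow> ereal x < ereal 1 \<longrightarrow> (F has_vector_derivative f x) (at x)"
    using einterval_antiderivative[of "ereal (-1)" "ereal 1" f] by auto
  then show ?thesis by (intro exI[of _ F]) (auto simp: has_real_derivative_iff_has_vector_derivative)
qed

text \<open>Integrability is part of the eventual claim: for small \<open>n\<close> the mollifier
  may reach the endpoints, where \<open>W\<close> need not be integrable, and the integrals are
  later to be added.\<close>

lemma mollifier_tendsto:
  fixes W \<rho> H1 :: "real \<Rightarrow> real"
  assumes d: "\<And>x. (H1 has_real_derivative \<rho> x) (at x)" and H: "H1 (-1) = 0" "H1 1 = 1"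
    and r: "\<And>x. \<rho> x \<ge> 0" "\<And>x. \<bar>x\<bar> \<ge> 1 \<Longrightarrow> \<rho> x = 0" and c: "continuous_on UNIV \<rho>"
    and W: "continuous_on Omega W" and x: "x \<in> Omega" and e: "\<epsilon> > 0"
  shows "\<forall>\<^sub>F n in sequentially.
    integrable (lebesgue_on Omega) (\<lambda>y. W y * (real (Suc n) * \<rho> (real (Suc n) * y + (- real (Suc n) * x)))) \<and>
    \<bar>(\<integral>y. W y * (real (Suc n) * \<rho> (real (Suc n) * y + (- real (Suc n) * x))) \<partial>lebesgue_on Omega) - W x\<bar> \<le> \<epsilon>"
proof -
  obtain d1 where d1: "d1 > 0" "\<And>y. y \<in> Omega \<Longrightarrow> dist y x < d1 \<Longrightarrow> dist (W y) (W x) < \<epsilon>"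
    using W x e unfolding continuous_on_iff by blast
  define d where "d = min d1 (min (1 + x) (1 - x)) / 2"
  have dpos: "d > 0" using d1 x by (auto simp: d_def)
  have dd: "d < d1" "d < 1 + x" "d < 1 - x" using d1(1) x by (auto simp: d_def)
  obtain N :: nat where N: "1 / d < real N" using reals_Archimedean2 by blast
  have "integrable (lebesgue_on Omega) (\<lambda>y. W y * (real (Suc n) * \<rho> (real (Suc n) * y + (- real (Suc n) * x)))) \<and>
    \<bar>(\<integral>y. W y * (real (Suc n) * \<rho> (real (Suc n) * y + (- real (Suc n) * x))) \<partial>lebesgue_on Omega) - W x\<bar> \<le> \<epsilon>"
    if n: "n \<ge> N" for n
  proof -
    define k where "k = real (Suc n)"
    have k: "k > 0" unfolding k_def by simp
    have "1 / d < k" using N n unfolding k_def by linarith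
    then have kd: "1 / k < d" using k dpos by (simp add: field_simps)
    define m where "m = (\<lambda>y. k * \<rho> (k * y + (- k * x)))"
    define a b where "a = x - 1 / k" and "b = x + 1 / k"
    have ab: "-1 < a" "b < 1" "a \<le> b" using kd dd k by (auto simp: a_def b_def)
    have sub: "y \<in> Omega" "dist y x < d1" if "y \<in> {a..b}" for y
      using that ab kd dd by (auto simp: a_def b_def dist_real_def)
    have cm: "continuous_on S m" for S unfolding m_def
      by (intro continuous_on_mult continuous_on_const continuous_on_compose2[OF c] continuous_intros) auto
    have mI: "(m has_integral 1) {a..b}"
    proof -
      have "(m has_integral (H1 (k * b + (- k * x)) - H1 (k * a + (- k * x)))) {a..b}"
      proof (rule fundamental_theorem_of_calculus[OF ab(3)])
        fix y
        have "((\<lambda>y. H1 (k * y + (- k * x))) has_real_derivative m y) (at y)"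
          unfolding m_def by (rule DERIV_chain'[OF _ d, THEN DERIV_cong]) (auto intro!: derivative_eq_intros)
        then show "((\<lambda>y. H1 (k * y + (- k * x))) has_vector_derivative m y) (at y within {a..b})"
          using has_vector_derivative_at_within unfolding has_real_derivative_iff_has_vector_derivative by blast
      qed
      moreover have "k * b + (- k * x) = 1" "k * a + (- k * x) = -1"
        using k by (auto simp: a_def b_def algebra_simps)
      ultimately show ?thesis using H by simp
    qed
    have cW: "continuous_on {a..b} W" using W by (rule continuous_on_subset) (use sub in blast)
    have cf: "continuous_on {a..b} (\<lambda>y. W y * m y)" by (intro continuous_on_mult cW cm)
    have z: "W y * m y = 0" if "y \<in> Omega" "y \<notin> {a..b}" for y
    proof -
      have "\<bar>y - x\<bar> \<ge> 1 / k" using that(2) by (auto simp: a_def b_def)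
      then have "k * \<bar>y - x\<bar> \<ge> 1" using k by (simp add: field_simps)
      moreover have "\<bar>k * y + (- k * x)\<bar> = k * \<bar>y - x\<bar>"
        using k abs_mult[of k "y - x"] by (simp add: algebra_simps)
      ultimately have "\<bar>k * y + (- k * x)\<bar> \<ge> 1" by simp
      then show ?thesis unfolding m_def using r(2) by simp
    qed
    have I1: "integrable (lebesgue_on Omega) (\<lambda>y. W y * m y)"
      by (rule integral_supported(1)[OF ab(1,2) cf z])
    have I2: "(\<integral>y. W y * m y \<partial>lebesgue_on Omega) = integral {a..b} (\<lambda>y. W y * m y)"
      by (rule integral_supported(2)[OF ab(1,2) cf z])
    have fi: "((\<lambda>y. W y * m y) has_integral integral {a..b} (\<lambda>y. W y * m y)) {a..b}"
      by (intro integrable_integral integrable_continuous_real cf)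
    have up: "W y * m y \<le> (W x + \<epsilon>) * m y" and low: "(W x - \<epsilon>) * m y \<le> W y * m y" if "y \<in> {a..b}" for y
    proof -
      have "m y \<ge> 0" unfolding m_def using k r(1) by simp
      moreover have "\<bar>W y - W x\<bar> < \<epsilon>" using d1(2)[OF sub[OF that]] by (simp add: dist_real_def)
      ultimately show "W y * m y \<le> (W x + \<epsilon>) * m y" "(W x - \<epsilon>) * m y \<le> W y * m y"
        by (intro mult_right_mono; linarith)+
    qed
    have "integral {a..b} (\<lambda>y. W y * m y) \<le> (W x + \<epsilon>) * 1"
      by (rule has_integral_le[OF fi has_integral_mult_right[OF mI] up])
    moreover have "(W x - \<epsilon>) * 1 \<le> integral {a..b} (\<lambda>y. W y * m y)"
      by (rule has_integral_le[OF has_integral_mult_right[OF mI] fi low])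
    ultimately show ?thesis using I1 I2 unfolding m_def k_def by (simp add: abs_le_iff del: of_nat_Suc)
  qed
  then show ?thesis unfolding eventually_sequentially by blast
qed

text \<open>With \<open>x = t x1 + (1 - t) x2\<close>, these functions smooth the tent whose second derivative is \<open>t\<close> times the
  point mass at \<open>x1\<close> plus \<open>1 - t\<close> times that at \<open>x2\<close> minus that at \<open>x\<close>: a sign of the first
  variation in their direction is therefore concavity of \<open>W\<close>.\<close>

lemma tent_test_functions:
  fixes x1 x2 t :: real
  assumes x: "x1 \<in> Omega" "x2 \<in> Omega" "x1 \<le> x2" and t: "0 \<le> t" "t \<le> 1"
  obtains \<psi> :: "nat \<Rightarrow> real \<Rightarrow> real" where
    "\<And>n y. \<psi> n y \<ge> 0" "\<And>n. smooth (\<psi> n)"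
    "\<And>n y. y < x1 - 1 / real (Suc n) \<or> y > x2 + 1 / real (Suc n) \<Longrightarrow> \<psi> n y = 0"
    "\<And>W. continuous_on Omega W \<Longrightarrow>
       (\<lambda>n. \<integral>y. W y * deriv (deriv (\<psi> n)) y \<partial>lebesgue_on Omega) \<longlonglongrightarrow> t * W x1 + (1 - t) * W x2 - W (t * x1 + (1 - t) * x2)"
proof -
  obtain H H1 \<rho> :: "real \<Rightarrow> real" and c :: real where
    sH: "smooth H" and dH: "\<And>x. (H has_real_derivative H1 x) (at x)" and dH1: "\<And>x. (H1 has_real_derivative \<rho> x) (at x)"
    and H: "\<And>x. x \<le> -1 \<Longrightarrow> H x = 0" "\<And>x. x \<ge> 1 \<Longrightarrow> H x = x - c" and r: "\<And>x. \<rho> x \<ge> 0"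
    "\<And>x. \<bar>x\<bar> \<ge> 1 \<Longrightarrow> \<rho> x = 0" and H1: "\<And>x. x \<le> -1 \<Longrightarrow> H1 x = 0" "\<And>x. x \<ge> 1 \<Longrightarrow> H1 x = 1" and sr: "smooth \<rho>"
    by (rule smooth_ramp) metis
  have conv: "convex_on UNIV H"
    by (rule f''_ge0_imp_convex[OF convex_UNIV dH dH1 r(1)])
  define x where "x = t * x1 + (1 - t) * x2"
  have xx: "x1 \<le> x" "x \<le> x2"
  proof -
    have "x - x1 = (1 - t) * (x2 - x1)" by (simp add: x_def algebra_simps)
    then have "x - x1 \<ge> 0" using t x(3) by simp
    then show "x1 \<le> x" by simp
    have "x2 - x = t * (x2 - x1)" by (simp add: x_def algebra_simps)
    then have "x2 - x \<ge> 0" using t x(3) by simp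
    then show "x \<le> x2" by simp
  qed
  then have xO: "x \<in> Omega" using x by auto
  define R where "R = (\<lambda>n z y. H (real (Suc n) * y + (- real (Suc n) * z)))"
  \<comment> \<open>The factor 1/(n+1) keeps the slopes bounded and makes the second derivative a
    combination of the unit masses \<open>m\<close>. Nonnegativity is the convexity of
    \<open>H\<close>.\<close>
  define \<psi> where "\<psi> = (\<lambda>n y. (1 / real (Suc n)) * (t * R n x1 y + ((1 - t) * R n x2 y + (-1) * R n x y)))"
  define m where "m = (\<lambda>n z y. real (Suc n) * \<rho> (real (Suc n) * y + (- real (Suc n) * z)))"
  have sR: "smooth (R n z)" for n z unfolding R_def by (intro smooth_affine_compose sH)
  have s: "smooth (\<psi> n)" for n unfolding \<psi>_def by (intro smooth_mult smooth_add smooth_const sR)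
  have dR: "(R n z has_real_derivative real (Suc n) * H1 (real (Suc n) * y + (- real (Suc n) * z))) (at y)" for n z y
    unfolding R_def by (rule DERIV_chain'[OF _ dH, THEN DERIV_cong]) (auto intro!: derivative_eq_intros)
  have d1: "deriv (\<psi> n) = (\<lambda>y. t * H1 (real (Suc n) * y + (- real (Suc n) * x1)) +
      ((1 - t) * H1 (real (Suc n) * y + (- real (Suc n) * x2)) + (-1) * H1 (real (Suc n) * y + (- real (Suc n) * x))))" for n
  proof
    fix y
    have "(\<psi> n has_real_derivative (1 / real (Suc n)) * (t * (real (Suc n) * H1 (real (Suc n) * y + (- real (Suc n) * x1))) +
      ((1 - t) * (real (Suc n) * H1 (real (Suc n) * y + (- real (Suc n) * x2))) + (-1) * (real (Suc n) * H1 (real (Suc n) * y + (- real (Suc n) * x)))))) (at y)"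
      unfolding \<psi>_def by (intro DERIV_cmult DERIV_add dR)
    then show "deriv (\<psi> n) y = t * H1 (real (Suc n) * y + (- real (Suc n) * x1)) +
      ((1 - t) * H1 (real (Suc n) * y + (- real (Suc n) * x2)) + (-1) * H1 (real (Suc n) * y + (- real (Suc n) * x)))"
      by (intro DERIV_imp_deriv) (simp add: distrib_left right_diff_distrib del: of_nat_Suc)
  qed
  have dH1': "((\<lambda>y. H1 (real (Suc n) * y + (- real (Suc n) * z))) has_real_derivative m n z y) (at y)" for n z y
    unfolding m_def by (rule DERIV_chain'[OF _ dH1, THEN DERIV_cong]) (auto intro!: derivative_eq_intros)
  have d2: "deriv (deriv (\<psi> n)) y = t * m n x1 y + ((1 - t) * m n x2 y + (-1) * m n x y)" for n y
    unfolding d1 by (intro DERIV_imp_deriv DERIV_cmult DERIV_add dH1')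
  show ?thesis
  proof (rule that[of \<psi>])
    fix n y
    have arg: "real (Suc n) * y + (- real (Suc n) * x) =
        t * (real (Suc n) * y + (- real (Suc n) * x1)) + (1 - t) * (real (Suc n) * y + (- real (Suc n) * x2))"
      unfolding x_def by (simp add: algebra_simps)
    have "R n x y \<le> t * R n x1 y + (1 - t) * R n x2 y"
      unfolding R_def arg
      using convex_onD[OF conv, of "1 - t" "real (Suc n) * y + (- real (Suc n) * x1)" "real (Suc n) * y + (- real (Suc n) * x2)"] t
      by (simp del: of_nat_Suc)
    then show "\<psi> n y \<ge> 0" unfolding \<psi>_def by (intro mult_nonneg_nonneg) auto
    show "smooth (\<psi> n)" by (rule s)
    assume "y < x1 - 1 / real (Suc n) \<or> y > x2 + 1 / real (Suc n)"
    then show "\<psi> n y = 0"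
    proof
      assume "y < x1 - 1 / real (Suc n)"
      then have "R n z y = 0" if "x1 \<le> z" for z
      proof -
        have "y - z \<le> - 1 / real (Suc n)" using \<open>y < x1 - 1 / real (Suc n)\<close> that by linarith
        then have "real (Suc n) * (y - z) \<le> -1" by (simp add: field_simps)
        then show ?thesis unfolding R_def by (intro H(1)) (simp add: algebra_simps)
      qed
      then show ?thesis using xx x(3) by (simp add: \<psi>_def)
    next
      assume y: "y > x2 + 1 / real (Suc n)"
      have Rz: "R n z y = real (Suc n) * y + (- real (Suc n) * z) - c" if "z \<le> x2" for z
      proof -
        have "y - z \<ge> 1 / real (Suc n)" using y that by linarith
        then have "real (Suc n) * (y - z) \<ge> 1" by (simp add: field_simps)
        then show ?thesis unfolding R_def by (intro H(2)) (simp add: algebra_simps)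
      qed
      \<comment> \<open>All three copies are affine here, and their affine parts cancel because the
        weights sum to 0 and \<open>x\<close> is the weighted mean of \<open>x1\<close> and
        \<open>x2\<close>; the constant \<open>c\<close> drops out too.\<close>
      have "t * R n x1 y + ((1 - t) * R n x2 y + (-1) * R n x y) = 0"
        using xx x(3) by (simp only: Rz arg order_refl) (simp add: algebra_simps)
      then show ?thesis by (simp add: \<psi>_def)
    qed
  next
    fix W :: "real \<Rightarrow> real" assume W: "continuous_on Omega W"
    have ev: "\<forall>\<^sub>F n in sequentially. integrable (lebesgue_on Omega) (\<lambda>y. W y * m n z y) \<and>
       \<bar>(\<integral>y. W y * m n z y \<partial>lebesgue_on Omega) - W z\<bar> \<le> \<epsilon>" if "z \<in> Omega" "\<epsilon> > 0" for z \<epsilon>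
      unfolding m_def
      by (rule mollifier_tendsto[OF dH1 _ _ r smooth_continuous[OF sr] W that]) (simp_all add: H1)
    have lim: "(\<lambda>n. \<integral>y. W y * m n z y \<partial>lebesgue_on Omega) \<longlonglongrightarrow> W z" if "z \<in> Omega" for z
    proof (rule tendstoI)
      fix \<epsilon> :: real assume "\<epsilon> > 0"
      then have "\<epsilon> / 2 > 0" by simp
      from ev[OF that this] show "\<forall>\<^sub>F n in sequentially. dist (\<integral>y. W y * m n z y \<partial>lebesgue_on Omega) (W z) < \<epsilon>"
        by eventually_elim (use \<open>\<epsilon> > 0\<close> in \<open>simp add: dist_real_def\<close>)
    qed
    have "(\<lambda>n. t * (\<integral>y. W y * m n x1 y \<partial>lebesgue_on Omega) + ((1 - t) * (\<integral>y. W y * m n x2 y \<partial>lebesgue_on Omega)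
       + (-1) * (\<integral>y. W y * m n x y \<partial>lebesgue_on Omega))) \<longlonglongrightarrow> t * W x1 + ((1 - t) * W x2 + (-1) * W x)"
      by (intro tendsto_intros lim x xO)
    moreover have "\<forall>\<^sub>F n in sequentially. t * (\<integral>y. W y * m n x1 y \<partial>lebesgue_on Omega) + ((1 - t) * (\<integral>y. W y * m n x2 y \<partial>lebesgue_on Omega)
       + (-1) * (\<integral>y. W y * m n x y \<partial>lebesgue_on Omega)) = (\<integral>y. W y * deriv (deriv (\<psi> n)) y \<partial>lebesgue_on Omega)"
      using ev[OF x(1) zero_less_one] ev[OF x(2) zero_less_one] ev[OF xO zero_less_one]
    proof eventually_elim
      case (elim n)
      have "(\<integral>y. W y * deriv (deriv (\<psi> n)) y \<partial>lebesgue_on Omega) =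
        (\<integral>y. t * (W y * m n x1 y) + ((1 - t) * (W y * m n x2 y) + (-1) * (W y * m n x y)) \<partial>lebesgue_on Omega)"
        unfolding d2 by (rule Bochner_Integration.integral_cong) (auto simp: algebra_simps)
      also have "\<dots> = t * (\<integral>y. W y * m n x1 y \<partial>lebesgue_on Omega) + ((1 - t) * (\<integral>y. W y * m n x2 y \<partial>lebesgue_on Omega)
       + (-1) * (\<integral>y. W y * m n x y \<partial>lebesgue_on Omega))"
        using elim by simp
      finally show ?case by simp
    qed
    ultimately have "(\<lambda>n. \<integral>y. W y * deriv (deriv (\<psi> n)) y \<partial>lebesgue_on Omega) \<longlonglongrightarrow> t * W x1 + ((1 - t) * W x2 + (-1) * W x)"
      by (rule Lim_transform_eventually)
    moreover have "t * W x1 + ((1 - t) * W x2 + (-1) * W x) = t * W x1 + (1 - t) * W x2 - W (t * x1 + (1 - t) * x2)"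
      by (simp add: x_def)
    ultimately show "(\<lambda>n. \<integral>y. W y * deriv (deriv (\<psi> n)) y \<partial>lebesgue_on Omega) \<longlonglongrightarrow> t * W x1 + (1 - t) * W x2 - W (t * x1 + (1 - t) * x2)"
      by (simp only:)
  qed
qed

text \<open>A second antiderivative \<open>G2\<close> absorbs the zeroth-order terms. What remains
  is the distributional second derivative of U - G2, so the sign of the first variation becomes
  concavity of a continuous function.\<close>

lemma first_variation_eq:
  assumes t: "\<psi> \<in> test_functions Omega" and U: "continuous_on Omega U"
    and c: "continuous_on Omega (\<lambda>x. b * U x + (U x - w x) / h)"
    and G1: "\<And>x. x \<in> Omega \<Longrightarrow> (G1 has_real_derivative b * U x + (U x - w x) / h) (at x)"
    and G2: "\<And>x. x \<in> Omega \<Longrightarrow> (G2 has_real_derivative G1 x) (at x)"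
  shows "first_variation b h w U \<psi> = - (\<integral>x. (U x - G2 x) * deriv (deriv \<psi>) x \<partial>lebesgue_on Omega)"
proof -
  note t' = test_function_deriv[OF t] and t'' = test_function_deriv[OF test_function_deriv[OF t]]
  have cG1: "continuous_on Omega G1" using G1 DERIV_isCont by (intro continuous_at_imp_continuous_on) blast
  have cG2: "continuous_on Omega G2" using G2 DERIV_isCont by (intro continuous_at_imp_continuous_on) blast
  have "(\<integral>x. (b * U x + (U x - w x) / h) * \<psi> x \<partial>lebesgue_on Omega) = (\<integral>x. G2 x * deriv (deriv \<psi>) x \<partial>lebesgue_on Omega)"
    using test_function_by_parts[OF t G1 c] test_function_by_parts[OF t' G2 cG1] by simp
  moreover have "(\<integral>x. (U x - G2 x) * deriv (deriv \<psi>) x \<partial>lebesgue_on Omega) =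
      (\<integral>x. U x * deriv (deriv \<psi>) x \<partial>lebesgue_on Omega) - (\<integral>x. G2 x * deriv (deriv \<psi>) x \<partial>lebesgue_on Omega)"
    unfolding left_diff_distrib
    by (intro Bochner_Integration.integral_diff integrable_cont_test U cG2 t'')
  ultimately show ?thesis by (simp add: first_variation_def)
qed

text \<open>What the comparison arguments use of one step of the scheme: its minimizer \<open>U\<close> solves
  \<open>min {(U - w) / h - U'' + b U, U - \<phi>} = 0\<close>. The function \<open>U\<close> is semiconcave only, so its second
  derivative is replaced by that of a function \<open>\<Psi>\<close> touching \<open>U\<close> from above.\<close>

definition obstacle_step ::
  "real \<Rightarrow> real \<Rightarrow> (real \<Rightarrow> real) \<Rightarrow> (real \<Rightarrow> real) \<Rightarrow> (real \<Rightarrow> real) \<Rightarrow> bool" where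
  "obstacle_step b h \<phi> w U \<longleftrightarrow> continuous_on Omega_bar U \<and>
     (\<forall>x\<in>Omega_bar. \<phi> x \<le> U x) \<and> U (-1) = \<phi> (-1) \<and> U 1 = \<phi> 1 \<and>
     (\<forall>x\<in>Omega. \<exists>\<Psi> \<Psi>'. (\<forall>y\<in>Omega. (\<Psi> has_real_derivative \<Psi>' y) (at y) \<and>
        (\<Psi>' has_real_derivative b * U y + (U y - w y) / h) (at y)) \<and>
        \<Psi> x = U x \<and> (\<forall>y\<in>Omega. U y \<le> \<Psi> y) \<and>
        (\<phi> x < U x \<longrightarrow> (\<forall>\<^sub>F y in nhds x. \<Psi> y = U y)))"

text \<open>Upward variations make \<open>W\<close> = U - G2 concave, and off the contact set
  downward variations make it affine. Adding \<open>G2\<close> to a supporting line of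
  \<open>W\<close> at \<open>x\<close> gives the touching function, whose second derivative is that
  of \<open>G2\<close>.\<close>

lemma minimizer_obstacle_step:
  assumes min: "is_arg_min (energy b h w) (\<lambda>v. v \<in> admissible \<phi>) U"
    and cU: "continuous_on Omega_bar U" and cw: "continuous_on Omega_bar w" and cp: "continuous_on Omega_bar \<phi>"
    and h: "h > 0"
  shows "obstacle_step b h \<phi> w U"
proof -
  have U: "U \<in> admissible \<phi>" using min by (simp add: is_arg_min_def)
  have ge: "\<phi> x \<le> U x" if "x \<in> Omega_bar" for x
    by (rule continuous_AE_le[where S=Omega and f=\<phi> and g=U and D=Omega_bar]) (use U cp cU that in \<open>auto simp: admissible_def\<close>)
  have H10: "(\<lambda>x. U x - \<phi> x) \<in> H10 Omega" using U by (simp add: admissible_def)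
  have bd: "U p = \<phi> p" if "p \<in> {-1, 1}" for p
    using H10_boundary_zero[OF H10 _ that] cU cp by (simp add: continuous_on_diff)
  have wL: "w \<in> L2 Omega" by (rule continuous_L2_Omega[OF cw])
  have sub: "Omega \<subseteq> Omega_bar" by auto
  define G where "G = (\<lambda>x. b * U x + (U x - w x) / h)"
  have cUO: "continuous_on Omega U" using cU sub by (rule continuous_on_subset)
  have "continuous_on Omega_bar G" unfolding G_def using h by (intro continuous_intros cU cw) auto
  then have cG: "continuous_on Omega G" using sub by (rule continuous_on_subset)
  obtain G1 where G1: "\<And>x. x \<in> Omega \<Longrightarrow> (G1 has_real_derivative G x) (at x)"
    using antiderivative_Omega[OF cG] by blast
  have cG1: "continuous_on Omega G1" using G1 DERIV_isCont by (intro continuous_at_imp_continuous_on) blast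
  obtain G2 where G2: "\<And>x. x \<in> Omega \<Longrightarrow> (G2 has_real_derivative G1 x) (at x)"
    using antiderivative_Omega[OF cG1] by blast
  have cG2: "continuous_on Omega G2" using G2 DERIV_isCont by (intro continuous_at_imp_continuous_on) blast
  define W where "W = (\<lambda>x. U x - G2 x)"
  have cW: "continuous_on Omega W" unfolding W_def by (intro continuous_on_diff cUO cG2)
  have fv: "first_variation b h w U \<psi> = - (\<integral>x. W x * deriv (deriv \<psi>) x \<partial>lebesgue_on Omega)"
    if "\<psi> \<in> test_functions Omega" for \<psi>
    unfolding W_def by (rule first_variation_eq[OF that cUO cG[unfolded G_def] G1[unfolded G_def] G2])
  have tent: "t * W x1 + (1 - t) * W x2 \<le> W (t * x1 + (1 - t) * x2) \<and>
     ((\<forall>y\<in>{x1..x2}. \<phi> y < U y) \<longrightarrow> t * W x1 + (1 - t) * W x2 = W (t * x1 + (1 - t) * x2))"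
    if x: "x1 \<in> Omega" "x2 \<in> Omega" "x1 \<le> x2" and t: "0 \<le> t" "t \<le> 1" for x1 x2 t
  proof -
    obtain \<psi> :: "nat \<Rightarrow> real \<Rightarrow> real" where p: "\<And>n y. \<psi> n y \<ge> 0" "\<And>n. smooth (\<psi> n)"
      "\<And>n y. y < x1 - 1 / real (Suc n) \<or> y > x2 + 1 / real (Suc n) \<Longrightarrow> \<psi> n y = 0"
      and lim: "\<And>W. continuous_on Omega W \<Longrightarrow>
       (\<lambda>n. \<integral>y. W y * deriv (deriv (\<psi> n)) y \<partial>lebesgue_on Omega) \<longlonglongrightarrow> t * W x1 + (1 - t) * W x2 - W (t * x1 + (1 - t) * x2)"
      proof (rule tent_test_functions[OF x t], goal_cases)
      case (1 \<psi>)
      show thesis by (rule 1(1)[of \<psi>]) (fact 1)+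
    qed
    have small: "\<forall>\<^sub>F n in sequentially. 1 / real (Suc n) < \<epsilon>" if "\<epsilon> > 0" for \<epsilon> :: real
      using LIMSEQ_inverse_real_of_nat that by (intro order_tendstoD(2)[of _ 0]) (auto simp: inverse_eq_divide)
    have test: "\<psi> n \<in> test_functions Omega" if "1 / real (Suc n) < min (1 + x1) (1 - x2)" for n
      by (rule test_functionsI[OF p(2) _ _ p(3)]) (use that in auto)
    have "min (1 + x1) (1 - x2) > 0" using x by auto
    note smallO = small[OF this]
    have "\<forall>\<^sub>F n in sequentially. (\<integral>y. W y * deriv (deriv (\<psi> n)) y \<partial>lebesgue_on Omega) \<le> 0"
      using smallO
    proof eventually_elim
      case (elim n)
      have "1 * first_variation b h w U (\<psi> n) \<ge> 0"
      proof (rule first_variation_nonneg[OF min wL test[OF elim], of 1])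
        fix s :: real assume "0 < s"
        then have "\<phi> y \<le> U y + s * 1 * \<psi> n y" if "y \<in> Omega" for y
          using ge[of y] p(1)[of n y] that by (intro order_trans[OF ge]) auto
        then show "AE y in lebesgue_on Omega. \<phi> y \<le> U y + s * 1 * \<psi> n y" by (intro AE_I2) simp
      qed simp
      then show ?case using fv[OF test[OF elim]] by simp
    qed
    then have le: "t * W x1 + (1 - t) * W x2 - W (t * x1 + (1 - t) * x2) \<le> 0"
      by (rule tendsto_upperbound[OF lim[OF cW]]) simp
    moreover have "t * W x1 + (1 - t) * W x2 - W (t * x1 + (1 - t) * x2) \<ge> 0" if gt: "\<forall>y\<in>{x1..x2}. \<phi> y < U y"
    proof -
      define D where "D = (\<lambda>y. U y - \<phi> y)"
      have cD: "continuous_on Omega_bar D" unfolding D_def by (intro continuous_on_diff cU cp)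
      have iO: "x1 \<in> Omega_bar" "x2 \<in> Omega_bar" using x by auto
      have "D x1 > 0" "D x2 > 0" using gt x(3) by (auto simp: D_def)
      then obtain e1 e2 where e: "e1 > 0" "\<And>y. y \<in> Omega_bar \<Longrightarrow> dist y x1 < e1 \<Longrightarrow> dist (D y) (D x1) < D x1"
         "e2 > 0" "\<And>y. y \<in> Omega_bar \<Longrightarrow> dist y x2 < e2 \<Longrightarrow> dist (D y) (D x2) < D x2"
        using cD iO unfolding continuous_on_iff by metis
      \<comment> \<open>The tents exceed [x1, x2] by 1/(n+1), so strict separation from the obstacle
        is needed on a slightly larger interval.\<close>
      define \<epsilon> where "\<epsilon> = min (min e1 e2) (min (1 + x1) (1 - x2)) / 2"
      have \<epsilon>: "\<epsilon> > 0" "\<epsilon> < e1" "\<epsilon> < e2" "\<epsilon> < 1 + x1" "\<epsilon> < 1 - x2" using e(1,3) x by (auto simp: \<epsilon>_def)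
      have pos: "D y > 0" if "y \<in> {x1 - \<epsilon>..x2 + \<epsilon>}" for y
      proof -
        have y: "y \<in> Omega_bar" using that \<epsilon> by auto
        consider "y < x1" | "y \<in> {x1..x2}" | "y > x2" by fastforce
        then show ?thesis
        proof cases
          case 1
          then have "dist y x1 < e1" using that \<epsilon> by (auto simp: dist_real_def)
          from e(2)[OF y this] show ?thesis by (simp add: dist_real_def)
        next
          case 2 then show ?thesis using gt by (simp add: D_def)
        next
          case 3
          then have "dist y x2 < e2" using that \<epsilon> by (auto simp: dist_real_def)
          from e(4)[OF y this] show ?thesis by (simp add: dist_real_def)
        qed
      qed
      have ne: "{x1 - \<epsilon>..x2 + \<epsilon>} \<noteq> {}" using \<epsilon>(1) x(3) by auto
      have "continuous_on {x1 - \<epsilon>..x2 + \<epsilon>} D" using cD by (rule continuous_on_subset) (use \<epsilon> in auto)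
      then obtain z where z: "z \<in> {x1 - \<epsilon>..x2 + \<epsilon>}" "\<And>y. y \<in> {x1 - \<epsilon>..x2 + \<epsilon>} \<Longrightarrow> D z \<le> D y"
        using continuous_attains_inf[OF compact_Icc ne] by blast
      have "\<forall>\<^sub>F n in sequentially. (\<integral>y. W y * deriv (deriv (\<psi> n)) y \<partial>lebesgue_on Omega) \<ge> 0"
        using smallO small[OF \<epsilon>(1)]
      proof eventually_elim
        case (elim n)
        obtain M where M: "\<And>y. y \<in> {x1 - \<epsilon>..x2 + \<epsilon>} \<Longrightarrow> \<psi> n y \<le> \<psi> n M"
          using continuous_attains_sup[OF compact_Icc ne smooth_continuous[OF p(2)]] by blast
        \<comment> \<open>Up to this amplitude the variation stays below \<open>D z\<close>, the
          smallest gap to the obstacle on the enlarged interval; the added 1 covers a vanishing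
          tent.\<close>
        define s0 where "s0 = D z / (\<psi> n M + 1)"
        have s0: "s0 > 0" using pos[OF z(1)] p(1)[of n M] by (simp add: s0_def add_nonneg_pos)
        have "(-1) * first_variation b h w U (\<psi> n) \<ge> 0"
        proof (rule first_variation_nonneg[OF min wL test[OF elim(1)] s0])
          fix s :: real assume s: "0 < s" "s \<le> s0"
          have "\<phi> y \<le> U y + s * (-1) * \<psi> n y" if "y \<in> Omega" for y
          proof (cases "y \<in> {x1 - \<epsilon>..x2 + \<epsilon>}")
            case True
            have "s * \<psi> n y \<le> s0 * (\<psi> n M + 1)"
              using s M[OF True] p(1)[of n y] by (intro mult_mono) auto
            also have "\<dots> = D z" using p(1)[of n M] by (simp add: s0_def)
            also have "\<dots> \<le> D y" by (rule z(2)[OF True])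
            finally show ?thesis by (simp add: D_def)
          next
            case False
            then have "\<psi> n y = 0" using elim(2) by (intro p(3)) auto
            then show ?thesis using ge[of y] that by simp
          qed
          then show "AE y in lebesgue_on Omega. \<phi> y \<le> U y + s * (-1) * \<psi> n y" by (intro AE_I2) simp
        qed
        then show ?case using fv[OF test[OF elim(1)]] by simp
      qed
      then show ?thesis by (rule tendsto_lowerbound[OF lim[OF cW]]) simp
    qed
    ultimately show ?thesis by (auto intro: antisym)
  qed
  have concave: "convex_on Omega (\<lambda>x. - W x)"
  proof (rule convex_onI)
    fix t x y :: real assume t: "0 < t" "t < 1" and xy: "x \<in> Omega" "y \<in> Omega"
    show "- W ((1 - t) *\<^sub>R x + t *\<^sub>R y) \<le> (1 - t) * - W x + t * - W y"
    proof (cases "x \<le> y")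
      case True
      then show ?thesis using tent[OF xy True, of "1 - t"] t by simp
    next
      case False
      then have "y \<le> x" by simp
      then show ?thesis using tent[OF xy(2,1) \<open>y \<le> x\<close>, of t] t by (simp add: add.commute)
    qed
  qed simp
  have touch: "\<exists>\<Psi> \<Psi>'. (\<forall>y\<in>Omega. (\<Psi> has_real_derivative \<Psi>' y) (at y) \<and>
        (\<Psi>' has_real_derivative b * U y + (U y - w y) / h) (at y)) \<and>
        \<Psi> x = U x \<and> (\<forall>y\<in>Omega. U y \<le> \<Psi> y) \<and>
        (\<phi> x < U x \<longrightarrow> (\<forall>\<^sub>F y in nhds x. \<Psi> y = U y))" if x: "x \<in> Omega" for x
  proof -
    \<comment> \<open>The right derivative of the convex function -W at \<open>x\<close>, one of its
      subgradients there.\<close>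
    define l where "l = Inf ((\<lambda>t. (- W x - - W t) / (x - t)) ` ({x<..} \<inter> Omega))"
    have W: "W y \<le> W x - l * (y - x)" if "y \<in> Omega" for y
      using convex_le_Inf_differential[OF concave _ that, of x] x by (simp add: l_def interior_open)
    define \<Psi> where "\<Psi> = (\<lambda>y. G2 y + W x - l * (y - x))"
    have d1: "(\<Psi> has_real_derivative G1 y - l) (at y)" if "y \<in> Omega" for y
      unfolding \<Psi>_def by (rule derivative_eq_intros G2[OF that] refl | simp)+
    have d2: "((\<lambda>y. G1 y - l) has_real_derivative b * U y + (U y - w y) / h) (at y)" if "y \<in> Omega" for y
      using DERIV_diff[OF G1[OF that] DERIV_const] by (simp add: G_def)
    have eq: "\<Psi> x = U x" by (simp add: \<Psi>_def W_def)
    have le: "U y \<le> \<Psi> y" if "y \<in> Omega" for y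
      using W[OF that] unfolding \<Psi>_def W_def by linarith
    have ev: "\<forall>\<^sub>F y in nhds x. \<Psi> y = U y" if gt: "\<phi> x < U x"
    proof -
      have "continuous_on Omega (\<lambda>y. U y - \<phi> y)" using cU cp sub continuous_on_subset
        by (intro continuous_on_diff) blast+
      then obtain e1 where e1: "e1 > 0" "\<And>y. y \<in> Omega \<Longrightarrow> dist y x < e1 \<Longrightarrow> dist (U y - \<phi> y) (U x - \<phi> x) < U x - \<phi> x"
        using x gt unfolding continuous_on_iff by (metis diff_gt_0_iff_gt)
      define e where "e = min e1 (min (1 + x) (1 - x)) / 2"
      have e: "e > 0" "e < e1" "e < 1 + x" "e < 1 - x" using e1(1) x by (auto simp: e_def)
      have gt': "\<phi> y < U y" if "\<bar>y - x\<bar> \<le> e" for y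
      proof -
        have "y \<in> Omega" "dist y x < e1" using that e by (auto simp: dist_real_def)
        from e1(2)[OF this] show ?thesis by (simp add: dist_real_def)
      qed
      have "\<Psi> y = U y" if y: "\<bar>y - x\<bar> < e" for y
      proof -
        \<comment> \<open>Reflection at \<open>x\<close>. The values at \<open>y\<close> and
          \<open>y'\<close> both lie on or below the supporting line, and the affine case of the
          tent inequality gives them the mean \<open>W x\<close>, so both lie on it.\<close>
        define y' where "y' = 2 * x - y"
        have yO: "y \<in> Omega" "y' \<in> Omega" using y e by (auto simp: y'_def)
        have g: "\<forall>z\<in>{min y y'..max y y'}. \<phi> z < U z"
          by (intro ballI gt') (use y in \<open>auto simp: y'_def\<close>)
        have "1 / 2 * W (min y y') + (1 - 1 / 2) * W (max y y') = W (1 / 2 * min y y' + (1 - 1 / 2) * max y y')"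
          using tent[of "min y y'" "max y y'" "1 / 2"] g yO by auto
        moreover have "1 / 2 * min y y' + (1 - 1 / 2) * max y y' = x" by (auto simp: min_def max_def y'_def simp flip: add_divide_distrib)
        ultimately have "W y + W y' = 2 * W x" by (auto simp: min_def max_def split: if_splits)
        moreover have "W y' \<le> W x - l * (y' - x)" "W y \<le> W x - l * (y - x)" by (rule W yO)+
        moreover have "l * (y' - x) = - (l * (y - x))" by (simp add: y'_def algebra_simps)
        ultimately have "W y = W x - l * (y - x)" by linarith
        then show ?thesis by (simp add: \<Psi>_def W_def)
      qed
      then show ?thesis unfolding eventually_nhds_metric using e(1)
        by (intro exI[of _ e]) (auto simp: dist_real_def)
    qed
    show ?thesis
      by (rule exI[of _ \<Psi>], rule exI[of _ "\<lambda>y. G1 y - l"], intro conjI ballI impI eq) (erule d1 d2 le ev)+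
  qed
  show ?thesis unfolding obstacle_step_def
    by (intro conjI ballI cU ge touch bd) auto
qed

section \<open>The kernel of the implicit Euler scheme\<close>

lemma filterlim_abs_at_0: "filterlim (\<lambda>y::real. \<bar>y\<bar>) (at 0) (at 0)"
  unfolding filterlim_at
  by (auto intro!: tendsto_rabs_zero tendsto_ident_at simp: eventually_at_filter)

text \<open>The kernels are elementary functions of |y|. The vanishing derivative at 0 is what makes
  the even extension differentiable there.\<close>

lemma DERIV_even_abs:
  fixes k :: "real \<Rightarrow> real"
  assumes k: "\<And>s. (k has_real_derivative k' s) (at s)" and z: "k' 0 = 0"
  shows "((\<lambda>y. k \<bar>y\<bar>) has_real_derivative sgn y * k' \<bar>y\<bar>) (at y)"
proof (cases y "0 :: real" rule: linorder_cases)
  case equal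
  have "((\<lambda>s. (k s - k 0) / s) \<longlongrightarrow> 0) (at 0)"
    using k[of 0] z by (simp add: has_field_derivative_iff)
  then have "((\<lambda>y. (k \<bar>y\<bar> - k 0) / \<bar>y\<bar>) \<longlongrightarrow> 0) (at 0)"
    using filterlim_abs_at_0 by (rule filterlim_compose)
  then have "((\<lambda>y. \<bar>(k \<bar>y\<bar> - k 0) / \<bar>y\<bar>\<bar>) \<longlongrightarrow> 0) (at 0)" by (rule tendsto_rabs_zero)
  then have "((\<lambda>y. \<bar>(k \<bar>y\<bar> - k \<bar>0\<bar>) / (y - 0)\<bar>) \<longlongrightarrow> 0) (at 0)" by simp
  then have "((\<lambda>y. (k \<bar>y\<bar> - k \<bar>0\<bar>) / (y - 0)) \<longlongrightarrow> 0) (at 0)" by (rule tendsto_rabs_zero_cancel)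
  then show ?thesis unfolding has_field_derivative_iff equal by simp
next
  case greater
  have "((\<lambda>y. k y) has_real_derivative sgn y * k' \<bar>y\<bar>) (at y)" using k[of y] greater by simp
  then show ?thesis
    by (rule has_field_derivative_transform_within_open[of _ _ _ "{0<..}"]) (use greater in auto)
next
  case less
  have "((\<lambda>y. k (- y)) has_real_derivative sgn y * k' \<bar>y\<bar>) (at y)"
    using DERIV_mirror[THEN iffD1, of k "k' (-y)" y] k[of "-y"] less by simp
  then show ?thesis
    by (rule has_field_derivative_transform_within_open[of _ _ _ "{..<0}"]) (use less in auto)
qed

lemma DERIV_odd_abs:
  fixes k :: "real \<Rightarrow> real"
  assumes k: "\<And>s. (k has_real_derivative k' s) (at s)" and z: "k 0 = 0"
  shows "((\<lambda>y. sgn y * k \<bar>y\<bar>) has_real_derivative k' \<bar>y\<bar>) (at y)"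
proof -
  consider "y = 0" | "y > 0" | "y < 0" by linarith
  then show ?thesis
  proof cases
    case 1
    have "((\<lambda>s. k s / s) \<longlongrightarrow> k' 0) (at 0)"
      using k[of 0] z by (simp add: has_field_derivative_iff)
    then have "((\<lambda>y. k \<bar>y\<bar> / \<bar>y\<bar>) \<longlongrightarrow> k' 0) (at 0)"
      using filterlim_abs_at_0 by (rule filterlim_compose)
    moreover have "k \<bar>y\<bar> / \<bar>y\<bar> = (sgn y * k \<bar>y\<bar> - sgn 0 * k \<bar>0\<bar>) / (y - 0)" for y
      by (simp add: sgn_if)
    ultimately show ?thesis unfolding has_field_derivative_iff 1 by simp
  next
    case 2
    have "((\<lambda>y. k y) has_real_derivative k' \<bar>y\<bar>) (at y)" using k[of y] 2 by simp
    then show ?thesis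
      by (rule has_field_derivative_transform_within_open[of _ _ _ "{0<..}"]) (use 2 in auto)
  next
    case 3
    have "((\<lambda>y. - k (- y)) has_real_derivative - (- k' \<bar>y\<bar>)) (at y)"
      using DERIV_minus[OF DERIV_mirror[THEN iffD1, of k "k' (-y)" y]] k[of "-y"] 3 by simp
    then have "((\<lambda>y. - k (- y)) has_real_derivative k' \<bar>y\<bar>) (at y)" by simp
    then show ?thesis
      by (rule has_field_derivative_transform_within_open[of _ _ _ "{..<0}"]) (use 3 in auto)
  qed
qed

text \<open>The function \<open>kern n\<close> is the \<open>n + 1\<close>-fold convolution power of \<open>exp (- \<bar>y\<bar>) / 2\<close>, the
  fundamental solution of \<open>f - f''\<close>; the recursion is that of the modified Bessel functions of
  half-integer order.\<close>

fun kern :: "nat \<Rightarrow> real \<Rightarrow> real" where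
  "kern 0 y = exp (- \<bar>y\<bar>) / 2"
| "kern (Suc 0) y = (1 + \<bar>y\<bar>) * exp (- \<bar>y\<bar>) / 4"
| "kern (Suc (Suc n)) y = (2 * real n + 3) / (2 * real n + 4) * kern (Suc n) y
     + y\<^sup>2 / (4 * (real n + 2) * (real n + 1)) * kern n y"

lemma kern_nonneg: "kern n y \<ge> 0"
  by (induction n y rule: kern.induct) auto

lemma kern_abs: "kern n \<bar>y\<bar> = kern n y"
  by (induction n y rule: kern.induct) auto

text \<open>The counterpart of the Bessel identity (z^p K_p)' = - z^p K_(p-1). The cases 0 and 1 are
  computed directly since the recursion for them would lead to the derivative of
  \<open>kern 0\<close>, which has a corner; from 2 on the product rule suffices.\<close>

lemma kern_deriv: "(kern (Suc n) has_real_derivative - (y / (2 * (real n + 1))) * kern n y) (at y)"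
proof (induction n arbitrary: y rule: less_induct)
  case (less n)
  consider "n = 0" | "n = 1" | m where "n = Suc (Suc m)"
    by (metis One_nat_def not0_implies_Suc)
  then show ?case
  proof cases
    case 1
    define k where "k = (\<lambda>s::real. (1 + s) * exp (- s) / 4)"
    have "(k has_real_derivative - s * exp (- s) / 4) (at s)" for s
      unfolding k_def by (auto intro!: derivative_eq_intros simp: algebra_simps)
    from DERIV_even_abs[of k, OF this, of y]
    have "((\<lambda>y. k \<bar>y\<bar>) has_real_derivative sgn y * (- \<bar>y\<bar> * exp (- \<bar>y\<bar>) / 4)) (at y)" by simp
    moreover have "sgn y * (- \<bar>y\<bar> * exp (- \<bar>y\<bar>) / 4) = - (y / (2 * (real n + 1))) * kern n y"
      using 1 by (simp add: sgn_if)
    moreover have "kern (Suc n) = (\<lambda>y. k \<bar>y\<bar>)" using 1 by (auto simp: k_def)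
    ultimately show ?thesis by (simp only:)
  next
    case 2
    \<comment> \<open>The closed form of \<open>kern 2\<close> in s = |y|.\<close>
    define k where "k = (\<lambda>s::real. (3 + 3 * s + s\<^sup>2) * exp (- s) / 16)"
    have "(k has_real_derivative - (s + s\<^sup>2) * exp (- s) / 16) (at s)" for s
      unfolding k_def by (auto intro!: derivative_eq_intros simp: field_simps)
    from DERIV_even_abs[of k, OF this, of y]
    have "((\<lambda>y. k \<bar>y\<bar>) has_real_derivative sgn y * (- (\<bar>y\<bar> + \<bar>y\<bar>\<^sup>2) * exp (- \<bar>y\<bar>) / 16)) (at y)" by simp
    moreover have "sgn y * (- (\<bar>y\<bar> + \<bar>y\<bar>\<^sup>2) * exp (- \<bar>y\<bar>) / 16) = - (y / (2 * (real n + 1))) * kern n y"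
      using 2 by (simp add: sgn_if power2_eq_square field_simps)
    moreover have "kern (Suc n) = (\<lambda>y. k \<bar>y\<bar>)" using 2 by (intro ext) (simp add: k_def power2_eq_square field_simps)
    ultimately show ?thesis by (simp only:)
  next
    case (3 m)
    define a where "a = real m"
    have a: "a \<ge> 0" by (simp add: a_def)
    have d1: "(kern (Suc (Suc m)) has_real_derivative - (y / (2 * (a + 2))) * kern (Suc m) y) (at y)"
    proof -
      have "real (Suc m) + 1 = a + 2" by (simp add: a_def)
      then show ?thesis using less[of "Suc m" y] 3 by (simp add: add.commute del: kern.simps of_nat_Suc)
    qed
    have d0: "(kern (Suc m) has_real_derivative - (y / (2 * (a + 1))) * kern m y) (at y)"
      using less[of m y] 3 by (simp add: a_def)
    have eq: "kern (Suc n) = (\<lambda>y. (2 * a + 5) / (2 * a + 6) * kern (Suc (Suc m)) y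
     + y\<^sup>2 / (4 * (a + 3) * (a + 2)) * kern (Suc m) y)"
      unfolding 3 kern.simps(3)[of "Suc m"] a_def by (simp add: add.commute)
    have "(kern (Suc n) has_real_derivative (2 * a + 5) / (2 * a + 6) * (- (y / (2 * (a + 2))) * kern (Suc m) y)
       + (y\<^sup>2 / (4 * (a + 3) * (a + 2)) * (- (y / (2 * (a + 1))) * kern m y)
          + 2 * y / (4 * (a + 3) * (a + 2)) * kern (Suc m) y)) (at y)"
      unfolding eq
      by (intro DERIV_add DERIV_cmult d1 DERIV_mult' d0) (use a in \<open>auto intro!: derivative_eq_intros\<close>)
    moreover have "(2 * a + 5) / (2 * a + 6) * (- (y / (2 * (a + 2))) * kern (Suc m) y)
       + (y\<^sup>2 / (4 * (a + 3) * (a + 2)) * (- (y / (2 * (a + 1))) * kern m y)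
          + 2 * y / (4 * (a + 3) * (a + 2)) * kern (Suc m) y) = - (y / (2 * (real n + 1))) * kern n y"
    proof -
      have n: "- (y / (2 * (real n + 1))) * kern n y = - (y / (2 * (a + 3))) * ((2 * a + 3) / (2 * a + 4) * kern (Suc m) y
     + y\<^sup>2 / (4 * (a + 2) * (a + 1)) * kern m y)"
        unfolding 3 kern.simps(3) a_def by (simp add: add.commute)
      have e1: "(2 * a + 5) / (2 * a + 6) * (- (y / (2 * (a + 2)))) + 2 * y / (4 * (a + 3) * (a + 2))
         = - (y / (2 * (a + 3))) * ((2 * a + 3) / (2 * a + 4))"
        using a by (simp add: divide_simps) (simp add: algebra_simps)
      have e2: "y\<^sup>2 / (4 * (a + 3) * (a + 2)) * (- (y / (2 * (a + 1)))) = - (y / (2 * (a + 3))) * (y\<^sup>2 / (4 * (a + 2) * (a + 1)))"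
        by (simp add: mult_ac) (simp add: algebra_simps)
      have "(2 * a + 5) / (2 * a + 6) * (- (y / (2 * (a + 2))) * kern (Suc m) y)
       + (y\<^sup>2 / (4 * (a + 3) * (a + 2)) * (- (y / (2 * (a + 1))) * kern m y)
          + 2 * y / (4 * (a + 3) * (a + 2)) * kern (Suc m) y) =
        ((2 * a + 5) / (2 * a + 6) * (- (y / (2 * (a + 2)))) + 2 * y / (4 * (a + 3) * (a + 2))) * kern (Suc m) y
        + (y\<^sup>2 / (4 * (a + 3) * (a + 2)) * (- (y / (2 * (a + 1))))) * kern m y"
        by (simp only: distrib_right mult.assoc add_ac)
      also have "\<dots> = - (y / (2 * (real n + 1))) * kern n y"
        unfolding n e1 e2 by (simp only: distrib_left mult.assoc)
      finally show ?thesis .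
    qed
    ultimately show ?thesis by simp
  qed
qed

text \<open>Together with \<open>kern_deriv\<close> this says that f = \<open>kern (Suc n)\<close>
  solves f - f'' = \<open>kern n\<close>: one implicit Euler step of unit length takes each kernel
  to the next.\<close>

lemma kern_deriv2:
  "((\<lambda>y. - (y / (2 * (real n + 1))) * kern n y) has_real_derivative kern (Suc n) y - kern n y) (at y)"
proof (cases n)
  case 0
  define k where "k = (\<lambda>s::real. (- 1 / 4) * (s * exp (- s)))"
  have "(k has_real_derivative (s - 1) * exp (- s) / 4) (at s)" for s
    unfolding k_def by (auto intro!: derivative_eq_intros simp: field_simps)
  from DERIV_odd_abs[of k, OF this, of y]
  have "((\<lambda>y. sgn y * k \<bar>y\<bar>) has_real_derivative (\<bar>y\<bar> - 1) * exp (- \<bar>y\<bar>) / 4) (at y)" by (simp add: k_def)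
  moreover have "(\<lambda>y. sgn y * k \<bar>y\<bar>) = (\<lambda>y. - (y / (2 * (real n + 1))) * kern n y)"
    using 0 by (auto simp: k_def sgn_if)
  moreover have "(\<bar>y\<bar> - 1) * exp (- \<bar>y\<bar>) / 4 = kern (Suc n) y - kern n y"
    using 0 by (simp add: field_simps)
  ultimately show ?thesis by simp
next
  case (Suc m)
  define a where "a = real m"
  have a: "a \<ge> 0" by (simp add: a_def)
  have d: "(kern n has_real_derivative - (y / (2 * (a + 1))) * kern m y) (at y)"
    unfolding Suc a_def by (rule kern_deriv)
  have n: "real n = a + 1" using Suc by (simp add: a_def)
  have D: "((\<lambda>y. - (y / (2 * (a + 2))) * kern n y) has_real_derivative
      - (y / (2 * (a + 2))) * (- (y / (2 * (a + 1))) * kern m y) + - (1 / (2 * (a + 2))) * kern n y) (at y)"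
    by (intro DERIV_mult' d) (use a in \<open>auto intro!: derivative_eq_intros\<close>)
  have R: "kern (Suc n) y = (2 * a + 3) / (2 * a + 4) * kern n y + y\<^sup>2 / (4 * (a + 2) * (a + 1)) * kern m y"
    unfolding Suc a_def by simp
  have P: "- (y / (2 * (a + 2))) * (- (y / (2 * (a + 1))) * kern m y) = y\<^sup>2 / (4 * (a + 2) * (a + 1)) * kern m y"
    by (simp add: power2_eq_square mult_ac) (simp add: algebra_simps)
  have coeff: "- (1 / (2 * (a + 2))) = (2 * a + 3) / (2 * a + 4) - 1"
  proof -
  have "2 * a + 4 \<noteq> 0" using a by simp
  then have "((2 * a + 4) - 1) / (2 * a + 4) = 1 - 1 / (2 * a + 4)"
    by (subst diff_divide_distrib) simp
  moreover have "(2 * a + 4) - 1 = 2 * a + 3" by simp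
  ultimately have "(2 * a + 3) / (2 * a + 4) = 1 - 1 / (2 * (a + 2))" by (simp only: distrib_left) simp
  then show ?thesis by linarith
  qed
  have "- (y / (2 * (a + 2))) * (- (y / (2 * (a + 1))) * kern m y) + - (1 / (2 * (a + 2))) * kern n y =
      kern (Suc n) y - kern n y"
    unfolding P R coeff left_diff_distrib by simp
  moreover have "a + 2 = real n + 1" by (simp add: n)
  ultimately show ?thesis using D by (simp only:)
qed

text \<open>The value \<open>kern n 0\<close> is the binomial coefficient (2n choose n) over
  2^(2n+1). The left-hand side does not increase with n, because (2a+3)(2a+5) \<le> (2a+4)^2, and it
  equals 1/4 at n = 0.\<close>

lemma kern_0_sq: "(kern n 0)\<^sup>2 * (2 * real n + 1) \<le> 1 / 4"
proof (induction n)
  case (Suc m)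
  show ?case
  proof (cases m)
    case (Suc n)
  define a where "a = real n"
  have a: "a \<ge> 0" by (simp add: a_def)
  have "kern (Suc (Suc n)) 0 = (2 * a + 3) / (2 * a + 4) * kern (Suc n) 0" by (simp add: a_def)
  then have "(kern (Suc (Suc n)) 0)\<^sup>2 * (2 * real (Suc (Suc n)) + 1) =
     ((2 * a + 3) * (2 * a + 5) / (2 * a + 4)\<^sup>2) * ((kern (Suc n) 0)\<^sup>2 * (2 * a + 3))"
    by (simp add: a_def power_mult_distrib power_divide power2_eq_square algebra_simps)
  also have "\<dots> \<le> 1 * ((kern (Suc n) 0)\<^sup>2 * (2 * a + 3))"
  proof (rule mult_right_mono)
    show "(2 * a + 3) * (2 * a + 5) / (2 * a + 4)\<^sup>2 \<le> 1"
    proof (subst divide_le_eq_1_pos)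
      show "(2 * a + 4)\<^sup>2 > 0" using a by (intro zero_less_power) simp
      show "(2 * a + 3) * (2 * a + 5) \<le> (2 * a + 4)\<^sup>2" by (simp add: power2_eq_square algebra_simps)
    qed
  qed (use a in simp)
  also have "\<dots> \<le> 1 / 4" using Suc.IH Suc by (simp add: a_def algebra_simps)
  finally show ?thesis using Suc by simp
  qed (simp add: power2_eq_square)
qed (simp add: power2_eq_square)

text \<open>The decay of order 1/sqrt n in a form that telescopes. The kernel is largest at 0, and
  the difference of roots is the reciprocal of their sum.\<close>

lemma kern_le: "kern n y \<le> sqrt (real n + 1) - sqrt (real n)"
proof -
  have "kern n y \<le> kern n 0"
  proof (cases n)
    case 0 then show ?thesis by simp
  next
    case (Suc m)
    have "kern n \<bar>y\<bar> \<le> kern n 0"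
    proof (rule DERIV_nonpos_imp_nonincreasing[of 0 "\<bar>y\<bar>"])
      fix s :: real assume "0 \<le> s"
      then show "\<exists>z. (kern n has_real_derivative z) (at s) \<and> z \<le> 0"
        using kern_deriv[of m s] kern_nonneg[of m s] Suc
        by (intro exI[of _ "- (s / (2 * (real m + 1))) * kern m s"]) simp
    qed simp
    then show ?thesis by (simp add: kern_abs)
  qed
  also have "kern n 0 \<le> sqrt (real n + 1) - sqrt (real n)"
  proof -
    define A B where "A = sqrt (real n + 1)" and "B = sqrt (real n)"
    have AB: "A > 0" "B \<ge> 0" "A\<^sup>2 = real n + 1" "B\<^sup>2 = real n" by (auto simp: A_def B_def)
    have "(A + B)\<^sup>2 \<le> 2 * (A\<^sup>2 + B\<^sup>2)"
      using zero_le_power2[of "A - B"] by (simp add: power2_eq_square algebra_simps)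
    then have "(kern n 0 * (A + B))\<^sup>2 \<le> (kern n 0)\<^sup>2 * (2 * (2 * real n + 1))"
      unfolding power_mult_distrib using AB by (intro mult_left_mono) auto
    also have "\<dots> \<le> 1\<^sup>2" using kern_0_sq[of n] unfolding power_one by linarith
    finally have "kern n 0 * (A + B) \<le> 1" by (rule power2_le_imp_le) simp
    moreover have "(A - B) * (A + B) = 1" using AB by (simp add: algebra_simps power2_eq_square)
    ultimately have "kern n 0 * (A + B) \<le> (A - B) * (A + B)" by simp
    moreover have "A + B > 0" using AB by simp
    ultimately have "kern n 0 \<le> A - B" by (rule mult_right_le_imp_le)
    then show ?thesis unfolding A_def B_def .
  qed
  finally show ?thesis .
qed

text \<open>The jump of the derivative of \<open>max y 0\<close> at \<open>0\<close> is compensated by that of \<open>kern 0\<close>.\<close>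

lemma max_plus_kern_deriv:
  fixes y :: real
  shows "((\<lambda>y. max y 0 + kern 0 y) has_real_derivative 1 / 2 + sgn y * (1 - exp (- \<bar>y\<bar>)) / 2) (at y)"
    and "((\<lambda>y. 1 / 2 + sgn y * (1 - exp (- \<bar>y\<bar>)) / 2) has_real_derivative kern 0 y) (at y)"
proof -
  define k where "k = (\<lambda>s::real. (s + exp (- s)) / 2)"
  define k' where "k' = (\<lambda>s::real. (1 - exp (- s)) / 2)"
  have "(k has_real_derivative k' s) (at s)" for s
    unfolding k_def k'_def by (auto intro!: derivative_eq_intros)
  from DERIV_even_abs[of k k', OF this, of y]
  have "((\<lambda>y. y / 2 + k \<bar>y\<bar>) has_real_derivative 1 / 2 + sgn y * k' \<bar>y\<bar>) (at y)"
    by (intro DERIV_add) (auto intro!: derivative_eq_intros simp: k'_def)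
  moreover have "(\<lambda>y. y / 2 + k \<bar>y\<bar>) = (\<lambda>y. max y 0 + kern 0 y)"
    by (auto simp: k_def max_def add_divide_distrib)
  ultimately show "((\<lambda>y. max y 0 + kern 0 y) has_real_derivative 1 / 2 + sgn y * (1 - exp (- \<bar>y\<bar>)) / 2) (at y)"
    by (simp add: k'_def)
  have "(k' has_real_derivative exp (- s) / 2) (at s)" for s
    unfolding k'_def by (auto intro!: derivative_eq_intros)
  from DERIV_odd_abs[of k', OF this, of y]
  have "((\<lambda>y. sgn y * k' \<bar>y\<bar>) has_real_derivative kern 0 y) (at y)" by (simp add: k'_def)
  from DERIV_add[OF DERIV_const this, of "1 / 2"]
  show "((\<lambda>y. 1 / 2 + sgn y * (1 - exp (- \<bar>y\<bar>)) / 2) has_real_derivative kern 0 y) (at y)"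
    by (simp add: k'_def)
qed

section \<open>Comparison for the discrete scheme\<close>

lemma second_derivative_at_local_max:
  fixes f f' :: "real \<Rightarrow> real"
  assumes max: "\<forall>\<^sub>F y in nhds x. f y \<le> f x" and f: "\<forall>\<^sub>F y in nhds x. (f has_real_derivative f' y) (at y)"
    and d: "(f' has_real_derivative d) (at x)"
  shows "d \<le> 0"
proof (rule ccontr)
  assume "\<not> d \<le> 0"
  have "\<forall>\<^sub>F y in nhds x. f y \<le> f x \<and> (f has_real_derivative f' y) (at y)"
    using max f by (rule eventually_conj)
  then obtain e1 where e1: "e1 > 0" "\<And>y. dist y x < e1 \<Longrightarrow> f y \<le> f x"
    "\<And>y. dist y x < e1 \<Longrightarrow> (f has_real_derivative f' y) (at y)"
    unfolding eventually_nhds_metric by blast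
  have z: "f' x = 0"
    by (rule DERIV_local_max[of f _ x e1]) (use e1 in \<open>auto simp: dist_real_def abs_minus_commute\<close>)
  have "d > 0" using \<open>\<not> d \<le> 0\<close> by simp
  from DERIV_pos_inc_right[OF d this] obtain e2 where e2: "e2 > 0" "\<And>h. h > 0 \<Longrightarrow> h < e2 \<Longrightarrow> f' x < f' (x + h)" by blast
  define e where "e = min e1 e2 / 2"
  have e: "e > 0" "e < e1" "e < e2" using e1(1) e2(1) by (auto simp: e_def)
  have "f x < f (x + e)"
  proof (rule DERIV_pos_imp_increasing_open[of x "x + e"])
    show "x < x + e" using e by simp
    fix y assume y: "x < y" "y < x + e"
    then have "(f has_real_derivative f' y) (at y)" by (intro e1(3)) (use e in \<open>auto simp: dist_real_def\<close>)
    moreover have "f' y > 0" using e2(2)[of "y - x"] y e z by simp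
    ultimately show "\<exists>z. (f has_real_derivative z) (at y) \<and> 0 < z" by blast
  next
    show "continuous_on {x..x + e} f"
    proof (intro continuous_at_imp_continuous_on ballI DERIV_isCont)
      fix y assume "y \<in> {x..x + e}"
      then show "(f has_real_derivative f' y) (at y)" by (intro e1(3)) (use e in \<open>auto simp: dist_real_def\<close>)
    qed
  qed
  moreover have "f (x + e) \<le> f x" by (rule e1(2)) (use e in \<open>simp add: dist_real_def\<close>)
  ultimately show False by simp
qed

lemma interior_maximum:
  fixes f :: "real \<Rightarrow> real"
  assumes "continuous_on Omega_bar f" "f (-1) \<le> c" "f 1 \<le> c" "x \<in> Omega_bar" "f x > c"
  obtains z where "z \<in> Omega" "f z > c" "\<And>y. y \<in> Omega_bar \<Longrightarrow> f y \<le> f z"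
proof -
  have "Omega_bar \<noteq> {}" by simp
  from continuous_attains_sup[OF compact_Icc this assms(1)]
  obtain z where z: "z \<in> Omega_bar" "\<And>y. y \<in> Omega_bar \<Longrightarrow> f y \<le> f z" by blast
  have "f z > c" using z(2)[OF assms(4)] assms(5) by simp
  moreover have "z \<noteq> -1" "z \<noteq> 1" using \<open>f z > c\<close> assms(2,3) by auto
  then have "z \<in> Omega" using z(1) by auto
  ultimately show ?thesis using that z(2) by blast
qed

lemma eventually_Omega: "x \<in> Omega \<Longrightarrow> \<forall>\<^sub>F y in nhds x. y \<in> Omega"
  by (rule eventually_nhds_in_open) simp_all

lemma Omega_subset_Omega_bar: "x \<in> Omega \<Longrightarrow> x \<in> Omega_bar"
  by simp

text \<open>Semiconcavity is stated by supporting lines of \<phi> - max y 0 - C y^2/2: apart from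
  curvature bounded above by \<open>C\<close>, the convex part of the obstacle is a unit jump of
  slope at 0.\<close>

locale obstacle_scheme =
  fixes b h C M :: real and \<phi> :: "real \<Rightarrow> real" and U :: "nat \<Rightarrow> real \<Rightarrow> real" and N :: nat
  assumes b_pos: "b > 0" and h_pos: "h > 0" and C_nonneg: "C \<ge> 0"
    and cont_obstacle: "continuous_on Omega_bar \<phi>"
    and obstacle_nonneg: "\<And>x. x \<in> Omega_bar \<Longrightarrow> 0 \<le> \<phi> x"
    and obstacle_le: "\<And>x. x \<in> Omega_bar \<Longrightarrow> \<phi> x \<le> M"
    and semiconcave: "\<And>x. x \<in> Omega \<Longrightarrow> \<exists>m. \<forall>y\<in>Omega_bar.
        \<phi> y - max y 0 - C * y\<^sup>2 / 2 \<le> \<phi> x - max x 0 - C * x\<^sup>2 / 2 + m * (y - x)"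
    and U_0: "U 0 = \<phi>"
    and step: "\<And>m. m < N \<Longrightarrow> obstacle_step b h \<phi> (U m) (U (Suc m))"
begin

lemma M_nonneg: "M \<ge> 0"
  using obstacle_nonneg[of 0] obstacle_le[of 0] by simp

lemma U_cont: "m \<le> N \<Longrightarrow> continuous_on Omega_bar (U m)"
  using step[of "m - 1"] U_0 cont_obstacle by (cases m) (auto simp: obstacle_step_def)

lemma U_ge: "m \<le> N \<Longrightarrow> x \<in> Omega_bar \<Longrightarrow> \<phi> x \<le> U m x"
  using step[of "m - 1"] U_0 by (cases m) (auto simp: obstacle_step_def)

lemma U_boundary: "m \<le> N \<Longrightarrow> U m (-1) = \<phi> (-1)" "m \<le> N \<Longrightarrow> U m 1 = \<phi> 1"
  using step[of "m - 1"] U_0 by (cases m; auto simp: obstacle_step_def)+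

definition rhs :: "nat \<Rightarrow> real \<Rightarrow> real" where
  "rhs m y = b * U (Suc m) y + (U (Suc m) y - U m y) / h"

lemma rhs_cont: "m < N \<Longrightarrow> continuous_on Omega_bar (rhs m)"
  unfolding rhs_def using h_pos by (intro continuous_intros U_cont) auto

lemma touching:
  assumes "m < N" "x \<in> Omega"
  obtains \<Psi> \<Psi>' where "\<And>y. y \<in> Omega \<Longrightarrow> (\<Psi> has_real_derivative \<Psi>' y) (at y)"
    "\<And>y. y \<in> Omega \<Longrightarrow> (\<Psi>' has_real_derivative rhs m y) (at y)"
    "\<Psi> x = U (Suc m) x" "\<And>y. y \<in> Omega \<Longrightarrow> U (Suc m) y \<le> \<Psi> y"
    "\<phi> x < U (Suc m) x \<Longrightarrow> \<forall>\<^sub>F y in nhds x. \<Psi> y = U (Suc m) y"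
proof -
  have "\<forall>x\<in>Omega. \<exists>\<Psi> \<Psi>'. (\<forall>y\<in>Omega. (\<Psi> has_real_derivative \<Psi>' y) (at y) \<and>
        (\<Psi>' has_real_derivative rhs m y) (at y)) \<and>
        \<Psi> x = U (Suc m) x \<and> (\<forall>y\<in>Omega. U (Suc m) y \<le> \<Psi> y) \<and>
        (\<phi> x < U (Suc m) x \<longrightarrow> (\<forall>\<^sub>F y in nhds x. \<Psi> y = U (Suc m) y))"
    using step[OF assms(1)] unfolding obstacle_step_def rhs_def by (elim conjE)
  from bspec[OF this assms(2)] show ?thesis
  proof (elim exE conjE, goal_cases)
    case (1 \<Psi> \<Psi>')
    show ?thesis by (rule that[of \<Psi> \<Psi>']) (use 1 in \<open>simp_all del: greaterThanLessThan_iff\<close>)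
  qed
qed

text \<open>Off the contact set the touching function coincides with the iterate near
  \<open>x\<close>, so it minus \<open>P\<close> has a genuine local maximum and the second
  derivative test applies, although the iterate itself need not be twice differentiable
  elsewhere.\<close>

lemma subsolution_at_max:
  assumes m: "m < N" and x: "x \<in> Omega" and gt: "\<phi> x < U (Suc m) x"
    and P: "\<And>y. y \<in> Omega \<Longrightarrow> (P has_real_derivative P' y) (at y)" and P': "(P' has_real_derivative d) (at x)"
    and max: "\<And>y. y \<in> Omega \<Longrightarrow> U (Suc m) y - P y \<le> U (Suc m) x - P x"
  shows "rhs m x \<le> d"
proof -
  obtain \<Psi> \<Psi>' where \<Psi>: "\<And>y. y \<in> Omega \<Longrightarrow> (\<Psi> has_real_derivative \<Psi>' y) (at y)"
    "\<And>y. y \<in> Omega \<Longrightarrow> (\<Psi>' has_real_derivative rhs m y) (at y)"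
    "\<Psi> x = U (Suc m) x" "\<And>y. y \<in> Omega \<Longrightarrow> U (Suc m) y \<le> \<Psi> y"
    "\<phi> x < U (Suc m) x \<Longrightarrow> \<forall>\<^sub>F y in nhds x. \<Psi> y = U (Suc m) y"
  proof (rule touching[OF m x], goal_cases)
    case (1 \<Psi> \<Psi>')
    show thesis by (rule 1(1)[of \<Psi> \<Psi>']) (fact 1)+
  qed
  have "rhs m x - d \<le> 0"
  proof (rule second_derivative_at_local_max[of "\<lambda>y. \<Psi> y - P y" x "\<lambda>y. \<Psi>' y - P' y"])
    show "\<forall>\<^sub>F y in nhds x. \<Psi> y - P y \<le> \<Psi> x - P x"
      using \<Psi>(5)[OF gt] eventually_Omega[OF x]
    proof eventually_elim
      case (elim y)
      then show ?case using max[of y] \<Psi>(3) by simp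
    qed
    show "\<forall>\<^sub>F y in nhds x. ((\<lambda>y. \<Psi> y - P y) has_real_derivative \<Psi>' y - P' y) (at y)"
      using eventually_Omega[OF x] by eventually_elim (intro DERIV_diff \<Psi>(1) P)
    show "((\<lambda>y. \<Psi>' y - P' y) has_real_derivative rhs m x - d) (at x)"
      by (intro DERIV_diff \<Psi>(2) P' x)
  qed
  then show ?thesis by simp
qed

lemma U_le: "m \<le> N \<Longrightarrow> x \<in> Omega_bar \<Longrightarrow> U m x \<le> M"
proof (induction m arbitrary: x)
  case 0 then show ?case using U_0 obstacle_le by simp
next
  case (Suc m)
  show ?case
  proof (rule ccontr)
    assume "\<not> U (Suc m) x \<le> M"
    then have "U (Suc m) x > M" by simp
    moreover have "U (Suc m) (-1) \<le> M" "U (Suc m) 1 \<le> M"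
      using U_boundary[OF Suc.prems(1)] obstacle_le by simp_all
    ultimately obtain z where z: "z \<in> Omega" "U (Suc m) z > M" "\<And>y. y \<in> Omega_bar \<Longrightarrow> U (Suc m) y \<le> U (Suc m) z"
      using interior_maximum[OF U_cont[OF Suc.prems(1)] _ _ Suc.prems(2)] by metis
    note zb = Omega_subset_Omega_bar[OF z(1)]
    have "rhs m z \<le> 0"
    proof (rule subsolution_at_max[of m z "\<lambda>_. 0" "\<lambda>_. 0"])
      show "m < N" using Suc.prems by simp
      show "\<phi> z < U (Suc m) z" using obstacle_le[OF zb] z(2) by simp
      show "U (Suc m) y - 0 \<le> U (Suc m) z - 0" if "y \<in> Omega" for y
        using z(3)[OF Omega_subset_Omega_bar[OF that]] by simp
    qed (use z in auto)
    moreover have "b * U (Suc m) z > 0" using b_pos z(2) M_nonneg by simp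
    moreover have "U m z \<le> M" using Suc.IH[OF _ zb] Suc.prems by simp
    then have "(U (Suc m) z - U m z) / h \<ge> 0" using z(2) h_pos by simp
    ultimately show False by (simp add: rhs_def)
  qed
qed

text \<open>The function (1 - h D^2)^(-(m+1)) applied to h times the point mass at 0; that mass is
  what the unit jump of slope contributes during one time step.\<close>

definition K :: "nat \<Rightarrow> real \<Rightarrow> real" where
  "K m x = sqrt h * kern m (x / sqrt h)"

lemma K_nonneg: "K m x \<ge> 0"
  unfolding K_def using kern_nonneg h_pos by simp

lemma K_cont: "continuous_on S (K m)"
proof -
  have "continuous_on UNIV (kern m)"
  proof (cases m)
    case 0
    then have "kern m = (\<lambda>y. exp (- \<bar>y\<bar>) / 2)" by auto
    then show ?thesis by (auto intro!: continuous_intros)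
  next
    case (Suc n)
    then show ?thesis
      using DERIV_isCont[OF kern_deriv[of n]] by (intro continuous_at_imp_continuous_on) simp
  qed
  then show ?thesis unfolding K_def
    using continuous_on_compose2[of UNIV "kern m" S "\<lambda>x. x / sqrt h"] h_pos
    by (intro continuous_on_mult continuous_on_const) (simp add: continuous_on_divide continuous_on_id)
qed

lemma scaled_deriv:
  assumes "\<And>y. (f has_real_derivative f' y) (at y)"
  shows "((\<lambda>x. f (x / sqrt h)) has_real_derivative f' (x / sqrt h) / sqrt h) (at x)"
proof -
  have "((\<lambda>x. x / sqrt h) has_real_derivative 1 / sqrt h) (at x)"
    using DERIV_cdivide[OF DERIV_ident, of "sqrt h"] by simp
  from DERIV_chain'[OF this assms] show ?thesis by simp
qed

text \<open>The kink prevents smooth functions from touching \<phi> from above at 0, but the corner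
  of \<open>K 0\<close> is opposite: \<open>P\<close>, the sum of max y 0, \<open>K 0\<close>, a
  parabola and a line, is twice differentiable and touches \<phi> + \<open>K 0\<close> from above.
  Multiplied by h, its second derivative is \<open>K 0\<close> + C h, exactly the bound.\<close>

lemma first_increment_le:
  assumes N: "0 < N" and x: "x \<in> Omega_bar"
  shows "U 1 x - U 0 x \<le> K 0 x + C * h"
proof (rule ccontr)
  assume "\<not> U 1 x - U 0 x \<le> K 0 x + C * h"
  then have gt: "U (Suc 0) x - \<phi> x - K 0 x > C * h" by (simp add: U_0)
  have Ch: "C * h \<ge> 0" using C_nonneg h_pos by simp
  have "continuous_on Omega_bar (\<lambda>x. U (Suc 0) x - \<phi> x - K 0 x)"
    using N by (intro continuous_on_diff U_cont K_cont cont_obstacle) simp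
  moreover have "U (Suc 0) (-1) - \<phi> (-1) - K 0 (-1) \<le> C * h" "U (Suc 0) 1 - \<phi> 1 - K 0 1 \<le> C * h"
    using U_boundary[of "Suc 0"] N K_nonneg[of 0 1] K_nonneg[of 0 "-1"] Ch by simp_all
  ultimately obtain z where z: "z \<in> Omega" "U (Suc 0) z - \<phi> z - K 0 z > C * h"
    "\<And>y. y \<in> Omega_bar \<Longrightarrow> U (Suc 0) y - \<phi> y - K 0 y \<le> U (Suc 0) z - \<phi> z - K 0 z"
  proof (rule interior_maximum[where f="\<lambda>x. U (Suc 0) x - \<phi> x - K 0 x" and c="C * h" and x=x, OF _ _ _ x gt], goal_cases)
    case (1 z)
    show thesis by (rule 1(1)[of z]) (fact 1)+
  qed
  note zb = Omega_subset_Omega_bar[OF z(1)]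
  obtain m where m: "\<And>y. y \<in> Omega_bar \<Longrightarrow>
        \<phi> y - max y 0 - C * y\<^sup>2 / 2 \<le> \<phi> z - max z 0 - C * z\<^sup>2 / 2 + m * (y - z)"
    using semiconcave[OF z(1)] by blast
  define s where "s = (\<lambda>y::real. max y 0 + kern 0 y)"
  define s' where "s' = (\<lambda>y::real. 1 / 2 + sgn y * (1 - exp (- \<bar>y\<bar>)) / 2)"
  define P where "P = (\<lambda>y. sqrt h * s (y / sqrt h) + (C * y\<^sup>2 / 2 + (\<phi> z - max z 0 - C * z\<^sup>2 / 2 + m * (y - z))))"
  define P' where "P' = (\<lambda>y. s' (y / sqrt h) + (C * y + m))"
  have sh: "sqrt h > 0" using h_pos by simp
  have S: "sqrt h * s (y / sqrt h) = max y 0 + K 0 y" for y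
  proof -
    have "sqrt h * max (y / sqrt h) 0 = max y 0" using sh by (auto simp: max_def field_simps)
    then show ?thesis by (simp add: s_def K_def distrib_left)
  qed
  have "(s has_real_derivative s' y) (at y)" for y unfolding s_def s'_def by (rule max_plus_kern_deriv)
  from DERIV_cmult[OF scaled_deriv[OF this], of "sqrt h"]
  have dS: "((\<lambda>y. sqrt h * s (y / sqrt h)) has_real_derivative s' (y / sqrt h)) (at y)" for y
    using sh by simp
  have dP: "(P has_real_derivative P' y) (at y)" for y
    unfolding P_def P'_def by (rule DERIV_add[OF dS]) (auto intro!: derivative_eq_intros)
  have "(s' has_real_derivative kern 0 y) (at y)" for y unfolding s'_def by (rule max_plus_kern_deriv)
  from scaled_deriv[OF this]
  have dS': "((\<lambda>y. s' (y / sqrt h)) has_real_derivative kern 0 (z / sqrt h) / sqrt h) (at z)" .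
  have dP': "(P' has_real_derivative kern 0 (z / sqrt h) / sqrt h + C) (at z)"
    unfolding P'_def by (rule DERIV_add[OF dS']) (auto intro!: derivative_eq_intros)
  have Ple: "\<phi> y + K 0 y \<le> P y" if "y \<in> Omega_bar" for y
    using m[OF that] S[of y] unfolding P_def by linarith
  have Pz: "P z = \<phi> z + K 0 z" using S[of z] unfolding P_def by simp
  have "rhs 0 z \<le> kern 0 (z / sqrt h) / sqrt h + C"
  proof (rule subsolution_at_max[OF N z(1) _ dP dP'])
    show "\<phi> z < U (Suc 0) z" using z(2) K_nonneg[of 0 z] Ch by linarith
    show "U (Suc 0) y - P y \<le> U (Suc 0) z - P z" if "y \<in> Omega" for y
      using z(3)[OF Omega_subset_Omega_bar[OF that]] Ple[OF Omega_subset_Omega_bar[OF that]] Pz by linarith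
  qed
  then have "h * rhs 0 z \<le> h * (kern 0 (z / sqrt h) / sqrt h + C)" using h_pos by (intro mult_left_mono) auto
  moreover have "h * (kern 0 (z / sqrt h) / sqrt h + C) = K 0 z + C * h"
  proof -
    have "h / sqrt h = sqrt h" using h_pos by (simp add: real_div_sqrt)
    moreover have "h * (k / sqrt h) = h / sqrt h * k" for k by simp
      ultimately have e: "h * (k / sqrt h) = sqrt h * k" for k by (simp only:)
    show ?thesis unfolding distrib_left e K_def mult.commute[of h C] ..
  qed
  moreover have "h * rhs 0 z = h * b * U (Suc 0) z + (U (Suc 0) z - \<phi> z)"
    using h_pos by (simp add: rhs_def U_0 distrib_left)
  moreover have "U (Suc 0) z \<ge> 0" using U_ge[OF _ zb, of "Suc 0"] obstacle_nonneg[OF zb] N by simp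
  then have "h * b * U (Suc 0) z \<ge> 0" using h_pos b_pos by simp
  ultimately show False using z(2) by linarith
qed

text \<open>At a positive maximum of the excess the newer iterate is off the contact set. The older
  one may be in contact, but being touched from above everywhere is enough. Subtracting the two
  equations, with (1 - h D^2) \<open>K (Suc m)\<close> = \<open>K m\<close>, bounds the excess by
  the previous one; the term with \<open>b\<close> has the favourable sign.\<close>

lemma increment_le:
  "m < N \<Longrightarrow> x \<in> Omega_bar \<Longrightarrow> U (Suc m) x - U m x \<le> K m x + C * h"
proof (induction m arbitrary: x)
  case 0
  then show ?case using first_increment_le by simp
next
  case (Suc m)
  note x = Suc.prems(2) and N = Suc.prems(1)
  have mN: "m < N" using N by simp
  show ?case
  proof (rule ccontr)
    assume "\<not> U (Suc (Suc m)) x - U (Suc m) x \<le> K (Suc m) x + C * h"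
    then have gt: "U (Suc (Suc m)) x - U (Suc m) x - K (Suc m) x > C * h" by simp
    have Ch: "C * h \<ge> 0" using C_nonneg h_pos by simp
    have "continuous_on Omega_bar (\<lambda>x. U (Suc (Suc m)) x - U (Suc m) x - K (Suc m) x)"
      using N by (intro continuous_on_diff U_cont K_cont) simp_all
    moreover have "U (Suc (Suc m)) (-1) - U (Suc m) (-1) - K (Suc m) (-1) \<le> C * h"
      "U (Suc (Suc m)) 1 - U (Suc m) 1 - K (Suc m) 1 \<le> C * h"
      using U_boundary[of "Suc m"] U_boundary[of "Suc (Suc m)"] N K_nonneg[of "Suc m" 1] K_nonneg[of "Suc m" "-1"] Ch by linarith+
    ultimately obtain z where z: "z \<in> Omega" "U (Suc (Suc m)) z - U (Suc m) z - K (Suc m) z > C * h"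
      "\<And>y. y \<in> Omega_bar \<Longrightarrow> U (Suc (Suc m)) y - U (Suc m) y - K (Suc m) y \<le> U (Suc (Suc m)) z - U (Suc m) z - K (Suc m) z"
    proof (rule interior_maximum[where f="\<lambda>x. U (Suc (Suc m)) x - U (Suc m) x - K (Suc m) x" and c="C * h" and x=x, OF _ _ _ x gt], goal_cases)
      case (1 z)
      show thesis by (rule 1(1)[of z]) (fact 1)+
    qed
    note zb = Omega_subset_Omega_bar[OF z(1)]
    obtain \<Psi> \<Psi>' where \<Psi>: "\<And>y. y \<in> Omega \<Longrightarrow> (\<Psi> has_real_derivative \<Psi>' y) (at y)"
      "\<And>y. y \<in> Omega \<Longrightarrow> (\<Psi>' has_real_derivative rhs m y) (at y)"
      "\<Psi> z = U (Suc m) z" "\<And>y. y \<in> Omega \<Longrightarrow> U (Suc m) y \<le> \<Psi> y"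
    proof (rule touching[OF mN z(1)], goal_cases)
      case (1 \<Psi> \<Psi>')
      show thesis by (rule 1(1)[of \<Psi> \<Psi>']) (fact 1)+
    qed
    have sh: "sqrt h > 0" using h_pos by simp
    define k' where "k' = (\<lambda>y. - (y / (2 * (real m + 1))) * kern m y)"
    have "(kern (Suc m) has_real_derivative k' y) (at y)" for y unfolding k'_def by (rule kern_deriv)
    from DERIV_cmult[OF scaled_deriv[OF this], of "sqrt h"]
    have dK: "(K (Suc m) has_real_derivative k' (y / sqrt h)) (at y)" for y
      using sh unfolding K_def by simp
    have "(k' has_real_derivative kern (Suc m) y - kern m y) (at y)" for y unfolding k'_def by (rule kern_deriv2)
    from scaled_deriv[OF this]
    have dK': "((\<lambda>y. k' (y / sqrt h)) has_real_derivative (kern (Suc m) (z / sqrt h) - kern m (z / sqrt h)) / sqrt h) (at z)" .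
    have "rhs (Suc m) z \<le> rhs m z + (kern (Suc m) (z / sqrt h) - kern m (z / sqrt h)) / sqrt h"
    proof (rule subsolution_at_max[OF N z(1) _ DERIV_add[OF \<Psi>(1) dK] DERIV_add[OF \<Psi>(2)[OF z(1)] dK']])
      show "\<phi> z < U (Suc (Suc m)) z"
        using z(2) K_nonneg[of "Suc m" z] Ch U_ge[OF _ zb, of "Suc m"] N by simp
      show "U (Suc (Suc m)) y - (\<Psi> y + K (Suc m) y) \<le> U (Suc (Suc m)) z - (\<Psi> z + K (Suc m) z)" if "y \<in> Omega" for y
        using z(3)[OF Omega_subset_Omega_bar[OF that]] \<Psi>(3) \<Psi>(4)[OF that] by linarith
    qed
    then have "h * rhs (Suc m) z \<le> h * (rhs m z + (kern (Suc m) (z / sqrt h) - kern m (z / sqrt h)) / sqrt h)"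
      using h_pos by (intro mult_left_mono) auto
    moreover have "h * (rhs m z + (kern (Suc m) (z / sqrt h) - kern m (z / sqrt h)) / sqrt h) = h * rhs m z + (K (Suc m) z - K m z)"
    proof -
      have "h / sqrt h = sqrt h" using h_pos by (simp add: real_div_sqrt)
      moreover have "h * (k / sqrt h) = h / sqrt h * k" for k by simp
      ultimately have e: "h * (k / sqrt h) = sqrt h * k" for k by (simp only:)
      show ?thesis unfolding distrib_left e K_def right_diff_distrib ..
    qed
    moreover have r: "h * rhs n z = h * b * U (Suc n) z + (U (Suc n) z - U n z)" for n
      using h_pos by (simp add: rhs_def distrib_left)
    moreover have "U (Suc m) z - U m z \<le> K m z + C * h" by (rule Suc.IH[OF mN zb])
    moreover have "h * b * U (Suc (Suc m)) z \<ge> h * b * U (Suc m) z"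
      using z(2) K_nonneg[of "Suc m" z] Ch h_pos b_pos by (intro mult_left_mono) auto
    ultimately show False using z(2) r[of "Suc m"] r[of m] by linarith
  qed
qed

text \<open>The bound of \<open>kern_le\<close> telescopes when the increments are summed.\<close>

lemma growth_le:
  assumes "m \<le> n" "n \<le> N" "x \<in> Omega_bar"
  shows "U n x - U m x \<le> sqrt h * (sqrt (real n) - sqrt (real m)) + C * h * (real n - real m)"
  using assms
proof (induction n rule: dec_induct)
  case base then show ?case by simp
next
  case (step n)
  have "K n x \<le> sqrt h * (sqrt (real n + 1) - sqrt (real n))"
    unfolding K_def using kern_le h_pos by (intro mult_left_mono) auto
  moreover have "U (Suc n) x - U n x \<le> K n x + C * h" using step by (intro increment_le) auto
  moreover have "U n x - U m x \<le> sqrt h * (sqrt (real n) - sqrt (real m)) + C * h * (real n - real m)"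
    using step by simp
  ultimately show ?case by (simp add: algebra_simps)
qed

end

section \<open>Comparison of the scheme with the viscosity solution\<close>

text \<open>The penalty in time is the square of a positive part so that it has the continuous time
  derivative required of test functions.\<close>

lemma DERIV_square_positive_part:
  "((\<lambda>t::real. (max (t - s) 0)\<^sup>2) has_real_derivative 2 * max (t - s) 0) (at t)"
proof -
  have "((\<lambda>y::real. y\<^sup>2) has_real_derivative 2 * y) (at y)" for y
    by (auto intro!: derivative_eq_intros)
  from DERIV_odd_abs[of "\<lambda>y. y\<^sup>2", OF this]
  have odd: "((\<lambda>y::real. sgn y * \<bar>y\<bar>\<^sup>2) has_real_derivative 2 * \<bar>y\<bar>) (at y)" for y by simp
  have "((\<lambda>y::real. y\<^sup>2 / 2 + sgn y * \<bar>y\<bar>\<^sup>2 / 2) has_real_derivative y + 2 * \<bar>y\<bar> / 2) (at y)" for y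
    by (intro DERIV_add DERIV_cdivide odd) (auto intro!: derivative_eq_intros)
  moreover have "(\<lambda>y::real. y\<^sup>2 / 2 + sgn y * \<bar>y\<bar>\<^sup>2 / 2) = (\<lambda>y. (max y 0)\<^sup>2)"
    by (auto simp: max_def sgn_if)
  moreover have "y + 2 * \<bar>y\<bar> / 2 = 2 * max y 0" for y :: real by (simp add: max_def)
  ultimately have sq: "((\<lambda>y::real. (max y 0)\<^sup>2) has_real_derivative 2 * max y 0) (at y)" for y by simp
  have "((\<lambda>t. t - s) has_real_derivative 1) (at t)"
    using DERIV_diff[OF DERIV_ident DERIV_const] by simp
  from DERIV_chain'[OF this sq] show ?thesis by simp
qed

text \<open>The penalty keeps the maximum away from the final time \<open>T\<close>, up to which \<open>f\<close> need not be
  bounded.\<close>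

lemma penalized_maximum:
  fixes f :: "real \<times> real \<Rightarrow> real"
  assumes c: "continuous_on ({0..<T} \<times> Omega_bar) f"
    and i: "\<And>x. x \<in> Omega_bar \<Longrightarrow> f (0, x) \<le> 0"
    and l: "\<And>t. t \<in> {0..<T} \<Longrightarrow> f (t, -1) \<le> 0" and r: "\<And>t. t \<in> {0..<T} \<Longrightarrow> f (t, 1) \<le> 0"
    and t1: "t1 \<in> {0..<T}" and x1: "x1 \<in> Omega_bar" and pos: "f (t1, x1) > 0"
  shows "\<exists>A s t0 x0. A \<ge> 0 \<and> t0 \<in> {0<..<T} \<and> x0 \<in> Omega \<and> f (t0, x0) > 0 \<and>
    (\<forall>\<^sub>F z in nhds (t0, x0). f z - A * (max (fst z - s) 0)\<^sup>2 \<le> f (t0, x0) - A * (max (t0 - s) 0)\<^sup>2)"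
proof -
  define T1 where "T1 = (t1 + T) / 2"
  have T1: "t1 < T1" "T1 < T" "0 \<le> t1" using t1 by (auto simp: T1_def)
  let ?R = "{0..T1} \<times> Omega_bar"
  have cR: "compact ?R" by (intro compact_Times compact_Icc)
  have neR: "?R \<noteq> {}" using T1 by auto
  have sub: "?R \<subseteq> {0..<T} \<times> Omega_bar" using T1 by auto
  have cf: "continuous_on ?R f" using c sub by (rule continuous_on_subset)
  have p1: "(t1, x1) \<in> ?R" using T1 x1 by simp
  obtain m where m: "m \<in> ?R" "\<And>z. z \<in> ?R \<Longrightarrow> f z \<le> f m"
    using continuous_attains_sup[OF cR neR cf] by blast
  have fm: "f m > 0" using m(2)[OF p1] pos by simp
  \<comment> \<open>This makes the penalized function nonpositive at time \<open>T1\<close>, while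
    the penalty vanishes up to \<open>t1\<close>, where a positive value is attained. The maximum is
    therefore positive and at a time before \<open>T1\<close>.\<close>
  define A where "A = f m / (T1 - t1)\<^sup>2"
  have A: "A \<ge> 0" using fm by (simp add: A_def)
  have AT: "A * (T1 - t1)\<^sup>2 = f m" using T1 by (simp add: A_def)
  define g where "g = (\<lambda>z. f z - A * (max (fst z - t1) 0)\<^sup>2)"
  have cg: "continuous_on ?R g" unfolding g_def by (intro continuous_intros cf)
  obtain z where z: "z \<in> ?R" "\<And>y. y \<in> ?R \<Longrightarrow> g y \<le> g z"
    using continuous_attains_sup[OF cR neR cg] by blast
  obtain t0 x0 where zz: "z = (t0, x0)" by (cases z)
  have "g (t1, x1) = f (t1, x1)" by (simp add: g_def)
  then have gz: "g z > 0" using z(2)[OF p1] pos by simp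
  have "g z \<le> f z" using A by (simp add: g_def)
  then have fz: "f (t0, x0) > 0" using gz zz by simp
  have "t0 \<noteq> T1"
  proof
    assume "t0 = T1"
    then have "g z = f z - f m" using T1 AT by (simp add: g_def zz max_def)
    then show False using m(2)[OF z(1)] gz by simp
  qed
  moreover have "t0 \<noteq> 0" using i[of x0] fz z(1) zz by auto
  moreover have "x0 \<noteq> -1" using l[of t0] fz z(1) zz T1 by auto
  moreover have "x0 \<noteq> 1" using r[of t0] fz z(1) zz T1 by auto
  ultimately have in0: "(t0, x0) \<in> {0<..<T1} \<times> Omega" using z(1) zz by auto
  have "open ({0<..<T1} \<times> Omega)" by (intro open_Times open_greaterThanLessThan)
  from eventually_nhds_in_open[OF this in0]
  have "\<forall>\<^sub>F y in nhds (t0, x0). g y \<le> g z"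
  proof eventually_elim
    case (elim y)
    then show ?case by (intro z(2)) auto
  qed
  then show ?thesis using A in0 T1 fz by (intro exI[of _ A] exI[of _ t1] exI[of _ t0] exI[of _ x0]) (auto simp: g_def zz)
qed

text \<open>Applied to a touching function of an iterate, whose second derivative
  \<open>rhs m\<close> is continuous: added to a C^1 function of time it is a legitimate test
  function for u.\<close>

lemma C12_separated:
  assumes P: "\<And>x. x \<in> Omega \<Longrightarrow> (\<Psi> has_real_derivative \<Psi>' x) (at x)"
    and P': "\<And>x. x \<in> Omega \<Longrightarrow> (\<Psi>' has_real_derivative G x) (at x)" and G: "continuous_on Omega G"
    and e: "\<And>t. (e has_real_derivative e' t) (at t)" and e': "continuous_on UNIV e'"
  shows "C12_with_derivs ({0<..<T} \<times> Omega) (\<lambda>z. \<Psi> (snd z) + e (fst z)) (\<lambda>z. e' (fst z))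
     (\<lambda>z. \<Psi>' (snd z)) (\<lambda>z. G (snd z))"
proof -
  have s: "continuous_on ({0<..<T} \<times> Omega) (\<lambda>z. f (snd z))" if "continuous_on Omega f" for f :: "real \<Rightarrow> real"
    by (rule continuous_on_compose2[OF that continuous_on_snd[OF continuous_on_id]]) auto
  have t: "continuous_on ({0<..<T} \<times> Omega) (\<lambda>z. f (fst z))" if "continuous_on UNIV f" for f :: "real \<Rightarrow> real"
    by (rule continuous_on_compose2[OF that continuous_on_fst[OF continuous_on_id]]) auto
  have c1: "continuous_on Omega \<Psi>" using P DERIV_isCont by (intro continuous_at_imp_continuous_on) blast
  have c2: "continuous_on Omega \<Psi>'" using P' DERIV_isCont by (intro continuous_at_imp_continuous_on) blast
  have c3: "continuous_on UNIV e" using e DERIV_isCont by (intro continuous_at_imp_continuous_on) blast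
  have "((\<lambda>s. \<Psi> x + e s) has_real_derivative e' t) (at t)" for t x
    using DERIV_add[OF DERIV_const e] by simp
  moreover have "((\<lambda>y. \<Psi> y + e t) has_real_derivative \<Psi>' x) (at x)" if "x \<in> Omega" for t x
    using DERIV_add[OF P[OF that] DERIV_const] by simp
  ultimately show ?thesis unfolding C12_with_derivs_def
    using s[OF c1] s[OF c2] s[OF G] t[OF c3] t[OF e'] P'
    by (auto intro!: continuous_on_add)
qed

lemma viscosity_subsolutionD:
  assumes "viscosity_subsolution T b \<phi> u" "t0 \<in> {0<..<T}" "x0 \<in> Omega"
    and "C12_with_derivs ({0<..<T} \<times> Omega) \<psi> \<psi>t \<psi>x \<psi>xx"
    and "\<forall>\<^sub>F z in nhds (t0, x0). u z - \<psi> z \<le> u (t0, x0) - \<psi> (t0, x0)" "u (t0, x0) > \<phi> x0"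
  shows "\<psi>t (t0, x0) - \<psi>xx (t0, x0) + b * u (t0, x0) \<le> 0"
proof -
  have "(t0, x0) \<in> {0<..<T} \<times> Omega" using assms(2,3) by simp
  then have "min (\<psi>t (t0, x0) - \<psi>xx (t0, x0) + b * u (t0, x0)) (u (t0, x0) - \<phi> (snd (t0, x0))) \<le> 0"
    using assms(1,4,5) unfolding viscosity_subsolution_def Let_def by blast
  then show ?thesis using assms(6) by (simp add: min_le_iff_disj)
qed

lemma viscosity_supersolutionD:
  assumes "viscosity_supersolution T b \<phi> u" "t0 \<in> {0<..<T}" "x0 \<in> Omega"
    and "C12_with_derivs ({0<..<T} \<times> Omega) \<psi> \<psi>t \<psi>x \<psi>xx"
    and "\<forall>\<^sub>F z in nhds (t0, x0). u z - \<psi> z \<ge> u (t0, x0) - \<psi> (t0, x0)"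
  shows "\<psi>t (t0, x0) - \<psi>xx (t0, x0) + b * u (t0, x0) \<ge> 0"
proof -
  have "(t0, x0) \<in> {0<..<T} \<times> Omega" using assms(2,3) by simp
  then have "min (\<psi>t (t0, x0) - \<psi>xx (t0, x0) + b * u (t0, x0)) (u (t0, x0) - \<phi> (snd (t0, x0))) \<ge> 0"
    using assms(1,4,5) unfolding viscosity_supersolution_def Let_def by blast
  then show ?thesis by simp
qed

lemma eventually_nhds_snd:
  assumes "\<forall>\<^sub>F y in nhds x0. P y"
  shows "\<forall>\<^sub>F z in nhds (t0, x0). P (snd z)"
proof -
  have "filterlim snd (nhds x0) (nhds (t0, x0))"
    using tendsto_snd[OF filterlim_ident[of "nhds (t0, x0)"]] by simp
  with assms show ?thesis by (rule eventually_compose_filterlim)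
qed

locale obstacle_comparison = obstacle_scheme +
  fixes T :: real and u :: "real \<times> real \<Rightarrow> real"
  assumes u_cont: "continuous_on ({0..<T} \<times> Omega_bar) u"
    and u_sub: "viscosity_subsolution T b \<phi> u" and u_super: "viscosity_supersolution T b \<phi> u"
    and u_initial: "\<And>x. x \<in> Omega_bar \<Longrightarrow> u (0, x) = \<phi> x"
    and u_boundary: "\<And>t. t \<in> {0..<T} \<Longrightarrow> u (t, -1) = \<phi> (-1)" "\<And>t. t \<in> {0..<T} \<Longrightarrow> u (t, 1) = \<phi> 1"
    and u_ge: "\<And>t x. t \<in> {0..<T} \<Longrightarrow> x \<in> Omega_bar \<Longrightarrow> \<phi> x \<le> u (t, x)"
begin

lemma penalty_deriv:
  "((\<lambda>t. E * exp (a * t) + A * (max (t - s) 0)\<^sup>2) has_real_derivative E * (a * exp (a * t)) + A * (2 * max (t - s) 0)) (at t)"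
  by (intro DERIV_add DERIV_cmult DERIV_square_positive_part) (auto intro!: derivative_eq_intros)

lemma penalty_deriv_cont: "continuous_on UNIV (\<lambda>t. E * (a * exp (a * t)) + A * (2 * max (t - s) 0) :: real)"
  by (intro continuous_intros)

lemma u_le:
  assumes t: "t \<in> {0..<T}" and x: "x \<in> Omega_bar"
  shows "u (t, x) \<le> M"
proof (rule ccontr)
  assume "\<not> u (t, x) \<le> M"
  define f where "f = (\<lambda>z. u z - M)"
  have p0: "f (t, x) > 0" using \<open>\<not> u (t, x) \<le> M\<close> by (simp add: f_def)
  have c0: "continuous_on ({0..<T} \<times> Omega_bar) f" unfolding f_def by (intro continuous_intros u_cont)
  have i0: "f (0, x) \<le> 0" if "x \<in> Omega_bar" for x using u_initial[OF that] obstacle_le[OF that] by (simp add: f_def)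
  have l0: "f (t, -1) \<le> 0" and r0: "f (t, 1) \<le> 0" if "t \<in> {0..<T}" for t
    using u_boundary[OF that] obstacle_le[of 1] obstacle_le[of "-1"] by (simp_all add: f_def)
  obtain A s t0 x0 where A: "A \<ge> 0" and p: "t0 \<in> {0<..<T}" "x0 \<in> Omega" and pos: "f (t0, x0) > 0"
    and max: "\<forall>\<^sub>F z in nhds (t0, x0). f z - A * (max (fst z - s) 0)\<^sup>2 \<le> f (t0, x0) - A * (max (t0 - s) 0)\<^sup>2"
    using penalized_maximum[OF c0 i0 l0 r0 t x p0] by blast
  define e where "e = (\<lambda>t. 0 * exp (0 * t) + A * (max (t - s) 0)\<^sup>2)"
  define e' where "e' = (\<lambda>t. 0 * (0 * exp (0 * t)) + A * (2 * max (t - s) 0))"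
  have C12: "C12_with_derivs ({0<..<T} \<times> Omega) (\<lambda>z. 0 + e (fst z)) (\<lambda>z. e' (fst z)) (\<lambda>z. 0) (\<lambda>z. 0)"
    by (rule C12_separated) (auto simp: e_def e'_def intro!: penalty_deriv[of 0 0, simplified] continuous_intros)
  have "e' (fst (t0, x0)) - 0 + b * u (t0, x0) \<le> 0"
  proof (rule viscosity_subsolutionD[OF u_sub p C12])
    show "\<forall>\<^sub>F z in nhds (t0, x0). u z - (0 + e (fst z)) \<le> u (t0, x0) - (0 + e (fst (t0, x0)))"
      using max by eventually_elim (simp add: f_def e_def)
    show "\<phi> x0 < u (t0, x0)" using pos obstacle_le[OF Omega_subset_Omega_bar[OF p(2)]] by (simp add: f_def)
  qed
  moreover have "e' t0 \<ge> 0" using A by (simp add: e'_def)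
  moreover have "b * u (t0, x0) > 0" using pos b_pos M_nonneg by (simp add: f_def)
  ultimately show False by simp
qed

text \<open>With E_m(t) = M exp (a t) / (1 + a h)^m one has E_m' = (E_(m-1) - E_m)/h, so the time
  derivative of the error term matches a step back in m. At a positive maximum of u -
  \<open>U (Suc m)\<close> - E_(m+1) the viscosity inequality therefore contradicts the induction
  hypothesis at the same point, without any relation between t and m h.\<close>

lemma u_le_U:
  assumes a: "a > 0" and m: "m \<le> N" and t: "t \<in> {0..<T}" and x: "x \<in> Omega_bar"
  shows "u (t, x) \<le> U m x + M / (1 + a * h) ^ m * exp (a * t)"
  using m t x
proof (induction m arbitrary: t x)
  case 0
  have "M * 1 \<le> M * exp (a * t)" using a 0(2) M_nonneg by (intro mult_left_mono) auto
  then show ?case using u_le[OF 0(2,3)] obstacle_nonneg[OF 0(3)] by (simp add: U_0)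
next
  case (Suc m)
  have mN: "m < N" using Suc.prems(1) by simp
  define E where "E = M / (1 + a * h) ^ Suc m"
  have ah: "1 + a * h > 0" using a h_pos by (simp add: add_pos_pos)
  have E: "E \<ge> 0" using M_nonneg ah by (simp add: E_def)
  have Em: "M / (1 + a * h) ^ m = (1 + a * h) * E" using ah by (simp add: E_def)
  show ?case
  proof (rule ccontr)
    assume nle: "\<not> u (t, x) \<le> U (Suc m) x + M / (1 + a * h) ^ Suc m * exp (a * t)"
    define f where "f = (\<lambda>z. u z - U (Suc m) (snd z) - E * exp (a * fst z))"
    have p0: "f (t, x) > 0" using nle by (simp add: f_def E_def)
    have c0: "continuous_on ({0..<T} \<times> Omega_bar) f" unfolding f_def
      by (intro continuous_intros u_cont continuous_on_compose2[OF U_cont[OF Suc.prems(1)]]) auto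
    have Ee: "E * exp (a * t) \<ge> 0" for t using E by simp
    have i0: "f (0, x) \<le> 0" if "x \<in> Omega_bar" for x
      using u_initial[OF that] U_ge[OF Suc.prems(1) that] E by (simp add: f_def)
    have l0: "f (t, -1) \<le> 0" and r0: "f (t, 1) \<le> 0" if "t \<in> {0..<T}" for t
      using u_boundary[OF that] U_boundary[OF Suc.prems(1)] Ee[of t] by (simp_all add: f_def)
    obtain A s t0 x0 where A: "A \<ge> 0" and p: "t0 \<in> {0<..<T}" "x0 \<in> Omega" and pos: "f (t0, x0) > 0"
      and max: "\<forall>\<^sub>F z in nhds (t0, x0). f z - A * (max (fst z - s) 0)\<^sup>2 \<le> f (t0, x0) - A * (max (t0 - s) 0)\<^sup>2"
      using penalized_maximum[OF c0 i0 l0 r0 Suc.prems(2,3) p0] by blast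
    note xb = Omega_subset_Omega_bar[OF p(2)]
    have tb: "t0 \<in> {0..<T}" using p(1) by simp
    obtain \<Psi> \<Psi>' where \<Psi>: "\<And>y. y \<in> Omega \<Longrightarrow> (\<Psi> has_real_derivative \<Psi>' y) (at y)"
      "\<And>y. y \<in> Omega \<Longrightarrow> (\<Psi>' has_real_derivative rhs m y) (at y)"
      "\<Psi> x0 = U (Suc m) x0" "\<And>y. y \<in> Omega \<Longrightarrow> U (Suc m) y \<le> \<Psi> y"
    proof (rule touching[OF mN p(2)], goal_cases)
      case (1 \<Psi> \<Psi>')
      show thesis by (rule 1(1)[of \<Psi> \<Psi>']) (fact 1)+
    qed
    define e where "e = (\<lambda>t. E * exp (a * t) + A * (max (t - s) 0)\<^sup>2)"
    define e' where "e' = (\<lambda>t. E * (a * exp (a * t)) + A * (2 * max (t - s) 0))"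
    have "continuous_on Omega (rhs m)"
      using rhs_cont[OF mN] by (rule continuous_on_subset) auto
    then have C12: "C12_with_derivs ({0<..<T} \<times> Omega) (\<lambda>z. \<Psi> (snd z) + e (fst z)) (\<lambda>z. e' (fst z))
        (\<lambda>z. \<Psi>' (snd z)) (\<lambda>z. rhs m (snd z))"
      unfolding e_def e'_def by (intro C12_separated \<Psi> penalty_deriv penalty_deriv_cont)
    have uU: "u (t0, x0) > U (Suc m) x0 + E * exp (a * t0)" using pos by (simp add: f_def)
    have "e' (fst (t0, x0)) - rhs m (snd (t0, x0)) + b * u (t0, x0) \<le> 0"
    proof (rule viscosity_subsolutionD[OF u_sub p C12])
      show "\<forall>\<^sub>F z in nhds (t0, x0). u z - (\<Psi> (snd z) + e (fst z)) \<le> u (t0, x0) - (\<Psi> (snd (t0, x0)) + e (fst (t0, x0)))"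
        using max eventually_nhds_snd[OF eventually_Omega[OF p(2)]]
      proof eventually_elim
        case (elim z)
        then show ?case using \<Psi>(3) \<Psi>(4)[OF elim(2)] by (simp add: f_def e_def)
      qed
      show "\<phi> x0 < u (t0, x0)" using uU U_ge[OF Suc.prems(1) xb] Ee[of t0] by linarith
    qed
    then have sub: "e' t0 - rhs m x0 + b * u (t0, x0) \<le> 0" by simp
    define X where "X = E * exp (a * t0)"
    have "e' t0 \<ge> a * X" using A by (simp add: e'_def X_def mult_ac)
    then have "h * (a * X + b * (u (t0, x0) - U (Suc m) x0)) \<le> h * ((U (Suc m) x0 - U m x0) / h)"
      using sub h_pos by (intro mult_left_mono) (auto simp: rhs_def right_diff_distrib)
    then have 1: "h * a * X + h * b * (u (t0, x0) - U (Suc m) x0) \<le> U (Suc m) x0 - U m x0"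
      using h_pos by (simp add: distrib_left mult.assoc)
    have 2: "u (t0, x0) \<le> U m x0 + (1 + a * h) * X"
      using Suc.IH[OF _ tb xb] mN unfolding Em X_def by (simp add: mult.assoc)
    have 3: "h * b * (u (t0, x0) - U (Suc m) x0) \<ge> 0"
      using uU Ee[of t0] h_pos b_pos by (intro mult_nonneg_nonneg) auto
    have "(1 + a * h) * X = X + h * a * X" by (simp add: algebra_simps)
    then show False using 1 2 3 uU unfolding X_def by linarith
  qed
qed

text \<open>The mirror image with -a in place of a. Here the iterate must be off the contact set for
  its touching function to serve in the supersolution test, which follows from its exceeding u.
  Index 0 has no error term, as u lies above the obstacle; this matters later when a shifted index
  is cut off at 0. At time 0 the error is at least \<open>M\<close> because powers of 1 - a h are at
  most 1.\<close>

lemma U_le_u: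
  assumes a: "a > 0" "a * h < 1" and m: "m \<le> N" and t: "t \<in> {0..<T}" and x: "x \<in> Omega_bar"
  shows "U m x \<le> u (t, x) + (if m = 0 then 0 else M / (1 - a * h) ^ m * exp (- a * t))"
  using m t x
proof (induction m arbitrary: t x)
  case 0
  then show ?case using u_ge by (simp add: U_0)
next
  case (Suc m)
  have mN: "m < N" using Suc.prems(1) by simp
  define E where "E = M / (1 - a * h) ^ Suc m"
  have ah: "1 - a * h > 0" "1 - a * h \<le> 1" using a h_pos by auto
  have E: "E \<ge> 0" using M_nonneg ah by (simp add: E_def)
  have EM: "E \<ge> M"
  proof -
    have "(1 - a * h) ^ Suc m \<le> 1" using ah by (intro power_le_one) auto
    then have "M * (1 - a * h) ^ Suc m \<le> M * 1" using M_nonneg by (intro mult_left_mono)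
    then show ?thesis using ah unfolding E_def by (simp add: pos_le_divide_eq del: power_Suc)
  qed
  have Em: "M / (1 - a * h) ^ m = (1 - a * h) * E" using ah by (simp add: E_def)
  show ?case
  proof (rule ccontr)
    assume nle: "\<not> U (Suc m) x \<le> u (t, x) + (if Suc m = 0 then 0 else M / (1 - a * h) ^ Suc m * exp (- a * t))"
    define f where "f = (\<lambda>z. U (Suc m) (snd z) - u z - E * exp (- a * fst z))"
    have p0: "f (t, x) > 0" using nle by (simp add: f_def E_def)
    have c0: "continuous_on ({0..<T} \<times> Omega_bar) f" unfolding f_def
      by (intro continuous_intros u_cont continuous_on_compose2[OF U_cont[OF Suc.prems(1)]]) auto
    have Ee: "E * exp (- a * t) \<ge> 0" for t using E by simp
    have i0: "f (0, x) \<le> 0" if "x \<in> Omega_bar" for x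
      using u_initial[OF that] U_le[OF Suc.prems(1) that] EM obstacle_nonneg[OF that] by (simp add: f_def)
    have l0: "f (t, -1) \<le> 0" and r0: "f (t, 1) \<le> 0" if "t \<in> {0..<T}" for t
      using u_boundary[OF that] U_boundary[OF Suc.prems(1)] Ee[of t] by (simp_all add: f_def)
    obtain A s t0 x0 where A: "A \<ge> 0" and p: "t0 \<in> {0<..<T}" "x0 \<in> Omega" and pos: "f (t0, x0) > 0"
      and max: "\<forall>\<^sub>F z in nhds (t0, x0). f z - A * (max (fst z - s) 0)\<^sup>2 \<le> f (t0, x0) - A * (max (t0 - s) 0)\<^sup>2"
      using penalized_maximum[OF c0 i0 l0 r0 Suc.prems(2,3) p0] by blast
    note xb = Omega_subset_Omega_bar[OF p(2)]
    have tb: "t0 \<in> {0..<T}" using p(1) by simp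
    obtain \<Psi> \<Psi>' where \<Psi>: "\<And>y. y \<in> Omega \<Longrightarrow> (\<Psi> has_real_derivative \<Psi>' y) (at y)"
      "\<And>y. y \<in> Omega \<Longrightarrow> (\<Psi>' has_real_derivative rhs m y) (at y)"
      "\<Psi> x0 = U (Suc m) x0" "\<phi> x0 < U (Suc m) x0 \<Longrightarrow> \<forall>\<^sub>F y in nhds x0. \<Psi> y = U (Suc m) y"
    proof (rule touching[OF mN p(2)], goal_cases)
      case (1 \<Psi> \<Psi>')
      show thesis by (rule 1(1)[of \<Psi> \<Psi>']) (fact 1)+
    qed
    define e where "e = (\<lambda>t. (- E) * exp ((- a) * t) + (- A) * (max (t - s) 0)\<^sup>2)"
    define e' where "e' = (\<lambda>t. (- E) * ((- a) * exp ((- a) * t)) + (- A) * (2 * max (t - s) 0))"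
    have "continuous_on Omega (rhs m)"
      using rhs_cont[OF mN] by (rule continuous_on_subset) auto
    then have C12: "C12_with_derivs ({0<..<T} \<times> Omega) (\<lambda>z. \<Psi> (snd z) + e (fst z)) (\<lambda>z. e' (fst z))
        (\<lambda>z. \<Psi>' (snd z)) (\<lambda>z. rhs m (snd z))"
      unfolding e_def e'_def by (intro C12_separated \<Psi> penalty_deriv penalty_deriv_cont)
    have uU: "U (Suc m) x0 > u (t0, x0) + E * exp (- a * t0)" using pos by (simp add: f_def)
    have gt: "\<phi> x0 < U (Suc m) x0" using uU u_ge[OF tb xb] Ee[of t0] by linarith
    have "e' (fst (t0, x0)) - rhs m (snd (t0, x0)) + b * u (t0, x0) \<ge> 0"
    proof (rule viscosity_supersolutionD[OF u_super p C12])
      show "\<forall>\<^sub>F z in nhds (t0, x0). u z - (\<Psi> (snd z) + e (fst z)) \<ge> u (t0, x0) - (\<Psi> (snd (t0, x0)) + e (fst (t0, x0)))"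
        using max eventually_nhds_snd[OF \<Psi>(4)[OF gt]]
        by eventually_elim (simp add: f_def e_def \<Psi>(3))
    qed
    then have sup: "e' t0 - rhs m x0 + b * u (t0, x0) \<ge> 0" by simp
    define X where "X = E * exp (- a * t0)"
    have "e' t0 \<le> a * X" using A by (simp add: e'_def X_def mult_ac)
    moreover have "b * (U (Suc m) x0 - u (t0, x0)) \<ge> 0"
      using uU Ee[of t0] b_pos by (intro mult_nonneg_nonneg) auto
    ultimately have "h * ((U (Suc m) x0 - U m x0) / h) \<le> h * (a * X)"
      using sup h_pos by (intro mult_left_mono) (auto simp: rhs_def right_diff_distrib)
    then have 1: "U (Suc m) x0 - U m x0 \<le> h * a * X" using h_pos by (simp add: mult.assoc)
    have "X \<ge> 0" unfolding X_def by (rule Ee)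
    then have X0: "(1 - a * h) * X \<ge> 0" using ah by simp
    have 2: "U m x0 \<le> u (t0, x0) + (1 - a * h) * X"
    proof (cases "m = 0")
      case True
      then show ?thesis using Suc.IH[OF _ tb xb] X0 by simp
    next
      case False
      then show ?thesis using Suc.IH[OF _ tb xb] mN unfolding Em X_def by (simp add: mult.assoc)
    qed
    have "(1 - a * h) * X = X - h * a * X" by (simp add: algebra_simps)
    then show False using 1 2 uU unfolding X_def by linarith
  qed
qed

end

section \<open>The error estimate\<close>

lemma sqrt_diff_le:
  fixes m n :: real
  assumes "0 \<le> m" "m \<le> n" "0 < p" "p \<le> n"
  shows "sqrt n - sqrt m \<le> (n - m) / sqrt p"
proof -
  have n: "n > 0" using assms by simp
  have "(sqrt n - sqrt m) * sqrt p \<le> (sqrt n - sqrt m) * (sqrt n + sqrt m)"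
    using assms by (intro mult_left_mono add_increasing2) auto
  also have "\<dots> = n - m" using assms n by (simp add: algebra_simps)
  finally show ?thesis using assms by (simp add: pos_le_divide_eq)
qed

context obstacle_comparison
begin

text \<open>\<open>delta\<close> bounds h j, the time by which the shifted index overshoots t, so
  the estimate is made up to T - \<delta>. \<open>h_small\<close> gives |ln h| \<ge> 1, which
  absorbs terms of order sqrt h into the final rate.\<close>

context
  fixes t x \<delta> :: real
  assumes h_small: "h \<le> exp (-1)" and delta: "3 * sqrt (T + 1) * (sqrt h * \<bar>ln h\<bar>) \<le> \<delta>"
    and N: "N = nat \<lfloor>T / h\<rfloor>" and t: "0 \<le> t" "t \<le> T - \<delta>" and x: "x \<in> Omega_bar" and delta_pos: "\<delta> > 0"
begin

text \<open>\<open>\<theta>\<close> stands for a h. The choice \<theta>^2 (k0 + 1) = 1/4 bounds the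
  quadratic terms in the logarithms of the error factors, and \<open>j\<close> is taken so that j
  \<theta> \<ge> |ln h|. The 1 added under the root keeps R \<ge> 1 for t < h.\<close>

definition k0 :: nat where "k0 = nat \<lfloor>t / h\<rfloor>"
definition R :: real where "R = sqrt (real k0 + 1)"
definition \<theta> :: real where "\<theta> = 1 / (2 * R)"
definition j :: nat where "j = nat \<lceil>2 * R * \<bar>ln h\<bar>\<rceil>"

lemma L_ge: "\<bar>ln h\<bar> \<ge> 1" and h_eq: "h = exp (- \<bar>ln h\<bar>)"
proof -
  have "ln h \<le> -1" using h_small h_pos by (metis ln_exp ln_le_cancel_iff exp_gt_zero)
  then show "\<bar>ln h\<bar> \<ge> 1" by simp
  have "- \<bar>ln h\<bar> = ln h" using \<open>ln h \<le> -1\<close> by simp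
  then show "h = exp (- \<bar>ln h\<bar>)" using h_pos by simp
qed

lemma sqrt_h: "exp (- \<bar>ln h\<bar> / 2) = sqrt h"
proof -
  have "(exp (- \<bar>ln h\<bar> / 2))\<^sup>2 = exp (- \<bar>ln h\<bar>)"
    by (simp add: power2_eq_square flip: exp_add)
  then have "(exp (- \<bar>ln h\<bar> / 2))\<^sup>2 = h" using h_eq by simp
  then show ?thesis by (metis exp_ge_zero real_sqrt_unique)
qed

lemma R_ge: "R \<ge> 1" "R * R = real k0 + 1"
  by (auto simp: R_def)

lemma theta: "\<theta> > 0" "\<theta> \<le> 1 / 2" "\<theta> * R = 1 / 2" "\<theta> * \<theta> * (real k0 + 1) = 1 / 4"
proof -
  show "\<theta> > 0" using R_ge(1) by (simp add: \<theta>_def)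
  show "\<theta> \<le> 1 / 2" using R_ge(1) by (simp add: \<theta>_def field_simps)
  show tr: "\<theta> * R = 1 / 2" using R_ge(1) by (simp add: \<theta>_def)
  have "\<theta> * \<theta> * (R * R) = (\<theta> * R) * (\<theta> * R)" by (simp add: mult_ac)
  then show "\<theta> * \<theta> * (real k0 + 1) = 1 / 4" using tr R_ge(2) by simp
qed

lemma j_bounds: "2 * R * \<bar>ln h\<bar> \<le> real j" "real j \<le> 3 * R * \<bar>ln h\<bar>" "\<bar>ln h\<bar> \<le> real j * \<theta>" "j \<ge> 1"
proof -
  have RL: "R * \<bar>ln h\<bar> \<ge> 1"
    using mult_mono[OF R_ge(1) L_ge] R_ge(1) by simp
  have p: "2 * R * \<bar>ln h\<bar> \<ge> 0" using R_ge(1) by simp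
  show 1: "2 * R * \<bar>ln h\<bar> \<le> real j" unfolding j_def using p by (meson of_nat_ceiling)
  have "real j = of_int \<lceil>2 * R * \<bar>ln h\<bar>\<rceil>" unfolding j_def using p by simp
  also have "\<dots> < 2 * R * \<bar>ln h\<bar> + 1" by linarith
  finally show "real j \<le> 3 * R * \<bar>ln h\<bar>" using RL by simp
  have "2 * R * \<bar>ln h\<bar> * \<theta> \<le> real j * \<theta>" using 1 theta(1) by (intro mult_right_mono) auto
  moreover have "2 * R * \<bar>ln h\<bar> * \<theta> = 2 * (\<theta> * R) * \<bar>ln h\<bar>" by (simp add: mult_ac)
  ultimately show "\<bar>ln h\<bar> \<le> real j * \<theta>" using theta(3) by simp
  have "real j > 0" using 1 RL by simp
  then show "j \<ge> 1" by simp
qed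

lemma k0_bounds: "real k0 * h \<le> t" "t < (real k0 + 1) * h"
proof -
  have "t / h \<ge> 0" using t h_pos by simp
  then have "real k0 = of_int \<lfloor>t / h\<rfloor>" by (simp add: k0_def)
  then have "real k0 \<le> t / h" "t / h < real k0 + 1" by linarith+
  then show "real k0 * h \<le> t" "t < (real k0 + 1) * h" using h_pos by (simp_all add: field_simps)
qed

text \<open>Since (k0 + 1) h \<le> t + h, the 1 in \<open>R\<close> costs at most h \<le> 1; this is
  where T + 1 comes from.\<close>

lemma hR: "h * R \<le> sqrt (T + 1) * sqrt h"
proof -
  have h1: "h \<le> 1" using h_small exp_le_one_iff[of "-1"] by linarith
  have "(real k0 + 1) * h \<le> T + 1" using k0_bounds(1) t delta_pos h1 by (simp add: distrib_right)
  then have "((real k0 + 1) * h) * h \<le> (T + 1) * h" using h_pos by (intro mult_right_mono) auto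
  moreover have "(h * R)\<^sup>2 = ((real k0 + 1) * h) * h"
    using R_ge(2) by (simp add: power2_eq_square mult_ac)
  moreover have "(sqrt (T + 1) * sqrt h)\<^sup>2 = (T + 1) * h"
    using t delta_pos h_pos by (simp add: power_mult_distrib)
  ultimately have "(h * R)\<^sup>2 \<le> (sqrt (T + 1) * sqrt h)\<^sup>2" by simp
  then show ?thesis by (rule power2_le_imp_le) (use t delta_pos h_pos in auto)
qed

lemma hj: "h * real j \<le> 3 * sqrt (T + 1) * (sqrt h * \<bar>ln h\<bar>)"
proof -
  have "h * real j \<le> h * (3 * R * \<bar>ln h\<bar>)" using j_bounds(2) h_pos by (intro mult_left_mono) auto
  also have "\<dots> = 3 * (h * R) * \<bar>ln h\<bar>" by simp
  also have "\<dots> \<le> 3 * (sqrt (T + 1) * sqrt h) * \<bar>ln h\<bar>"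
    using hR by (intro mult_right_mono mult_left_mono) auto
  finally show ?thesis by (simp add: mult_ac)
qed

lemma t_T: "t \<in> {0..<T}"
  using t delta_pos by simp

lemma index_le: "k0 + j \<le> N"
proof -
  have "(real k0 + real j) * h \<le> T"
    using k0_bounds(1) hj delta t(2) unfolding distrib_right mult.commute[of "real j" h] by linarith
  then have "real (k0 + j) \<le> T / h" using h_pos by (simp add: field_simps)
  then show ?thesis unfolding N by (simp add: le_nat_floor)
qed

lemma a_facts: "\<theta> / h > 0" "\<theta> / h * h = \<theta>"
  using theta(1) h_pos by simp_all

text \<open>By ln (1 + \<theta>) \<ge> \<theta> - \<theta>^2, a shift of \<open>j\<close> indices
  forward brings the exponential factor down to order sqrt h; \<open>growth_le\<close> then pays for
  returning to \<open>k0\<close>.\<close>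

lemma lower_error: "u (t, x) - U k0 x \<le> (3 * M + 3 + 3 * C * sqrt (T + 1)) * (sqrt h * \<bar>ln h\<bar>)"
proof -
  have 1: "u (t, x) \<le> U (k0 + j) x + M / (1 + \<theta>) ^ (k0 + j) * exp (\<theta> / h * t)"
    using u_le_U[OF a_facts(1) index_le t_T x] unfolding a_facts(2) .
  have "exp (\<theta> / h * t) / (1 + \<theta>) ^ (k0 + j) \<le> exp (3 / 4 - \<bar>ln h\<bar> / 2)"
  proof -
    have "exp (\<theta> - \<theta>\<^sup>2) \<le> 1 + \<theta>"
      using ln_one_plus_pos_lower_bound[of \<theta>] theta(1,2) by (simp add: ln_ge_iff)
    then have "exp (\<theta> - \<theta>\<^sup>2) ^ (k0 + j) \<le> (1 + \<theta>) ^ (k0 + j)" by (intro power_mono) auto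
    then have "exp (real (k0 + j) * (\<theta> - \<theta>\<^sup>2)) \<le> (1 + \<theta>) ^ (k0 + j)" by (simp only: exp_of_nat_mult)
    then have "exp (\<theta> / h * t) / (1 + \<theta>) ^ (k0 + j) \<le> exp (\<theta> / h * t) / exp (real (k0 + j) * (\<theta> - \<theta>\<^sup>2))"
      using theta(1) by (intro divide_left_mono mult_pos_pos) auto
    also have "\<dots> = exp (\<theta> / h * t - real (k0 + j) * (\<theta> - \<theta>\<^sup>2))" by (simp only: exp_diff)
    also have "\<dots> \<le> exp (3 / 4 - \<bar>ln h\<bar> / 2)"
    proof -
      have "\<theta> / h * t \<le> \<theta> / h * ((real k0 + 1) * h)" using k0_bounds(2) a_facts(1) by (intro mult_left_mono) auto
      also have "\<dots> = \<theta> * (real k0 + 1)" using h_pos by simp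
      finally have "\<theta> / h * t - real (k0 + j) * (\<theta> - \<theta>\<^sup>2) \<le> \<theta> * (real k0 + 1) - real (k0 + j) * (\<theta> - \<theta>\<^sup>2)" by simp
      also have "\<dots> = \<theta> - real j * \<theta> + \<theta> * \<theta> * (real k0 + 1) - \<theta> * \<theta> + (real j * \<theta>) * \<theta>"
        by (simp add: power2_eq_square algebra_simps)
      \<comment> \<open>Half of j \<theta> is given up to j \<theta>^2, as \<theta> \<le> 1/2; this
        leaves |ln h|/2 in the exponent, hence sqrt h.\<close>
      also have "\<dots> \<le> 1 / 2 - real j * \<theta> + 1 / 4 + (real j * \<theta>) * (1 / 2)"
      proof -
        have "\<theta> * \<theta> \<ge> 0" by simp
        moreover have "real j * \<theta> * \<theta> \<le> real j * \<theta> * (1 / 2)"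
          by (rule mult_left_mono[OF theta(2)]) (use theta(1) in simp)
        ultimately show ?thesis using theta(2,4) by linarith
      qed
      also have "\<dots> \<le> 3 / 4 - \<bar>ln h\<bar> / 2" using j_bounds(3) by linarith
      finally show ?thesis by simp
    qed
    finally show ?thesis .
  qed
  also have "exp (3 / 4 - \<bar>ln h\<bar> / 2) = exp (3 / 4) * sqrt h"
    unfolding sqrt_h[symmetric] by (simp flip: exp_add)
  also have "\<dots> \<le> 3 * sqrt h"
  proof -
    have "exp (3 / 4 :: real) \<le> exp 1" by simp
    then have "exp (3 / 4 :: real) \<le> 3" using exp_le by linarith
    then show ?thesis using h_pos by (intro mult_right_mono) auto
  qed
  finally have "M * (exp (\<theta> / h * t) / (1 + \<theta>) ^ (k0 + j)) \<le> M * (3 * sqrt h)"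
    using M_nonneg by (intro mult_left_mono)
  also have "\<dots> \<le> 3 * M * (sqrt h * \<bar>ln h\<bar>)"
    using M_nonneg h_pos L_ge mult_left_mono[OF L_ge, of "3 * M * sqrt h"] by (simp add: mult_ac)
  finally have 2: "M / (1 + \<theta>) ^ (k0 + j) * exp (\<theta> / h * t) \<le> 3 * M * (sqrt h * \<bar>ln h\<bar>)" by simp
  have 3: "U (k0 + j) x - U k0 x \<le> sqrt h * (sqrt (real (k0 + j)) - sqrt (real k0)) + C * h * (real (k0 + j) - real k0)"
    by (rule growth_le[OF _ index_le x]) simp
  have "sqrt (real (k0 + j)) - sqrt (real k0) \<le> (real (k0 + j) - real k0) / sqrt (real k0 + 1)"
    using j_bounds(4) by (intro sqrt_diff_le) auto
  also have "\<dots> = real j / R" by (simp add: R_def)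
  also have "\<dots> \<le> 3 * \<bar>ln h\<bar>" using j_bounds(2) R_ge(1) by (simp add: divide_le_eq mult_ac)
  finally have "sqrt h * (sqrt (real (k0 + j)) - sqrt (real k0)) \<le> sqrt h * (3 * \<bar>ln h\<bar>)"
    using h_pos by (intro mult_left_mono) auto
  moreover have "C * (h * real j) \<le> C * (3 * sqrt (T + 1) * (sqrt h * \<bar>ln h\<bar>))"
    using hj C_nonneg by (intro mult_left_mono)
  ultimately show ?thesis using 1 2 3 by (simp add: algebra_simps)
qed

text \<open>The shift now goes backward, with ln (1 - \<theta>) \<ge> - \<theta> - 2 \<theta>^2. The
  subtraction defining \<open>k\<close> is truncated: if it yields 0, there is no exponential term
  to estimate and only the growth from index 0 remains.\<close>

lemma upper_error: "U k0 x - u (t, x) \<le> (2 * M + 6 + 3 * C * sqrt (T + 1)) * (sqrt h * \<bar>ln h\<bar>)"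
proof -
  define k where "k = k0 - j"
  have k: "k \<le> k0" "real k0 - real k \<le> real j" by (auto simp: k_def)
  have kN: "k \<le> N" "k0 \<le> N" using index_le k by auto
  have sL: "sqrt h * \<bar>ln h\<bar> \<ge> sqrt h" using mult_left_mono[OF L_ge, of "sqrt h"] h_pos by simp
  have 1: "U k x \<le> u (t, x) + (if k = 0 then 0 else M / (1 - \<theta>) ^ k * exp (- (\<theta> / h) * t))"
    using U_le_u[OF a_facts(1) _ kN(1) t_T x] theta(2) unfolding a_facts(2) by simp
  have 2: "(if k = 0 then 0 else M / (1 - \<theta>) ^ k * exp (- (\<theta> / h) * t)) \<le> 2 * M * (sqrt h * \<bar>ln h\<bar>)"
  proof (cases "k = 0")
    case True
    then show ?thesis using M_nonneg h_pos by simp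
  next
    case False
    then have kk: "real k = real k0 - real j" by (simp add: k_def)
    have t1: "1 - \<theta> > 0" using theta(2) by simp
    have "exp (- \<theta> - 2 * \<theta>\<^sup>2) \<le> 1 - \<theta>"
      using ln_one_minus_pos_lower_bound[of \<theta>] theta(1,2) t1 by (simp add: ln_ge_iff)
    then have "exp (- \<theta> - 2 * \<theta>\<^sup>2) ^ k \<le> (1 - \<theta>) ^ k" by (intro power_mono) auto
    then have "exp (real k * (- \<theta> - 2 * \<theta>\<^sup>2)) \<le> (1 - \<theta>) ^ k" by (simp only: exp_of_nat_mult)
    then have "exp (- (\<theta> / h) * t) / (1 - \<theta>) ^ k \<le> exp (- (\<theta> / h) * t) / exp (real k * (- \<theta> - 2 * \<theta>\<^sup>2))"
      using t1 by (intro divide_left_mono mult_pos_pos) auto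
    also have "\<dots> = exp (- (\<theta> / h) * t - real k * (- \<theta> - 2 * \<theta>\<^sup>2))" by (simp only: exp_diff)
    also have "\<dots> \<le> exp (1 / 2 - \<bar>ln h\<bar> / 2)"
    proof -
      have "\<theta> / h * (real k0 * h) \<le> \<theta> / h * t" using k0_bounds(1) a_facts(1) by (intro mult_left_mono) auto
      moreover have "\<theta> / h * (real k0 * h) = \<theta> * real k0" using h_pos by simp
      ultimately have "- (\<theta> / h) * t - real k * (- \<theta> - 2 * \<theta>\<^sup>2) \<le> - \<theta> * real k0 - real k * (- \<theta> - 2 * \<theta>\<^sup>2)" by simp
      also have "\<dots> = 2 * (\<theta> * \<theta> * (real k0 + 1)) - 2 * (\<theta> * \<theta>) - real j * \<theta> - 2 * (real j * (\<theta> * \<theta>))"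
        unfolding kk by (simp add: power2_eq_square algebra_simps)
      also have "\<dots> \<le> 1 / 2 - \<bar>ln h\<bar>"
      proof -
        have "\<theta> * \<theta> \<ge> 0" "real j * (\<theta> * \<theta>) \<ge> 0" by simp_all
        then show ?thesis using theta(4) j_bounds(3) by linarith
      qed
      also have "\<dots> \<le> 1 / 2 - \<bar>ln h\<bar> / 2" by simp
      finally show ?thesis by simp
    qed
    also have "\<dots> = exp (1 / 2) * sqrt h"
      unfolding sqrt_h[symmetric] by (simp flip: exp_add)
    also have "\<dots> \<le> 2 * sqrt h"
    proof -
      have "(exp (1 / 2 :: real))\<^sup>2 = exp 1" by (simp add: power2_eq_square flip: exp_add)
      then have "(exp (1 / 2 :: real))\<^sup>2 \<le> 2\<^sup>2" using exp_le by simp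
      then have "exp (1 / 2 :: real) \<le> 2" by (rule power2_le_imp_le) simp
      then show ?thesis using h_pos by (intro mult_right_mono) auto
    qed
    finally have "M * (exp (- (\<theta> / h) * t) / (1 - \<theta>) ^ k) \<le> M * (2 * sqrt h)"
      using M_nonneg by (intro mult_left_mono)
    also have "\<dots> \<le> M * (2 * (sqrt h * \<bar>ln h\<bar>))" using sL M_nonneg by (intro mult_left_mono) auto
    finally show ?thesis using False by (simp add: mult_ac)
  qed
  have 3: "U k0 x - U k x \<le> sqrt h * (sqrt (real k0) - sqrt (real k)) + C * h * (real k0 - real k)"
    by (rule growth_le[OF k(1) kN(2) x])
  have "sqrt (real k0) - sqrt (real k) \<le> 6 * \<bar>ln h\<bar>"
  proof (cases "k0 = 0")
    case True
    then show ?thesis using k by simp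
  next
    case False
    then have k1: "real k0 \<ge> 1" by simp
    \<comment> \<open>The growth bound involves sqrt k0 instead of R; exchanging them costs a factor
      2, whence 6 instead of 3.\<close>
    have "real k0 + 1 \<le> 4 * real k0" using k1 by simp
    then have "R \<le> sqrt (4 * real k0)" unfolding R_def by simp
    then have R2: "R \<le> 2 * sqrt (real k0)" by (simp add: real_sqrt_mult)
    have s: "sqrt (real k0) > 0" using k1 by simp
    have "sqrt (real k0) - sqrt (real k) \<le> (real k0 - real k) / sqrt (real k0)"
      using k k1 by (intro sqrt_diff_le) auto
    also have "\<dots> \<le> real j / sqrt (real k0)" using k(2) s by (intro divide_right_mono) auto
    also have "\<dots> \<le> (3 * R * \<bar>ln h\<bar>) / sqrt (real k0)" using j_bounds(2) s by (intro divide_right_mono) auto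
    also have "\<dots> \<le> (3 * (2 * sqrt (real k0)) * \<bar>ln h\<bar>) / sqrt (real k0)"
      using R2 s by (intro divide_right_mono mult_right_mono mult_left_mono) auto
    also have "\<dots> = 6 * \<bar>ln h\<bar>" using s by simp
    finally show ?thesis .
  qed
  then have "sqrt h * (sqrt (real k0) - sqrt (real k)) \<le> sqrt h * (6 * \<bar>ln h\<bar>)"
    using h_pos by (intro mult_left_mono) auto
  moreover have "C * (h * (real k0 - real k)) \<le> C * (3 * sqrt (T + 1) * (sqrt h * \<bar>ln h\<bar>))"
  proof (rule mult_left_mono[OF _ C_nonneg])
    have "h * (real k0 - real k) \<le> h * real j" using k(2) h_pos by (intro mult_left_mono) auto
    then show "h * (real k0 - real k) \<le> 3 * sqrt (T + 1) * (sqrt h * \<bar>ln h\<bar>)" using hj by linarith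
  qed
  ultimately show ?thesis using 1 2 3 by (simp add: algebra_simps)
qed

lemma error_bound:
  "\<bar>U (nat \<lfloor>t / h\<rfloor>) x - u (t, x)\<bar> \<le> (3 * M + 6 + 3 * C * sqrt (T + 1)) * (sqrt h * \<bar>ln h\<bar>)"
proof -
  define s where "s = sqrt h * \<bar>ln h\<bar>"
  have s: "s \<ge> 0" using h_pos by (simp add: s_def)
  have "(3 * M + 3 + 3 * C * sqrt (T + 1)) * s \<le> (3 * M + 6 + 3 * C * sqrt (T + 1)) * s"
    "(2 * M + 6 + 3 * C * sqrt (T + 1)) * s \<le> (3 * M + 6 + 3 * C * sqrt (T + 1)) * s"
    using s M_nonneg by (intro mult_right_mono; simp)+
  then show ?thesis using lower_error upper_error unfolding k0_def s_def by linarith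
qed

end

end

section \<open>The concrete obstacle and the hypotheses of the comparison\<close>

lemma obstacle_eq_max:
  "obstacle q r x = exp ((alpha q r + 1) * max x 0) - exp (alpha q r * max x 0)"
proof (cases "x \<ge> 0")
  case True
  then show ?thesis by (simp add: obstacle_def max_def right_diff_distrib distrib_right exp_add)
next
  case False
  then show ?thesis by (simp add: obstacle_def max_def)
qed

lemma obstacle_continuous: "continuous_on S (obstacle q r)"
  unfolding obstacle_def by (intro continuous_intros)

text \<open>After the subtraction the function is -g on the right and -C y^2/2 on the left. Both
  branches are concave, and as g(0) = g'(0) = 0 they join with equal slope. The constant dominates
  the positive part of the second derivative of the smooth right branch for |s| \<le> 2.\<close>

lemma obstacle_semiconcave:
  fixes q r :: real
  defines "a \<equiv> alpha q r"
  defines "C \<equiv> (a + 1)\<^sup>2 * exp (2 * \<bar>a + 1\<bar>)"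
  assumes x: "x \<in> Omega"
  shows "\<exists>m. \<forall>y\<in>Omega_bar. obstacle q r y - max y 0 - C * y\<^sup>2 / 2 \<le> obstacle q r x - max x 0 - C * x\<^sup>2 / 2 + m * (y - x)"
proof -
  define g where "g = (\<lambda>s. C * s\<^sup>2 / 2 - (exp ((a + 1) * s) - exp (a * s) - s))"
  define g1 where "g1 = (\<lambda>s. C * s - ((a + 1) * exp ((a + 1) * s) - a * exp (a * s) - 1))"
  define g2 where "g2 = (\<lambda>s. C - ((a + 1)\<^sup>2 * exp ((a + 1) * s) - a\<^sup>2 * exp (a * s)))"
  have d1: "(g has_real_derivative g1 s) (at s)" for s
    unfolding g_def g1_def by (auto intro!: derivative_eq_intros)
  have d2: "(g1 has_real_derivative g2 s) (at s)" for s
    unfolding g1_def g2_def by (auto intro!: derivative_eq_intros simp: power2_eq_square)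
  have g2: "g2 s \<ge> 0" if "s \<in> {-2..2}" for s
  proof -
    have "(a + 1) * s \<le> \<bar>a + 1\<bar> * \<bar>s\<bar>" by (metis abs_ge_self abs_mult)
    also have "\<dots> \<le> \<bar>a + 1\<bar> * 2" using that by (intro mult_left_mono) auto
    finally have "(a + 1)\<^sup>2 * exp ((a + 1) * s) \<le> C" unfolding C_def by (intro mult_left_mono) auto
    moreover have "a\<^sup>2 * exp (a * s) \<ge> 0" by simp
    ultimately show ?thesis unfolding g2_def by linarith
  qed
  \<comment> \<open>The interval is enlarged so that 0 and 1 are interior points, as the tangent
    inequality requires.\<close>
  have conv: "convex_on {-2..2} g"
    by (rule f''_ge0_imp_convex[OF convex_real_interval(5) d1 d2 g2])
  have tangent: "g y \<ge> g s + g1 s * (y - s)" if "s \<in> {0..1}" "y \<in> {0..1}" for s y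
  proof -
    have "g y - g s \<ge> g1 s * (y - s)"
      by (rule convex_on_imp_above_tangent[OF conv]) (use that d1 in \<open>auto intro: has_field_derivative_at_within\<close>)
    then show ?thesis by simp
  qed
  have zero: "g 0 = 0" "g1 0 = 0" by (simp_all add: g_def g1_def)
  have C0: "C \<ge> 0" by (simp add: C_def)
  have pos: "obstacle q r y - max y 0 - C * y\<^sup>2 / 2 = - g y" if "y \<ge> 0" for y
    using that by (simp add: obstacle_eq_max g_def a_def max_def)
  have neg: "obstacle q r y - max y 0 - C * y\<^sup>2 / 2 = - (C * y\<^sup>2 / 2)" if "y \<le> 0" for y
    using that by (simp add: obstacle_eq_max max_def)
  show ?thesis
  proof (cases "x \<ge> 0")
    case True
    then have x01: "x \<in> {0..1}" using x by simp
    \<comment> \<open>The nonnegative slope makes the tangent at x nonpositive to the left of 0,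
      hence below the branch C y^2/2 there.\<close>
    have "g1 x \<ge> 0"
    proof (cases "x = 0")
      case False
      have "g x \<ge> 0" using tangent[of 0 x] x01 zero by simp
      moreover have "0 \<ge> g x + g1 x * (0 - x)" using tangent[OF x01, of 0] zero by simp
      ultimately have "g1 x * x \<ge> 0" by simp
      then show ?thesis using False True by (simp add: zero_le_mult_iff)
    qed (simp add: zero)
    show ?thesis
    proof (intro exI[of _ "- g1 x"] ballI)
      fix y :: real assume y: "y \<in> Omega_bar"
      have "(if y \<ge> 0 then g y else C * y\<^sup>2 / 2) \<ge> g x + g1 x * (y - x)"
      proof (cases "y \<ge> 0")
        case True
        then show ?thesis using tangent[OF x01, of y] y by simp
      next
        case False
        have "g x + g1 x * (0 - x) \<le> 0" using tangent[OF x01, of 0] zero by simp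
        moreover have "g1 x * y \<le> 0" using \<open>g1 x \<ge> 0\<close> False by (simp add: mult_nonneg_nonpos)
        moreover have "g x + g1 x * (y - x) = (g x + g1 x * (0 - x)) + g1 x * y" by (simp add: algebra_simps)
        moreover have "C * y\<^sup>2 / 2 \<ge> 0" using C0 by simp
        ultimately show ?thesis using False by simp
      qed
      then show "obstacle q r y - max y 0 - C * y\<^sup>2 / 2 \<le> obstacle q r x - max x 0 - C * x\<^sup>2 / 2 + - g1 x * (y - x)"
        using pos[OF True] pos[of y] neg[of y] by (cases "y \<ge> 0") simp_all
    qed
  next
    case False
    show ?thesis
    proof (intro exI[of _ "- (C * x)"] ballI)
      fix y :: real assume y: "y \<in> Omega_bar"
      have "(if y \<ge> 0 then g y else C * y\<^sup>2 / 2) \<ge> C * x\<^sup>2 / 2 + C * x * (y - x)"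
      proof (cases "y \<ge> 0")
        case True
        have "g y \<ge> 0" using tangent[of 0 y] True y zero by simp
        moreover have "C * x * y \<le> 0" using C0 False True by (simp add: mult_nonneg_nonpos mult_nonpos_nonneg)
        moreover have "C * x\<^sup>2 \<ge> 0" using C0 by simp
        moreover have "C * x\<^sup>2 / 2 + C * x * (y - x) = C * x * y - C * x\<^sup>2 / 2" by (simp add: power2_eq_square algebra_simps)
        ultimately show ?thesis using True by simp
      next
        case False
        have "C * (y - x)\<^sup>2 \<ge> 0" using C0 by simp
        moreover have "C * (y - x)\<^sup>2 / 2 = C * y\<^sup>2 / 2 - (C * x\<^sup>2 / 2 + C * x * (y - x))"
          by (simp add: power2_eq_square field_simps)
        ultimately have "C * x\<^sup>2 / 2 + C * x * (y - x) \<le> C * y\<^sup>2 / 2" by linarith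
        then show ?thesis using False by (simp only: if_False)
      qed
      then show "obstacle q r y - max y 0 - C * y\<^sup>2 / 2 \<le> obstacle q r x - max x 0 - C * x\<^sup>2 / 2 + - (C * x) * (y - x)"
        using neg[of x] pos[of y] neg[of y] False by (cases "y \<ge> 0") simp_all
    qed
  qed
qed

lemma obstacle_bounds:
  assumes "x \<in> Omega_bar"
  shows "0 \<le> obstacle q r x" "obstacle q r x \<le> exp (\<bar>alpha q r\<bar> + 1)"
proof -
  show "0 \<le> obstacle q r x" by (simp add: obstacle_def)
  have "alpha q r * x \<le> \<bar>alpha q r\<bar> * \<bar>x\<bar>" by (metis abs_ge_self abs_mult)
  also have "\<dots> \<le> \<bar>alpha q r\<bar> * 1" using assms by (intro mult_left_mono) auto
  finally have "exp (alpha q r * x) \<le> exp \<bar>alpha q r\<bar>" by simp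
  moreover have "exp x \<le> exp 1" using assms by simp
  then have "exp x - 1 \<le> exp 1" by linarith
  then have "max (exp x - 1) 0 \<le> exp 1" by (rule max.boundedI) simp
  ultimately have "obstacle q r x \<le> exp \<bar>alpha q r\<bar> * exp 1"
    unfolding obstacle_def by (intro mult_mono) auto
  then show "obstacle q r x \<le> exp (\<bar>alpha q r\<bar> + 1)" by (simp add: exp_add)
qed

text \<open>The almost everywhere equation gives the order inside the open cylinder, and continuity
  carries it to the initial time and the lateral boundary.\<close>

lemma solution_ge_obstacle:
  assumes sol: "ae_solution T b \<phi> u" and c: "continuous_on ({0..<T} \<times> Omega_bar) u"
    and p: "continuous_on Omega_bar \<phi>" and T: "T > 0" and t: "t \<in> {0..<T}" and x: "x \<in> Omega_bar"
  shows "\<phi> x \<le> u (t, x)"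
proof -
  let ?Q = "{0<..<T} \<times> Omega"
  obtain ut uxx where "AE p in lebesgue_on ?Q. min (ut p - uxx p + b * u p) (u p - \<phi> (snd p)) = 0"
    using sol unfolding ae_solution_def Let_def by blast
  then have ae: "AE p in lebesgue_on ?Q. \<phi> (snd p) \<le> u p"
    by eventually_elim (auto simp: min_def split: if_splits)
  have "\<phi> (snd (t, x)) \<le> u (t, x)"
  proof (rule continuous_AE_le[where S="?Q" and D="{0..<T} \<times> Omega_bar" and f="\<lambda>p. \<phi> (snd p)", OF ae _ _ c])
    show "open ?Q" by (intro open_Times open_greaterThanLessThan)
    show "continuous_on ({0..<T} \<times> Omega_bar) (\<lambda>p. \<phi> (snd p))"
      by (rule continuous_on_compose2[OF p continuous_on_snd[OF continuous_on_id]]) auto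
    show "?Q \<subseteq> {0..<T} \<times> Omega_bar" by auto
    have "closure ?Q = {0..T} \<times> Omega_bar" using T by (simp add: closure_Times)
    then show "{0..<T} \<times> Omega_bar \<subseteq> closure ?Q" by auto
    show "(t, x) \<in> {0..<T} \<times> Omega_bar" using t x by simp
  qed
  then show ?thesis by simp
qed

lemma minimizing_scheme_step:
  assumes s: "minimizing_scheme T b \<phi> h U" and h: "h > 0" and p: "continuous_on Omega_bar \<phi>"
    and m: "m < nat \<lfloor>T / h\<rfloor>"
  shows "obstacle_step b h \<phi> (U m) (U (Suc m))"
proof -
  have S: "continuous_on Omega_bar (U k) \<and> is_arg_min (energy b h (U (k - 1))) (\<lambda>v. v \<in> admissible \<phi>) (U k)"
    if "1 \<le> k" "k \<le> nat \<lfloor>T / h\<rfloor>" for k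
    using s that unfolding minimizing_scheme_def by blast
  have U0: "U 0 = \<phi>" using s unfolding minimizing_scheme_def by blast
  have c: "continuous_on Omega_bar (U m)"
  proof (cases m)
    case 0 then show ?thesis using U0 p by simp
  next
    case (Suc k) then show ?thesis using S[of m] m by simp
  qed
  show ?thesis
    by (rule minimizer_obstacle_step[OF _ _ c p h]) (use S[of "Suc m"] m in simp_all)
qed

text \<open>With y = h^(1/4) this is y ln (1/y) \<le> 1; it makes the threshold \<open>h0\<close>
  explicit.\<close>

lemma sqrt_mult_abs_ln_le:
  assumes "0 < h" "h < 1"
  shows "sqrt h * \<bar>ln h\<bar> \<le> 4 * sqrt (sqrt h)"
proof -
  define y where "y = sqrt (sqrt h)"
  have y: "y > 0" "y * y = sqrt h" using assms by (simp_all add: y_def)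
  have hy: "h = y ^ 4"
  proof -
    have "y ^ 4 = (y * y) * (y * y)" by (simp add: power4_eq_xxxx mult.assoc)
    then show ?thesis using y(2) assms by simp
  qed
  have "ln (1 / y) \<le> 1 / y" using ln_bound[of "1 / y"] y(1) by simp
  then have "y * - ln y \<le> 1" using y(1) by (simp add: ln_div field_simps)
  then have "y * (y * - ln y) \<le> y * 1" using y(1) by (intro mult_left_mono) auto
  moreover have "ln h = 4 * ln y" unfolding hy using y(1) by (simp add: ln_realpow)
  then have "\<bar>ln h\<bar> = 4 * - ln y" using ln_less_zero[OF assms] by simp
  then have "sqrt h * \<bar>ln h\<bar> = 4 * (y * (y * - ln y))"
    by (simp only: y(2)[symmetric] mult_ac)
  ultimately show ?thesis unfolding y_def[symmetric] by linarith
qed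

theorem theorem2p1:
  fixes T q r :: real and u :: "real \<times> real \<Rightarrow> real"
  assumes "T > 0" and "q > 0" and "r > 0"
    and "q < r" and "r < q * exp 1"
    and "obstacle_problem_solution T (beta q r) (obstacle q r) u"
  shows "\<forall>\<delta>>0. \<exists>K>0. \<exists>h0>0. \<forall>h. 0 < h \<and> h < h0 \<longrightarrow>
           (\<forall>U. minimizing_scheme T (beta q r) (obstacle q r) h U \<longrightarrow>
              (SUP p\<in>{0..T - \<delta>} \<times> Omega_bar. ereal \<bar>interpolant h U p - u p\<bar>)
                \<le> ereal (K * sqrt h * \<bar>ln h\<bar>))"
proof (intro allI impI)
  fix \<delta> :: real assume \<delta>: "\<delta> > 0"
  define M where "M = exp (\<bar>alpha q r\<bar> + 1)"
  define C where "C = (alpha q r + 1)\<^sup>2 * exp (2 * \<bar>alpha q r + 1\<bar>)"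
  define S where "S = sqrt (T + 1)"
  define B where "B = 3 * M + 6 + 3 * C * S"
  \<comment> \<open>The second entry makes 12 S h^(1/4) \<le> \<delta>, so that the shifted indices
    stay within [0, T].\<close>
  define h0 where "h0 = min (exp (-1)) ((\<delta> / (12 * S)) ^ 4)"
  have S: "S > 0" using assms(1) by (simp add: S_def)
  have M: "M > 0" by (simp add: M_def)
  have C: "C \<ge> 0" by (simp add: C_def)
  have B: "B > 0" unfolding B_def using M C S by (intro add_pos_nonneg add_pos_pos) auto
  have h0: "h0 > 0" using \<delta> S by (simp add: h0_def)
  have b: "beta q r > 0" using assms(3) by (simp add: beta_def add_nonneg_pos)
  have u: "continuous_on ({0..<T} \<times> Omega_bar) u" "ae_solution T (beta q r) (obstacle q r) u"
    "viscosity_subsolution T (beta q r) (obstacle q r) u" "viscosity_supersolution T (beta q r) (obstacle q r) u"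
    "\<And>x. x \<in> Omega_bar \<Longrightarrow> u (0, x) = obstacle q r x"
    "\<And>t. t \<in> {0<..<T} \<Longrightarrow> u (t, -1) = obstacle q r (-1) \<and> u (t, 1) = obstacle q r 1"
    using assms(6) unfolding obstacle_problem_solution_def by blast+
  \<comment> \<open>The boundary values are prescribed for positive times only; at t = 0 they come
    from the initial condition.\<close>
  have bd: "u (t, -1) = obstacle q r (-1)" "u (t, 1) = obstacle q r 1" if "t \<in> {0..<T}" for t
    using u(5)[of "-1"] u(5)[of 1] u(6)[of t] that by (cases "t = 0"; simp)+
  have "(SUP p\<in>{0..T - \<delta>} \<times> Omega_bar. ereal \<bar>interpolant h U p - u p\<bar>) \<le> ereal (B * sqrt h * \<bar>ln h\<bar>)"
    if h: "0 < h" "h < h0" and U: "minimizing_scheme T (beta q r) (obstacle q r) h U" for h U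
  proof (rule SUP_least)
    fix p :: "real \<times> real" assume "p \<in> {0..T - \<delta>} \<times> Omega_bar"
    then obtain t x where p: "p = (t, x)" and t: "0 \<le> t" "t \<le> T - \<delta>" and x: "x \<in> Omega_bar"
      by (cases p) auto
    have h1: "h \<le> exp (-1)" using h(2) by (simp add: h0_def)
    have hlt1: "h < 1" using h1 exp_less_one_iff[of "-1"] by linarith
    have "3 * S * (sqrt h * \<bar>ln h\<bar>) \<le> 3 * S * (4 * sqrt (sqrt h))"
      using sqrt_mult_abs_ln_le[OF h(1) hlt1] S by (intro mult_left_mono) auto
    also have "\<dots> \<le> 3 * S * (4 * (\<delta> / (12 * S)))"
    proof -
      have "h \<le> (\<delta> / (12 * S)) ^ 4" using h(2) by (simp add: h0_def)
      then have "sqrt h \<le> (\<delta> / (12 * S))\<^sup>2" using \<delta> S by (intro real_le_lsqrt) (simp_all flip: power_mult)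
      then have "sqrt (sqrt h) \<le> \<delta> / (12 * S)" using \<delta> S by (metis real_le_lsqrt divide_nonneg_pos less_imp_le zero_less_mult_iff zero_less_numeral)
      then show ?thesis using S by (intro mult_left_mono) auto
    qed
    also have "\<dots> = \<delta>" using S by simp
    finally have small: "3 * sqrt (T + 1) * (sqrt h * \<bar>ln h\<bar>) \<le> \<delta>" by (simp add: S_def)
    interpret obstacle_comparison "beta q r" h C M "obstacle q r" U "nat \<lfloor>T / h\<rfloor>" T u
    proof unfold_locales
      show "U 0 = obstacle q r" using U unfolding minimizing_scheme_def by blast
      show "obstacle_step (beta q r) h (obstacle q r) (U m) (U (Suc m))" if "m < nat \<lfloor>T / h\<rfloor>" for m
        by (rule minimizing_scheme_step[OF U h(1) obstacle_continuous that])
      show "obstacle q r x \<le> u (t, x)" if "t \<in> {0..<T}" "x \<in> Omega_bar" for t x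
        by (rule solution_ge_obstacle[OF u(2,1) obstacle_continuous assms(1) that])
      show "\<exists>m. \<forall>y\<in>Omega_bar. obstacle q r y - max y 0 - C * y\<^sup>2 / 2 \<le> obstacle q r x - max x 0 - C * x\<^sup>2 / 2 + m * (y - x)"
        if "x \<in> Omega" for x
        unfolding C_def by (rule obstacle_semiconcave[OF that])
    qed (fact b h C obstacle_continuous u bd | simp add: obstacle_bounds M_def)+
    have "\<bar>U (nat \<lfloor>t / h\<rfloor>) x - u (t, x)\<bar> \<le> B * (sqrt h * \<bar>ln h\<bar>)"
      unfolding B_def S_def by (rule error_bound[OF h1 small refl t x \<delta>])
    then show "ereal \<bar>interpolant h U p - u p\<bar> \<le> ereal (B * sqrt h * \<bar>ln h\<bar>)"
      by (simp add: interpolant_def p mult.assoc)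
  qed
  then show "\<exists>K>0. \<exists>h0>0. \<forall>h. 0 < h \<and> h < h0 \<longrightarrow>
           (\<forall>U. minimizing_scheme T (beta q r) (obstacle q r) h U \<longrightarrow>
              (SUP p\<in>{0..T - \<delta>} \<times> Omega_bar. ereal \<bar>interpolant h U p - u p\<bar>)
                \<le> ereal (K * sqrt h * \<bar>ln h\<bar>))"
    using B h0 by blast
qed

end
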